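(* The function $$w(x):=\inf_{\tau\in\mathcal{T}} \mathbb{E}_x\left[e^{\int_0^{\tau} g(X_s)ds+G(X_\tau)}\right],\quad x\in E,$$ is continuous and bounded. Moreover, $\underline w(x)= w(x)=\overline w(x)$ for every $x\in E$, and the optimal stopping time for $w$ (i.e. a stopping time attaining the infimum, for every $x\in E$) is given by $$\hat{\tau}:=\inf\left\{t\geq 0: w(X_t)=e^{G(X_t)}\right\}.$$
   Context: Setting: $(\Omega,\mathcal{F},(\mathcal{F}_t)_{t\geq 0},\mathbb{P})$ is a filtered probability space satisfying the usual conditions, with $\mathcal{F}_0$ trivial. $X=(X_t)_{t\ge 0}$ is a time-homogeneous standard Markov process (right-continuous, strong Markov, quasi-left-continuous: if stopping times $\sigma_n\uparrow\sigma$, then $X_{\sigma_n}\to X_\sigma$ a.s. on $\{\sigma<\infty\}$) with values in a locally compact separable metric space $(E,\rho)$ with its Borel $\sigma$-field; $\mathbb{P}_x,\mathbb{E}_x$ denote probability and expectation when $X_0=x$. The transition semigroup $P_tf(x)=\mathbb{E}_x[f(X_t)]$ is $C_0$-Feller: $P_tC_0(E)\subset C_0(E)$ for each $t\ge 0$, where $C_0(E)$ is the set of continuous bounded functions vanishing at infinity. The functions $g,G:E\to\mathbb{R}$ are continuous, bounded and non-negative, and $g(\cdot)\geq c$ for some constant $c>0$. $\mathcal{T}$ is the family of almost surely finite $(\mathcal{F}_t)$-stopping times with values in $[0,\infty)$. Convention: for a process $(Z_t)$ and $\tau\in\mathcal{T}$, $\mathbb{E}_x[Z_\tau]:=\liminf_{n\to\infty}\mathbb{E}_x[Z_{\tau\wedge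 n}]$. For $T\ge 0$ and $x\in E$, with infima over stopping times $\tau\in\mathcal{T}$ with $\tau\le T$, $$\underline{w}_T(x):=\inf_{\tau\leq T} \mathbb{E}_x\left[e^{\int_0^\tau g(X_s)ds + 1_{\{\tau<T\}}G(X_\tau) }\right],\qquad \overline{w}_T(x):=\inf_{\tau\leq T} \mathbb{E}_x\left[e^{\int_0^{\tau} g(X_s)ds+G(X_{\tau})}\right].$$ For each $x$, $T\mapsto\underline w_T(x)$ is non-decreasing and $T\mapsto\overline w_T(x)$ is non-increasing, and one sets $\underline w(x):=\lim_{T\to\infty}\underline w_{T}(x)$ and $\overline w(x):=\lim_{T\to\infty}\overline w_{T}(x)$. *)

theory Defs
  imports "HOL-Probability.Probability"
begin

text \<open>
  Time is indexed by \<^typ>\<open>ennreal\<close> for filtrations and stopping times, so that the library notions of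
  filtration, stopping time and \<open>pre_sigma\<close> apply to stopping times that may be infinite; the member
  \<open>F \<infinity>\<close> of a filtration is any \<open>\<sigma>\<close>-algebra containing all the others. Processes are indexed by
  \<^typ>\<open>real\<close>, and only the times \<open>t \<ge> 0\<close> matter.
\<close>

locale usual_conditions = prob_space M + complete_measure M + filtration "space M" F
  for M :: "'w measure" and F :: "ennreal \<Rightarrow> 'w measure" +
  assumes subalgebra_F: "\<And>t. subalgebra M (F t)"
    and null_sets_F0: "null_sets M \<subseteq> sets (F 0)"
    and right_continuous_F: "\<And>t. t < \<infinity> \<Longrightarrow> sets (F t) = (\<Inter>s\<in>{t<..}. sets (F s))"

text \<open>
  The law \<open>P x\<close> is the one under which the process starts at \<open>x\<close>. The usual conditions refer to a
  single probability measure, so the \<open>\<sigma>\<close>-algebra of events (that of \<open>P x\<close>) and the filtration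
  \<open>F x\<close> carry the index \<open>x\<close> too; the space \<open>\<Omega>\<close> and the process \<open>X\<close> do not depend on it.
\<close>

locale standard_markov_process =
  fixes \<Omega> :: "'w set"
    and P :: "'e::{metric_space, second_countable_topology} \<Rightarrow> 'w measure"
    and F :: "'e \<Rightarrow> ennreal \<Rightarrow> 'w measure"
    and X :: "real \<Rightarrow> 'w \<Rightarrow> 'e"
  assumes locally_compact_E: "locally_compact_space (euclidean :: 'e topology)"
    and space_P: "\<And>x. space (P x) = \<Omega>"
    and usual_conditions_P: "\<And>x. usual_conditions (P x) (F x)"
    and F0_trivial: "\<And>x A. A \<in> sets (F x 0) \<Longrightarrow> measure (P x) A = 0 \<or> measure (P x) A = 1"
    and adapted: "\<And>x t. t \<ge> 0 \<Longrightarrow> X t \<in> borel_measurable (F x (ennreal t))"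
    and initial: "\<And>x. AE \<omega> in P x. X 0 \<omega> = x"
    and right_continuous_paths:
      "\<And>\<omega> t. \<omega> \<in> \<Omega> \<Longrightarrow> t \<ge> 0 \<Longrightarrow> continuous (at_right t) (\<lambda>s. X s \<omega>)"
    and strong_markov:
      "\<And>x \<sigma> s (f :: 'e \<Rightarrow> real).
         stopping_time (F x) \<sigma> \<Longrightarrow> s \<ge> 0 \<Longrightarrow> f \<in> borel_measurable borel \<Longrightarrow> bounded (range f) \<Longrightarrow>
         AE \<omega> in P x. \<sigma> \<omega> < \<infinity> \<longrightarrow>
           real_cond_exp (P x) (filtration.pre_sigma \<Omega> (F x) \<sigma>)
             (\<lambda>\<omega>. f (X (enn2real (\<sigma> \<omega>) + s) \<omega>)) \<omega>
           = (\<integral>\<omega>'. f (X s \<omega>') \<partial>P (X (enn2real (\<sigma> \<omega>)) \<omega>))"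
    and quasi_left_continuous:
      "\<And>x (\<sigma> :: nat \<Rightarrow> 'w \<Rightarrow> ennreal).
         (\<And>n. stopping_time (F x) (\<sigma> n)) \<Longrightarrow> (\<And>\<omega>. \<omega> \<in> \<Omega> \<Longrightarrow> incseq (\<lambda>n. \<sigma> n \<omega>)) \<Longrightarrow>
         AE \<omega> in P x. (SUP n. \<sigma> n \<omega>) < \<infinity> \<longrightarrow>
           (\<lambda>n. X (enn2real (\<sigma> n \<omega>)) \<omega>) \<longlonglongrightarrow> X (enn2real (SUP n. \<sigma> n \<omega>)) \<omega>"

definition C0 :: "('e::topological_space \<Rightarrow> real) set" where
  "C0 = {f. continuous_on UNIV f \<and> bounded (range f) \<and>
            (\<forall>\<epsilon>>0. \<exists>K. compact K \<and> (\<forall>x. x \<notin> K \<longrightarrow> \<bar>f x\<bar> < \<epsilon>))}"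

definition semigroup :: "('e \<Rightarrow> 'w measure) \<Rightarrow> (real \<Rightarrow> 'w \<Rightarrow> 'e) \<Rightarrow> real \<Rightarrow> ('e \<Rightarrow> real) \<Rightarrow> 'e \<Rightarrow> real"
  where "semigroup P X t f x = (\<integral>\<omega>. f (X t \<omega>) \<partial>P x)"

definition C0_feller ::
    "('e::topological_space \<Rightarrow> 'w measure) \<Rightarrow> (real \<Rightarrow> 'w \<Rightarrow> 'e) \<Rightarrow> bool" where
  "C0_feller P X \<longleftrightarrow> (\<forall>t\<ge>0. semigroup P X t ` C0 \<subseteq> C0)"

definition finite_stopping_times ::
    "'w measure \<Rightarrow> (ennreal \<Rightarrow> 'w measure) \<Rightarrow> ('w \<Rightarrow> ennreal) set" where
  "finite_stopping_times M F = {\<tau>. stopping_time F \<tau> \<and> (AE \<omega> in M. \<tau> \<omega> < \<infinity>)}"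

definition bounded_stopping_times ::
    "'w measure \<Rightarrow> (ennreal \<Rightarrow> 'w measure) \<Rightarrow> real \<Rightarrow> ('w \<Rightarrow> ennreal) set" where
  "bounded_stopping_times M F T =
     {\<tau> \<in> finite_stopping_times M F. \<forall>\<omega>\<in>space M. \<tau> \<omega> \<le> ennreal T}"

text \<open>
  The convention \<open>E[Z\<^sub>\<tau>] := liminf\<^sub>n E[Z\<^bsub>min \<tau> n\<^esub>]\<close>, for nonnegative processes. If \<open>\<tau>\<close> is bounded,
  the sequence is eventually constant, and this is the ordinary expectation of \<open>Z\<^sub>\<tau>\<close>.
\<close>

definition stopped_expectation ::
    "'w measure \<Rightarrow> (real \<Rightarrow> 'w \<Rightarrow> real) \<Rightarrow> ('w \<Rightarrow> ennreal) \<Rightarrow> ennreal" where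
  "stopped_expectation M Z \<tau> =
     liminf (\<lambda>n. \<integral>\<^sup>+\<omega>. ennreal (Z (enn2real (min (\<tau> \<omega>) (of_nat n))) \<omega>) \<partial>M)"

definition payoff ::
    "(real \<Rightarrow> 'w \<Rightarrow> 'e) \<Rightarrow> ('e \<Rightarrow> real) \<Rightarrow> ('e \<Rightarrow> real) \<Rightarrow> real \<Rightarrow> 'w \<Rightarrow> real" where
  "payoff X g G t \<omega> = exp ((LINT s:{0..t}|lborel. g (X s \<omega>)) + G (X t \<omega>))"

definition lower_payoff ::
    "(real \<Rightarrow> 'w \<Rightarrow> 'e) \<Rightarrow> ('e \<Rightarrow> real) \<Rightarrow> ('e \<Rightarrow> real) \<Rightarrow> real \<Rightarrow> real \<Rightarrow> 'w \<Rightarrow> real" where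
  "lower_payoff X g G T t \<omega> =
     exp ((LINT s:{0..t}|lborel. g (X s \<omega>)) + of_bool (t < T) * G (X t \<omega>))"

definition opt_value ::
    "('e \<Rightarrow> 'w measure) \<Rightarrow> ('e \<Rightarrow> ennreal \<Rightarrow> 'w measure) \<Rightarrow> (real \<Rightarrow> 'w \<Rightarrow> 'e) \<Rightarrow>
      ('e \<Rightarrow> real) \<Rightarrow> ('e \<Rightarrow> real) \<Rightarrow> 'e \<Rightarrow> ennreal" where
  "opt_value P F X g G x =
     (INF \<tau>\<in>finite_stopping_times (P x) (F x). stopped_expectation (P x) (payoff X g G) \<tau>)"

definition lower_value_upto ::
    "('e \<Rightarrow> 'w measure) \<Rightarrow> ('e \<Rightarrow> ennreal \<Rightarrow> 'w measure) \<Rightarrow> (real \<Rightarrow> 'w \<Rightarrow> 'e) \<Rightarrow>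
      ('e \<Rightarrow> real) \<Rightarrow> ('e \<Rightarrow> real) \<Rightarrow> real \<Rightarrow> 'e \<Rightarrow> ennreal" where
  "lower_value_upto P F X g G T x =
     (INF \<tau>\<in>bounded_stopping_times (P x) (F x) T.
        stopped_expectation (P x) (lower_payoff X g G T) \<tau>)"

definition upper_value_upto ::
    "('e \<Rightarrow> 'w measure) \<Rightarrow> ('e \<Rightarrow> ennreal \<Rightarrow> 'w measure) \<Rightarrow> (real \<Rightarrow> 'w \<Rightarrow> 'e) \<Rightarrow>
      ('e \<Rightarrow> real) \<Rightarrow> ('e \<Rightarrow> real) \<Rightarrow> real \<Rightarrow> 'e \<Rightarrow> ennreal" where
  "upper_value_upto P F X g G T x =
     (INF \<tau>\<in>bounded_stopping_times (P x) (F x) T. stopped_expectation (P x) (payoff X g G) \<tau>)"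

definition lower_value ::
    "('e \<Rightarrow> 'w measure) \<Rightarrow> ('e \<Rightarrow> ennreal \<Rightarrow> 'w measure) \<Rightarrow> (real \<Rightarrow> 'w \<Rightarrow> 'e) \<Rightarrow>
      ('e \<Rightarrow> real) \<Rightarrow> ('e \<Rightarrow> real) \<Rightarrow> 'e \<Rightarrow> ennreal" where
  "lower_value P F X g G x = Lim at_top (\<lambda>T. lower_value_upto P F X g G T x)"

definition upper_value ::
    "('e \<Rightarrow> 'w measure) \<Rightarrow> ('e \<Rightarrow> ennreal \<Rightarrow> 'w measure) \<Rightarrow> (real \<Rightarrow> 'w \<Rightarrow> 'e) \<Rightarrow>
      ('e \<Rightarrow> real) \<Rightarrow> ('e \<Rightarrow> real) \<Rightarrow> 'e \<Rightarrow> ennreal" where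
  "upper_value P F X g G x = Lim at_top (\<lambda>T. upper_value_upto P F X g G T x)"

definition optimal_time ::
    "('e \<Rightarrow> 'w measure) \<Rightarrow> ('e \<Rightarrow> ennreal \<Rightarrow> 'w measure) \<Rightarrow> (real \<Rightarrow> 'w \<Rightarrow> 'e) \<Rightarrow>
      ('e \<Rightarrow> real) \<Rightarrow> ('e \<Rightarrow> real) \<Rightarrow> 'w \<Rightarrow> ennreal" where
  "optimal_time P F X g G \<omega> =
     Inf {ennreal t | t. t \<ge> 0 \<and> opt_value P F X g G (X t \<omega>) = ennreal (exp (G (X t \<omega>)))}"

end

theory Submission
  imports Defs
begin

text \<open>
  Put \<open>h = e\<^sup>G\<close> and let \<open>Q\<^sub>t f(x) = E\<^sub>x[exp(\<integral>\<^sub>0\<^sup>t g(X\<^sub>s) ds) f(X\<^sub>t)]\<close>. Stopping on the grid of mesh \<open>2\<^sup>-\<^sup>k\<close> is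
  solved by iterating the Bellman operator \<open>f \<mapsto> min h (Q\<^sub>d f)\<close>. This operator is concave, and since
  \<open>g \<ge> c\<close> it lifts constants below \<open>1\<close> exponentially fast; so the iterations started at \<open>h\<close> (upper values)
  and at \<open>1\<close> (lower values) approach each other geometrically, uniformly in \<open>x\<close> and in the mesh, and all
  three values coincide.

  The common value \<open>w\<close> is upper semicontinuous as an infimum of continuous grid values. For lower
  semicontinuity, \<open>h\<close> is truncated to \<open>1 + (h - 1) \<eta>\<close> with a cutoff \<open>\<eta>\<close>: the Feller semigroup is strongly
  continuous on \<open>C\<^sub>0\<close>, which makes the grid values of the truncated problem converge uniformly as the mesh
  vanishes, and quasi-left-continuity keeps the process in compact sets, which makes the truncation
  negligible.

  If \<open>\<tau>\<^sub>n\<close> are nearly optimal grid times, then \<open>(h - w)(X(\<tau>\<^sub>n))\<close> tends to \<open>0\<close> almost surely along a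
  subsequence, so the first entrance into \<open>{h - w < \<epsilon>}\<close> happens before \<open>\<tau>\<^sub>n\<close> for large \<open>n\<close>. Optional sampling
  for the submartingale \<open>exp(\<integral> g) w(X)\<close> and Fatou's lemma bound the cost of these entrance times by \<open>w\<close>;
  by quasi-left-continuity they increase to the contact time as \<open>\<epsilon>\<close> tends to \<open>0\<close>.
\<close>

section \<open>Weakly convergent sequences in \<open>C\<^sub>0\<close>\<close>

text \<open>The exponent of the running cost is positive, so constants grow under \<open>Q\<close>
  and letting the horizon tend to infinity is not harmless. Horizons are compared through the
  geometric gap, whose ratio depends only on \<open>c\<close> and on the bound \<open>H\<close> of
  the reward; neither the mesh nor the starting point enters.

  The Feller hypothesis concerns each fixed time separately, so strong continuity has to be
  extracted from the right-continuity of paths. Pointwise convergence as time tends to 0 is easy;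
  uniformity comes from convex combinations, whence the functional-analytic beginning.

  The weight \<open>exp (I t)\<close> depends on the whole path, whereas the Markov property yields
  finitely many times. The semigroup law of \<open>Q\<close> and its Markov property are therefore
  proved for right-endpoint Riemann sums and passed to the limit, and continuity of
  \<open>Q r f\<close> in the starting point is reduced to finite-dimensional distributions by the
  power series of the exponential.

  Meshes are dyadic so that the grids are nested and the grid values monotone. Rounding always goes
  up: this suits right-continuous paths and preserves stopping times.\<close>

instance bcontfun :: (metric_space, banach) banach ..

text \<open>A form of Simons' inequality. If all convex combinations had norm at least
  \<open>e\<close>, a greedy choice of \<open>u k\<close> in the hulls of the tails would give a
  series whose norm exceeds that of each partial sum by a definite amount. But the limit lies in
  \<open>K\<close>, so its norm is its value at some point \<open>y\<close>, and at \<open>y\<close>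
  the late terms are small.\<close>

lemma Simons_small_convex_combination:
  fixes f :: "nat \<Rightarrow> 'a::metric_space \<Rightarrow>\<^sub>C real"
  assumes add: "\<And>u v. u \<in> K \<Longrightarrow> v \<in> K \<Longrightarrow> u + v \<in> K"
    and scale: "\<And>u a. u \<in> K \<Longrightarrow> a \<ge> 0 \<Longrightarrow> a *\<^sub>R u \<in> K"
    and "closed K"
    and attained: "\<And>u. u \<in> K \<Longrightarrow> \<exists>x. apply_bcontfun u x = norm u"
    and f_K: "\<And>n. f n \<in> K"
    and f_bound: "\<And>n. norm (f n) \<le> B"
    and f_lim: "\<And>x. (\<lambda>n. apply_bcontfun (f n) x) \<longlonglongrightarrow> 0"
    and "e > 0"
  shows "\<exists>u\<in>convex hull (range f). norm u < e"
proof (rule ccontr)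
  assume "\<not> ?thesis"
  then have large: "norm u \<ge> e" if "u \<in> convex hull (range f)" for u
    using that by force
  define C where "C k = convex hull (f ` {k..})" for k
  have C_ne: "C k \<noteq> {}" for k
    by (auto simp: C_def)
  have convex_K: "convex K"
    by (rule convexI) (auto intro: add scale)
  have C_K: "C k \<subseteq> K" for k
    unfolding C_def by (rule hull_minimal) (use f_K convex_K in auto)
  have C_mono: "C j \<subseteq> C k" if "k \<le> j" for k j
    unfolding C_def by (rule hull_mono) (use that in auto)
  have C_large: "norm u \<ge> e" if "u \<in> C k" for u k
    using large that hull_mono[of "f ` {k..}" "range f" convex] unfolding C_def by auto
  have C_bound: "norm u \<le> B" if "u \<in> C k" for u k
  proof -
    have "C k \<subseteq> cball 0 B"
      unfolding C_def by (rule hull_minimal) (use f_bound in auto)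
    with that show ?thesis by auto
  qed
  have convex_C: "convex (C k)" for k
    by (simp add: C_def)
  \<comment> \<open>\<open>a k\<close> is the total weight of the series of \<open>1 / 2 ^ j\<close>
    from the index \<open>k\<close> on.\<close>
  define a :: "nat \<Rightarrow> real" where "a k = 2 / 2 ^ k" for k :: nat
  \<comment> \<open>All the remaining weight is placed on a single element of \<open>C k\<close>
    that makes the norm nearly minimal. The tolerance decays like \<open>1 / 4 ^ k\<close>, faster
    than the gap of order \<open>1 / 2 ^ k\<close> that it must not destroy.\<close>
  have "\<exists>u\<in>C k. \<forall>v\<in>C k. norm (H + a k *\<^sub>R u) \<le> norm (H + a k *\<^sub>R v) + e / 4 / 4 ^ k" for k H
  proof -
    let ?S = "(\<lambda>u. norm (H + a k *\<^sub>R u)) ` C k"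
    have bdd: "bdd_below ?S" by (rule bdd_belowI[of _ 0]) auto
    have "Inf ?S < Inf ?S + e / 4 / 4 ^ k" using \<open>e > 0\<close> by simp
    then obtain u where u: "u \<in> C k" "norm (H + a k *\<^sub>R u) < Inf ?S + e / 4 / 4 ^ k"
      using cInf_lessD[of ?S] C_ne by blast
    have "Inf ?S \<le> norm (H + a k *\<^sub>R v)" if "v \<in> C k" for v
      using bdd that by (auto intro!: cInf_lower)
    with u show ?thesis by (intro bexI[of _ u]) force+
  qed
  then obtain gg where gg: "\<And>k H. gg k H \<in> C k"
      "\<And>k H v. v \<in> C k \<Longrightarrow> norm (H + a k *\<^sub>R gg k H) \<le> norm (H + a k *\<^sub>R v) + e / 4 / 4 ^ k"
    by metis
  define H where "H = rec_nat 0 (\<lambda>k h. h + (1 / 2 ^ k) *\<^sub>R gg k h)"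
  define u where "u k = gg k (H k)" for k
  have H_0: "H 0 = 0" and H_Suc: "H (Suc k) = H k + (1 / 2 ^ k) *\<^sub>R u k" for k
    by (simp_all add: H_def u_def)
  have u_C: "u k \<in> C k" for k
    by (simp add: u_def gg)
  have u_min: "norm (H k + a k *\<^sub>R u k) \<le> norm (H k + a k *\<^sub>R v) + e / 4 / 4 ^ k" if "v \<in> C k" for k v
    using gg(2)[OF that] by (simp add: u_def)
  have H_sum: "H n = (\<Sum>k<n. (1 / 2 ^ k) *\<^sub>R u k)" for n
    by (induction n) (auto simp: H_0 H_Suc add.commute)
  have "summable (\<lambda>k. (1 / 2 ^ k) *\<^sub>R u k)"
  proof (rule summable_comparison_test')
    show "summable (\<lambda>k. (1/2) ^ k * B)"
      by (intro summable_mult2 summable_geometric) auto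
    show "norm ((1 / 2 ^ k) *\<^sub>R u k) \<le> (1/2) ^ k * B" if "k \<ge> 0" for k
      using C_bound[OF u_C[of k]] by (simp add: power_one_over field_simps)
  qed
  then obtain h where H_lim: "H \<longlonglongrightarrow> h"
    unfolding summable_def sums_def H_sum[symmetric, abs_def] by blast
  have H_K: "H n \<in> K" for n
  proof (induction n)
    case 0
    show ?case using scale[OF f_K[of 0], of 0] by (simp add: H_0)
  next
    case (Suc n)
    then show ?case unfolding H_Suc using u_C[of n] C_K[of n] by (intro add scale) auto
  qed
  have h_K: "h \<in> K"
    using \<open>closed K\<close> H_K H_lim closed_sequentially by blast
  \<comment> \<open>Since \<open>a n = 1 / 2 ^ n + a (Suc n)\<close> with equal summands, sharing
    the remaining weight between \<open>u n\<close> and \<open>v\<close> amounts to using their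
    midpoint, which is in the hull. So everything reached later competes in the minimisation at
    stage \<open>k\<close>.\<close>
  have tail: "\<exists>c\<in>C k. H n + a n *\<^sub>R v = H k + a k *\<^sub>R c" if "k \<le> n" "v \<in> C n" for k n v
    using that
  proof (induction n arbitrary: v rule: dec_induct)
    case base
    then show ?case by auto
  next
    case (step n)
    have "(1/2) *\<^sub>R u n + (1/2) *\<^sub>R v \<in> C n"
      using convexD[OF convex_C u_C[of n], of v "1/2" "1/2"] step.prems C_mono[of n "Suc n"] by auto
    moreover have "H (Suc n) + a (Suc n) *\<^sub>R v = H n + a n *\<^sub>R ((1/2) *\<^sub>R u n + (1/2) *\<^sub>R v)"
      by (simp add: H_Suc a_def scaleR_add_right algebra_simps)
    ultimately show ?case using step.IH by auto
  qed
  have a_lim: "a \<longlonglongrightarrow> 0"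
  proof -
    have "(\<lambda>k. 2 * (1/2::real) ^ k) \<longlonglongrightarrow> 2 * 0"
      by (intro tendsto_mult tendsto_const LIMSEQ_power_zero) auto
    then show ?thesis by (simp add: a_def[abs_def] power_one_over)
  qed
  have "(\<lambda>n. a n *\<^sub>R u n) \<longlonglongrightarrow> 0"
  proof (rule Lim_null_comparison)
    show "\<forall>\<^sub>F n in sequentially. norm (a n *\<^sub>R u n) \<le> a n * B"
      using C_bound[OF u_C] by (intro always_eventually) (auto simp: a_def intro!: divide_right_mono)
    show "(\<lambda>n. a n * B) \<longlonglongrightarrow> 0"
      using tendsto_mult_left_zero[OF a_lim] by simp
  qed
  then have "(\<lambda>n. H n + a n *\<^sub>R u n) \<longlonglongrightarrow> h + 0"
    by (intro tendsto_add H_lim)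
  then have norm_lim: "(\<lambda>n. norm (H n + a n *\<^sub>R u n)) \<longlonglongrightarrow> norm h"
    using tendsto_norm by force
  have h_ge: "norm (H k + a k *\<^sub>R u k) - e / 4 / 4 ^ k \<le> norm h" for k
  proof (rule LIMSEQ_le_const[OF norm_lim], intro exI[of _ k] allI impI)
    fix n assume "k \<le> n"
    with tail[OF this u_C] obtain c where "c \<in> C k" "H n + a n *\<^sub>R u n = H k + a k *\<^sub>R c" by auto
    then show "norm (H k + a k *\<^sub>R u k) - e / 4 / 4 ^ k \<le> norm (H n + a n *\<^sub>R u n)"
      using u_min by force
  qed
  \<comment> \<open>\<open>H (Suc k)\<close> is the midpoint of \<open>H k\<close> and
    \<open>H k + a k *\<^sub>R u k\<close>, and the norm of the latter exceeds \<open>norm h\<close>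
    by at most the tolerance; so each step loses little more than half of the gap. The second
    summand pays for the accumulated tolerances.\<close>
  have gap: "norm h - norm (H k) \<ge> e / 2 ^ k + e / 2 / 4 ^ k" for k
  proof (induction k)
    case 0
    have "norm (a 0 *\<^sub>R u 0) \<ge> 2 * e" using C_large[OF u_C[of 0]] by (simp add: a_def)
    with h_ge[of 0] \<open>e > 0\<close> show ?case by (simp add: H_0)
  next
    case (Suc k)
    have "H (Suc k) = (1/2) *\<^sub>R (H k + a k *\<^sub>R u k) + (1/2) *\<^sub>R H k"
    proof -
      have "(1/2) *\<^sub>R (H k + a k *\<^sub>R u k) + (1/2) *\<^sub>R H k = ((1/2) *\<^sub>R H k + (1/2) *\<^sub>R H k) + (1/2 * a k) *\<^sub>R u k"
        by (simp add: scaleR_add_right)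
      also have "(1/2) *\<^sub>R H k + (1/2) *\<^sub>R H k = H k"
        by (simp flip: scaleR_left_distrib)
      finally show ?thesis by (simp add: H_Suc a_def)
    qed
    then have "norm (H (Suc k)) \<le> norm ((1/2) *\<^sub>R (H k + a k *\<^sub>R u k)) + norm ((1/2) *\<^sub>R H k)"
      using norm_triangle_ineq by metis
    also have "\<dots> = norm (H k + a k *\<^sub>R u k) / 2 + norm (H k) / 2" by simp
    also have "\<dots> \<le> (norm h + e / 4 / 4 ^ k) / 2 + norm (H k) / 2"
      using h_ge[of k] by simp
    finally have "norm h - norm (H (Suc k)) \<ge> (norm h - norm (H k)) / 2 - e / 8 / 4 ^ k"
      by (simp add: field_simps)
    also have "(norm h - norm (H k)) / 2 - e / 8 / 4 ^ k \<ge> (e / 2 ^ k + e / 2 / 4 ^ k) / 2 - e / 8 / 4 ^ k"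
      by (rule diff_right_mono, rule divide_right_mono, rule Suc.IH) simp
    also have "(e / 2 ^ k + e / 2 / 4 ^ k) / 2 - e / 8 / 4 ^ k = e / 2 ^ Suc k + e / 2 / 4 ^ Suc k"
      by (simp add: add_divide_distrib)
    finally show ?case .
  qed
  \<comment> \<open>Past a suitable \<open>k\<close> the given sequence is below
    \<open>e / 4\<close> at the point \<open>y\<close>, and hence so is every \<open>u n\<close>.
    The tail of the series then contributes at most \<open>2 / 2 ^ k\<close> times
    \<open>e / 4\<close> at \<open>y\<close>, which is half of the gap just established.\<close>
  obtain y where y: "apply_bcontfun h y = norm h"
    using attained[OF h_K] by auto
  have "\<forall>\<^sub>F n in sequentially. apply_bcontfun (f n) y < e / 4"
    using f_lim[of y] \<open>e > 0\<close> by (intro order_tendstoD) auto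
  then obtain k where k: "\<And>n. n \<ge> k \<Longrightarrow> apply_bcontfun (f n) y < e / 4"
    by (auto simp: eventually_sequentially)
  have u_y: "apply_bcontfun (u n) y \<le> e / 4" if "n \<ge> k" for n
  proof -
    have "convex {v. apply_bcontfun v y \<le> e / 4}"
    proof (rule convexI)
      fix v w :: "'a \<Rightarrow>\<^sub>C real" and s t :: real
      assume "v \<in> {v. apply_bcontfun v y \<le> e / 4}" "w \<in> {v. apply_bcontfun v y \<le> e / 4}"
        "0 \<le> s" "0 \<le> t" "s + t = 1"
      then show "s *\<^sub>R v + t *\<^sub>R w \<in> {v. apply_bcontfun v y \<le> e / 4}"
        using convex_bound_le[of "apply_bcontfun v y" "e/4" "apply_bcontfun w y" s t] by simp
    qed
    then have "C n \<subseteq> {v. apply_bcontfun v y \<le> e / 4}"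
      unfolding C_def using k[THEN less_imp_le] that by (intro hull_minimal) auto
    with u_C[of n] show ?thesis by auto
  qed
  have "apply_bcontfun (H n) y - apply_bcontfun (H k) y \<le> (2 / 2 ^ k - 2 / 2 ^ n) * (e / 4)" if "n \<ge> k" for n
    using that
  proof (induction n rule: dec_induct)
    case (step n)
    have "apply_bcontfun (H (Suc n)) y - apply_bcontfun (H k) y
        = (apply_bcontfun (H n) y - apply_bcontfun (H k) y) + apply_bcontfun (u n) y / 2 ^ n"
      by (simp add: H_Suc)
    also have "\<dots> \<le> (2 / 2 ^ k - 2 / 2 ^ n) * (e / 4) + e / 4 / 2 ^ n"
      by (rule add_mono[OF step.IH divide_right_mono[OF u_y[OF step.hyps(1)]]]) simp
    also have "\<dots> = (2 / 2 ^ k - 2 / 2 ^ Suc n) * (e / 4)"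
      by (simp add: left_diff_distrib diff_divide_distrib)
    finally show ?case .
  qed auto
  moreover have "(2 / 2 ^ k - 2 / 2 ^ n) * (e / 4) \<le> e / 2 / 2 ^ k" for n
    using \<open>e > 0\<close> by (simp add: left_diff_distrib diff_divide_distrib)
  ultimately have le: "apply_bcontfun (H n) y - apply_bcontfun (H k) y \<le> e / 2 / 2 ^ k" if "n \<ge> k" for n
    using that order_trans by blast
  have "(\<lambda>n. apply_bcontfun (H n) y) \<longlonglongrightarrow> apply_bcontfun h y"
    by (rule tendsto_uniform_limitI[OF tendsto_bcontfun_uniform_limit[OF H_lim]]) simp
  then have "apply_bcontfun h y - apply_bcontfun (H k) y \<le> e / 2 / 2 ^ k"
    by (rule LIMSEQ_le_const2[OF tendsto_diff[OF _ tendsto_const]], intro exI[of _ k] allI impI le)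
  moreover have "apply_bcontfun (H k) y \<le> norm (H k)"
    using norm_bounded[of "H k" y] by simp
  ultimately have "norm h - norm (H k) \<le> e / 2 / 2 ^ k"
    using y by simp
  moreover have "e / 2 / 2 ^ k \<le> e / 2 ^ k"
    using \<open>e > 0\<close> by (intro divide_right_mono) auto
  moreover have "0 < e / 2 / 4 ^ k"
    using \<open>e > 0\<close> by simp
  ultimately show False
    using gap[of k] by linarith
qed


section \<open>Algebra, closedness and maxima of \<open>C0\<close> functions\<close>

lemma C0I:
  assumes "continuous_on UNIV f" "bounded (range f)"
    and "\<And>\<epsilon>. \<epsilon> > 0 \<Longrightarrow> \<exists>K. compact K \<and> (\<forall>x. x \<notin> K \<longrightarrow> \<bar>f x\<bar> < \<epsilon>)"
  shows "f \<in> C0"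
  using assms by (auto simp: C0_def)

lemma C0_continuous: "f \<in> C0 \<Longrightarrow> continuous_on UNIV f"
  and C0_bounded: "f \<in> C0 \<Longrightarrow> bounded (range f)"
  and C0_vanishes: "f \<in> C0 \<Longrightarrow> \<epsilon> > 0 \<Longrightarrow> \<exists>K. compact K \<and> (\<forall>x. x \<notin> K \<longrightarrow> \<bar>f x\<bar> < \<epsilon>)"
  by (auto simp: C0_def)

lemma bounded_rangeI: "(\<And>x. \<bar>f x\<bar> \<le> B) \<Longrightarrow> bounded (range (f :: 'a \<Rightarrow> real))"
  by (rule boundedI[of _ B]) auto

lemma bounded_rangeE:
  assumes "bounded (range (f :: 'a \<Rightarrow> real))"
  obtains B where "B \<ge> 0" "\<And>x. \<bar>f x\<bar> \<le> B"
proof -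
  obtain B where B: "\<And>x. norm (f x) \<le> B"
    using assms unfolding bounded_iff by auto
  have "B \<ge> 0" using order_trans[OF norm_ge_zero B] .
  with B that show thesis by simp
qed

lemma C0_add:
  fixes f g :: "'a::t2_space \<Rightarrow> real"
  assumes f: "f \<in> C0" and g: "g \<in> C0"
  shows "(\<lambda>x. f x + g x) \<in> C0"
proof (rule C0I)
  show "continuous_on UNIV (\<lambda>x. f x + g x)"
    by (intro continuous_intros C0_continuous f g)
  show "bounded (range (\<lambda>x. f x + g x))"
    by (intro bounded_plus_comp C0_bounded f g)
  fix \<epsilon> :: real assume "\<epsilon> > 0"
  then have "\<epsilon> / 2 > 0" by simp
  obtain K where K: "compact K" "\<And>x. x \<notin> K \<Longrightarrow> \<bar>f x\<bar> < \<epsilon> / 2"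
    using C0_vanishes[OF f \<open>\<epsilon> / 2 > 0\<close>] by auto
  obtain L where L: "compact L" "\<And>x. x \<notin> L \<Longrightarrow> \<bar>g x\<bar> < \<epsilon> / 2"
    using C0_vanishes[OF g \<open>\<epsilon> / 2 > 0\<close>] by auto
  show "\<exists>K. compact K \<and> (\<forall>x. x \<notin> K \<longrightarrow> \<bar>f x + g x\<bar> < \<epsilon>)"
    by (rule exI[of _ "K \<union> L"]) (use K L in \<open>fastforce intro: compact_Un\<close>)
qed

lemma C0_mult_bounded:
  fixes f g :: "'a::topological_space \<Rightarrow> real"
  assumes f: "f \<in> C0" and g: "continuous_on UNIV g" "bounded (range g)"
  shows "(\<lambda>x. g x * f x) \<in> C0"
proof (rule C0I)
  obtain B where B: "B \<ge> 0" "\<And>x. \<bar>g x\<bar> \<le> B" using bounded_rangeE[OF g(2)] by metis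
  obtain B' where B': "B' \<ge> 0" "\<And>x. \<bar>f x\<bar> \<le> B'" using bounded_rangeE[OF C0_bounded[OF f]] by metis
  show "continuous_on UNIV (\<lambda>x. g x * f x)"
    by (intro continuous_intros C0_continuous f g)
  show "bounded (range (\<lambda>x. g x * f x))"
    by (rule bounded_rangeI[of _ "B * B'"]) (auto simp: abs_mult intro!: mult_mono B B')
  fix \<epsilon> :: real assume "\<epsilon> > 0"
  then have "\<epsilon> / (B + 1) > 0" using B by simp
  from C0_vanishes[OF f this] obtain K where K: "compact K" "\<And>x. x \<notin> K \<Longrightarrow> \<bar>f x\<bar> < \<epsilon> / (B + 1)"
    by auto
  have "\<bar>g x * f x\<bar> < \<epsilon>" if "x \<notin> K" for x
  proof -
    have "\<bar>g x * f x\<bar> \<le> (B + 1) * \<bar>f x\<bar>"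
      unfolding abs_mult using B(2)[of x] by (intro mult_right_mono) auto
    also have "\<dots> < (B + 1) * (\<epsilon> / (B + 1))"
      using K(2)[OF that] B(1) by (intro mult_strict_left_mono) auto
    finally show ?thesis using B(1) by simp
  qed
  with K(1) show "\<exists>K. compact K \<and> (\<forall>x. x \<notin> K \<longrightarrow> \<bar>g x * f x\<bar> < \<epsilon>)" by auto
qed

lemma C0_cmult: "f \<in> C0 \<Longrightarrow> (\<lambda>x. a * f x) \<in> C0" for f :: "'a::topological_space \<Rightarrow> real"
  by (rule C0_mult_bounded) auto

lemma C0_abs: "f \<in> C0 \<Longrightarrow> (\<lambda>x. \<bar>f x\<bar>) \<in> C0" for f :: "'a::topological_space \<Rightarrow> real"
  by (rule C0I, intro continuous_intros C0_continuous, assumption)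
     (auto dest: C0_bounded C0_vanishes simp: bounded_iff)

lemma C0_diff: "f \<in> C0 \<Longrightarrow> g \<in> C0 \<Longrightarrow> (\<lambda>x. f x - g x) \<in> C0" for f :: "'a::t2_space \<Rightarrow> real"
  using C0_add[of f "\<lambda>x. -1 * g x"] C0_cmult[of g "-1"] by simp

text \<open>Makes the cone to which Simons' argument is applied closed in the supremum norm.\<close>

lemma C0_uniform_limit:
  fixes f :: "'a::topological_space \<Rightarrow> real"
  assumes cont: "continuous_on UNIV f" and bdd: "bounded (range f)"
    and approx: "\<And>\<epsilon>. \<epsilon> > 0 \<Longrightarrow> \<exists>g\<in>C0. \<forall>x. \<bar>f x - g x\<bar> < \<epsilon>"
  shows "f \<in> C0"
proof (rule C0I[OF cont bdd])
  fix \<epsilon> :: real assume "\<epsilon> > 0"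
  then have "\<epsilon> / 2 > 0" by simp
  from approx[OF this] obtain g where g: "g \<in> C0" "\<And>x. \<bar>f x - g x\<bar> < \<epsilon> / 2" by auto
  from C0_vanishes[OF g(1) \<open>\<epsilon> / 2 > 0\<close>] obtain K where K: "compact K" "\<And>x. x \<notin> K \<Longrightarrow> \<bar>g x\<bar> < \<epsilon> / 2"
    by auto
  have "\<bar>f x\<bar> < \<epsilon>" if "x \<notin> K" for x
    using g(2)[of x] K(2)[OF that] by linarith
  with K(1) show "\<exists>K. compact K \<and> (\<forall>x. x \<notin> K \<longrightarrow> \<bar>f x\<bar> < \<epsilon>)" by auto
qed

text \<open>Supplies the attained norms that Simons' argument asks for. A positive value confines
  the supremum to a compact set. Nonnegativity settles the other case: a negative function could
  approach its supremum 0 only at infinity.\<close>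

lemma C0_nonneg_attains_sup:
  fixes f :: "'a::topological_space \<Rightarrow> real"
  assumes f: "f \<in> C0" and nonneg: "\<And>x. f x \<ge> 0"
  shows "\<exists>x. \<forall>y. f y \<le> f x"
proof (cases "\<exists>z. f z > 0")
  case True
  then obtain z where z: "f z > 0" by auto
  from C0_vanishes[OF f z] obtain K where K: "compact K" "\<And>x. x \<notin> K \<Longrightarrow> \<bar>f x\<bar> < f z" by auto
  have "z \<in> K" using K(2)[of z] by force
  then obtain x where x: "x \<in> K" "\<And>y. y \<in> K \<Longrightarrow> f y \<le> f x"
    using continuous_attains_sup[OF K(1), of f] continuous_on_subset[OF C0_continuous[OF f]] by blast
  have "f y \<le> f x" for y
    using x(2)[of y] x(2)[OF \<open>z \<in> K\<close>] K(2)[of y] by force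
  then show ?thesis by auto
next
  case False
  then show ?thesis using nonneg by (metis not_less order_trans)
qed

text \<open>
  Pointwise convergence of a bounded sequence in \<^term>\<open>C0\<close> is weak convergence; this is Mazur's lemma
  for it, obtained from Simons' inequality without the Riesz representation theorem.
\<close>

lemma C0_Mazur:
  fixes f :: "nat \<Rightarrow> 'a::metric_space \<Rightarrow> real"
  assumes f: "\<And>n. f n \<in> C0" and l: "l \<in> C0"
    and bound: "\<And>n x. \<bar>f n x\<bar> \<le> B"
    and lim: "\<And>x. (\<lambda>n. f n x) \<longlonglongrightarrow> l x"
    and f_L: "\<And>n. f n \<in> L"
    and L_convex: "\<And>u v s t. u \<in> L \<Longrightarrow> v \<in> L \<Longrightarrow> s \<ge> 0 \<Longrightarrow> t \<ge> 0 \<Longrightarrow> s + t = 1 \<Longrightarrow>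
                     (\<lambda>x. s * u x + t * v x) \<in> L"
    and "e > 0"
  shows "\<exists>u\<in>L. \<forall>x. \<bar>u x - l x\<bar> < e"
proof -
  \<comment> \<open>Absolute differences are nonnegative members of \<open>C0\<close> and so attain
    their norms. By the triangle inequality a convex combination of them dominates the absolute
    difference between the same combination of the \<open>f n\<close> and \<open>l\<close>.\<close>
  define d where "d n = Bcontfun (\<lambda>x. \<bar>f n x - l x\<bar>)" for n
  have d_C0: "(\<lambda>x. \<bar>f n x - l x\<bar>) \<in> C0" for n
    by (intro C0_abs C0_diff f l)
  then have d_apply: "apply_bcontfun (d n) = (\<lambda>x. \<bar>f n x - l x\<bar>)" for n
    unfolding d_def by (intro Bcontfun_inverse) (auto simp: bcontfun_def C0_def)
  let ?K = "{u :: 'a \<Rightarrow>\<^sub>C real. apply_bcontfun u \<in> C0 \<and> (\<forall>x. apply_bcontfun u x \<ge> 0)}"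
  obtain B' where B': "\<And>x. \<bar>l x\<bar> \<le> B'" using bounded_rangeE[OF C0_bounded[OF l]] by metis
  have "\<exists>u\<in>convex hull (range d). norm u < e"
  proof (rule Simons_small_convex_combination[where K = ?K])
    show "closed ?K"
      unfolding closed_sequential_limits
    proof safe
      fix u :: "nat \<Rightarrow> 'a \<Rightarrow>\<^sub>C real" and v
      assume u: "\<forall>n. u n \<in> ?K" and conv: "u \<longlonglongrightarrow> v"
      have unif: "uniform_limit UNIV u v sequentially"
        by (rule tendsto_bcontfun_uniform_limit[OF conv])
      show "apply_bcontfun v \<in> C0"
      proof (rule C0_uniform_limit)
        fix \<epsilon> :: real assume "\<epsilon> > 0"
        then obtain n where "\<forall>x. dist (u n x) (v x) < \<epsilon>"
          using uniform_limitD[OF unif] by (force simp: eventually_sequentially)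
        with u show "\<exists>g\<in>C0. \<forall>x. \<bar>apply_bcontfun v x - g x\<bar> < \<epsilon>"
          by (intro bexI[of _ "apply_bcontfun (u n)"]) (auto simp: dist_real_def abs_minus_commute)
      qed auto
      fix x
      have "(\<lambda>n. u n x) \<longlonglongrightarrow> v x"
        by (rule tendsto_uniform_limitI[OF unif]) simp
      then show "0 \<le> v x"
        by (rule LIMSEQ_le_const) (use u in auto)
    qed
    fix u assume u: "u \<in> ?K"
    obtain x where x: "\<And>y. u y \<le> u x"
      using C0_nonneg_attains_sup[of "apply_bcontfun u"] u by auto
    have "norm u \<le> u x"
      by (rule norm_bound) (use u x in auto)
    moreover have "u x \<le> norm u"
      using norm_bounded[of u x] by simp
    ultimately show "\<exists>x. u x = norm u" by (intro exI[of _ x]) simp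
  next
    fix n
    show "d n \<in> ?K" using d_C0 by (simp add: d_apply)
    have "\<bar>f n x - l x\<bar> \<le> B + B'" for x
      using bound[of n x] B'[of x] by linarith
    then show "norm (d n) \<le> B + B'"
      by (intro norm_bound) (simp add: d_apply)
  next
    fix x
    show "(\<lambda>n. d n x) \<longlonglongrightarrow> 0"
      using tendsto_rabs[OF LIM_zero[OF lim[of x]]] by (simp add: d_apply)
  qed (use \<open>e > 0\<close> in \<open>auto intro: C0_add C0_cmult\<close>)
  \<comment> \<open>The right-hand set is convex because \<open>L\<close> is closed under convex
    combinations, so the property passes from the generators \<open>d n\<close> to the whole
    hull.\<close>
  moreover have "convex hull (range d) \<subseteq> {u. \<exists>v\<in>L. \<forall>x. \<bar>v x - l x\<bar> \<le> apply_bcontfun u x}"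
  proof (rule hull_minimal)
    show "range d \<subseteq> {u. \<exists>v\<in>L. \<forall>x. \<bar>v x - l x\<bar> \<le> apply_bcontfun u x}"
      using f_L by (auto simp: d_apply)
    show "convex {u. \<exists>v\<in>L. \<forall>x. \<bar>v x - l x\<bar> \<le> apply_bcontfun u x}"
    proof (rule convexI)
      fix u1 u2 :: "'a \<Rightarrow>\<^sub>C real" and s t :: real
      assume "u1 \<in> {u. \<exists>v\<in>L. \<forall>x. \<bar>v x - l x\<bar> \<le> apply_bcontfun u x}" "u2 \<in> {u. \<exists>v\<in>L. \<forall>x. \<bar>v x - l x\<bar> \<le> apply_bcontfun u x}"
        and st: "0 \<le> s" "0 \<le> t" "s + t = 1"
      then obtain v1 v2 where v: "v1 \<in> L" "v2 \<in> L" "\<And>x. \<bar>v1 x - l x\<bar> \<le> u1 x" "\<And>x. \<bar>v2 x - l x\<bar> \<le> u2 x"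
        by auto
      have "\<bar>s * v1 x + t * v2 x - l x\<bar> \<le> s * u1 x + t * u2 x" for x
      proof -
        have "s * v1 x + t * v2 x - l x = s * (v1 x - l x) + t * (v2 x - l x) + (s + t - 1) * l x"
          by (simp add: algebra_simps)
        also have "\<bar>\<dots>\<bar> \<le> s * \<bar>v1 x - l x\<bar> + t * \<bar>v2 x - l x\<bar>"
          using st abs_triangle_ineq[of "s * (v1 x - l x)" "t * (v2 x - l x)"] by (simp add: abs_mult)
        also have "\<dots> \<le> s * u1 x + t * u2 x"
          by (intro add_mono mult_left_mono v st)
        finally show ?thesis .
      qed
      with L_convex[OF v(1,2) st]
      show "s *\<^sub>R u1 + t *\<^sub>R u2 \<in> {u. \<exists>v\<in>L. \<forall>x. \<bar>v x - l x\<bar> \<le> apply_bcontfun u x}"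
        by (auto intro!: bexI[of _ "\<lambda>x. s * v1 x + t * v2 x"])
    qed
  qed
  ultimately obtain u v where u: "norm u < e" and v: "v \<in> L" "\<And>x. \<bar>v x - l x\<bar> \<le> apply_bcontfun u x"
    by blast
  have "\<bar>v x - l x\<bar> < e" for x
    using v(2)[of x] norm_bounded[of u x] u by simp
  with v(1) show ?thesis by auto
qed

text \<open>Local compactness and the Lindelof property give a countable cover by balls with compact
  closed balls. The bump \<open>b i\<close> is positive exactly on the \<open>i\<close>-th ball; the
  factor \<open>m\<close> pushes a positive partial sum above 1, locally uniformly, while only the
  first \<open>m\<close> balls support \<open>\<eta> m\<close>.\<close>

lemma locally_compact_cutoffs:
  assumes lc: "locally_compact_space (euclidean :: 'e::{metric_space, second_countable_topology} topology)"
  obtains \<eta> :: "nat \<Rightarrow> 'e::{metric_space, second_countable_topology} \<Rightarrow> real" where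
    "\<And>m. continuous_on UNIV (\<eta> m)" "\<And>m x. 0 \<le> \<eta> m x" "\<And>m x. \<eta> m x \<le> 1"
    "\<And>m x. \<eta> m x \<le> \<eta> (Suc m) x"
    "\<And>m. \<exists>K. compact K \<and> (\<forall>x. x \<notin> K \<longrightarrow> \<eta> m x = 0)"
    "\<And>x. \<exists>U M. open U \<and> x \<in> U \<and> (\<forall>m\<ge>M. \<forall>y\<in>U. \<eta> m y = 1)"
proof -
  have "\<exists>r>0. compact (cball a r)" for a :: 'e
  proof -
    have "\<exists>U K. open U \<and> compact K \<and> a \<in> U \<and> U \<subseteq> K"
      using lc by (simp add: locally_compact_space_def)
    then obtain U K where UK: "open U" "compact K" "a \<in> U" "U \<subseteq> K"
      by blast
    then obtain r where r: "r > 0" "cball a r \<subseteq> U"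
      by (meson open_contains_cball)
    have "cball a r = K \<inter> cball a r" using r UK by auto
    then have "compact (cball a r)"
      using compact_Int_closed[OF UK(2), of "cball a r"] by simp
    with r show ?thesis by auto
  qed
  then obtain r where r: "\<And>a :: 'e. r a > 0" "\<And>a. compact (cball a (r a))" by metis
  obtain \<C> where \<C>: "\<C> \<subseteq> range (\<lambda>a. ball a (r a))" "countable \<C>" "\<Union>\<C> = \<Union>(range (\<lambda>a. ball a (r a)))"
    using Lindelof[of "range (\<lambda>a. ball a (r a))"] by auto
  have "\<Union>(range (\<lambda>a. ball a (r a))) = UNIV"
    using r(1) by (auto intro: exI[of _ "_ :: 'e"])
  with \<C> have cover: "\<Union>\<C> = UNIV" by simp
  then have "\<C> \<noteq> {}" by auto
  obtain A where A: "countable A" "\<C> = (\<lambda>a. ball a (r a)) ` A"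
    using \<C> countable_image_eq[THEN iffD1] by (metis countable_subset_image)
  then have "A \<noteq> {}" using \<open>\<C> \<noteq> {}\<close> by auto
  define a where "a = from_nat_into A"
  have a_cover: "\<exists>i. y \<in> ball (a i) (r (a i))" for y
  proof -
    obtain b where "b \<in> A" "y \<in> ball b (r b)" using cover A(2) by blast
    moreover have "range a = A"
      unfolding a_def by (rule range_from_nat_into[OF \<open>A \<noteq> {}\<close> A(1)])
    ultimately show ?thesis by (metis imageE)
  qed
  define b where "b i y = max 0 (r (a i) - dist (a i) y)" for i y
  have b_nonneg: "b i y \<ge> 0" for i y by (simp add: b_def)
  have b_cont: "continuous_on UNIV (b i)" for i
    unfolding b_def by (intro continuous_intros)
  define \<eta> where "\<eta> m y = min 1 (real m * (\<Sum>i<m. b i y))" for m y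
  have sum_nonneg: "(\<Sum>i<m. b i y) \<ge> 0" for m y
    by (intro sum_nonneg b_nonneg)
  show thesis
  proof (rule that[of \<eta>])
    fix m
    show "continuous_on UNIV (\<eta> m)"
      unfolding \<eta>_def by (intro continuous_intros b_cont)
    let ?K = "\<Union>i<m. cball (a i) (r (a i))"
    have "compact ?K" using r(2) by (intro compact_UN) auto
    moreover have "\<eta> m x = 0" if "x \<notin> ?K" for x
    proof -
      have "b i x = 0" if "i < m" for i
        using that \<open>x \<notin> ?K\<close> by (force simp: b_def not_le)
      then show ?thesis by (simp add: \<eta>_def)
    qed
    ultimately show "\<exists>K. compact K \<and> (\<forall>x. x \<notin> K \<longrightarrow> \<eta> m x = 0)" by blast
    fix x
    show "0 \<le> \<eta> m x" "\<eta> m x \<le> 1"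
      using sum_nonneg by (auto simp: \<eta>_def)
    have "real m * (\<Sum>i<m. b i x) \<le> real (Suc m) * (\<Sum>i<Suc m. b i x)"
      using b_nonneg[of m x] sum_nonneg by (intro mult_mono) auto
    then show "\<eta> m x \<le> \<eta> (Suc m) x"
      unfolding \<eta>_def by (rule min.mono[OF order_refl])
  next
    fix x
    obtain i where i: "x \<in> ball (a i) (r (a i))" using a_cover by auto
    then have pos: "b i x > 0" by (simp add: b_def)
    \<comment> \<open>On \<open>?U\<close> the bump keeps more than half of its value at
      \<open>x\<close>, so one index works for the whole neighbourhood.\<close>
    let ?U = "{y. b i y > b i x / 2}"
    have "open ?U"
      by (rule open_Collect_less[OF continuous_on_const b_cont])
    moreover have "x \<in> ?U" using pos by simp
    moreover obtain N where N: "real N > 2 / b i x" using reals_Archimedean2 by auto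
    moreover have "\<eta> m y = 1" if "m \<ge> max N (Suc i)" "y \<in> ?U" for m y
    proof -
      have "1 = (2 / b i x) * (b i x / 2)" using pos by simp
      also have "\<dots> \<le> real m * (\<Sum>i<m. b i y)"
      proof (rule mult_mono)
        show "2 / b i x \<le> real m" using N that by simp
        have "b i x / 2 \<le> b i y" using that by simp
        also have "b i y \<le> (\<Sum>i<m. b i y)"
          using that b_nonneg by (intro member_le_sum) auto
        finally show "b i x / 2 \<le> (\<Sum>i<m. b i y)" .
      qed (use pos in auto)
      finally show ?thesis by (simp add: \<eta>_def)
    qed
    ultimately show "\<exists>U M. open U \<and> x \<in> U \<and> (\<forall>m\<ge>M. \<forall>y\<in>U. \<eta> m y = 1)"
      by blast
  qed
qed

section \<open>Right-continuous paths and their additive functional\<close>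

text \<open>Rounding goes up because the paths are only right-continuous. Through
  \<open>nat\<close>, negative times are rounded to 0.\<close>

definition grid_ceil :: "real \<Rightarrow> real \<Rightarrow> real" where
  "grid_ceil d t = d * real (nat \<lceil>t / d\<rceil>)"

lemma grid_ceil_ge: "d > 0 \<Longrightarrow> t \<le> grid_ceil d t"
  unfolding grid_ceil_def
  using real_nat_ceiling_ge[of "t / d"] by (simp add: field_simps)

lemma grid_ceil_less:
  assumes "d > 0" "t \<ge> 0"
  shows "grid_ceil d t < t + d"
proof -
  have "real (nat \<lceil>t / d\<rceil>) = of_int \<lceil>t / d\<rceil>" using assms by simp
  also have "\<dots> < t / d + 1" by linarith
  finally have "d * real (nat \<lceil>t / d\<rceil>) < d * (t / d + 1)"
    using assms by (intro mult_strict_left_mono) auto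
  then show ?thesis using assms by (simp add: grid_ceil_def distrib_left)
qed

lemma grid_ceil_tendsto:
  assumes "\<And>n. d n > 0" "d \<longlonglongrightarrow> 0" "t \<ge> 0"
  shows "(\<lambda>n. grid_ceil (d n) t) \<longlonglongrightarrow> t"
proof (rule tendsto_sandwich[OF _ _ tendsto_const])
  show "\<forall>\<^sub>F n in sequentially. t \<le> grid_ceil (d n) t"
    using assms(1) by (intro always_eventually allI grid_ceil_ge)
  show "\<forall>\<^sub>F n in sequentially. grid_ceil (d n) t \<le> t + d n"
    by (intro always_eventually allI less_imp_le[OF grid_ceil_less] assms)
  show "(\<lambda>n. t + d n) \<longlonglongrightarrow> t"
    using tendsto_add[OF tendsto_const assms(2), of t] by simp
qed

lemma grid_ceil_eq:
  assumes "d > 0" "real i * d < t" "t \<le> real (Suc i) * d"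
  shows "grid_ceil d t = real (Suc i) * d"
proof -
  have "\<lceil>t / d\<rceil> = int (Suc i)"
    by (rule ceiling_unique) (use assms in \<open>simp_all add: field_simps\<close>)
  then show ?thesis by (simp add: grid_ceil_def)
qed

text \<open>Presents the Riemann sum as the integral of a step function, which makes its limit a
  matter of dominated convergence.\<close>

lemma right_Riemann_sum_eq_integral:
  fixes \<phi> :: "real \<Rightarrow> real"
  assumes "d > 0"
  shows "has_bochner_integral lborel (\<lambda>s. indicator {t<..t + real m * d} s * \<phi> (t + grid_ceil d (s - t)))
           (\<Sum>i<m. d * \<phi> (t + real (Suc i) * d))"
proof -
  have "indicator {t<..t + real m * d} s * \<phi> (t + grid_ceil d (s - t))
      = (\<Sum>i<m. indicator {t + real i * d<..t + real (Suc i) * d} s * \<phi> (t + real (Suc i) * d))" for s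
  proof (induction m)
    case (Suc m)
    have later: "t < s" if "t + d * real m < s"
    proof -
      have "0 \<le> d * real m" using assms by simp
      with that show ?thesis by linarith
    qed
    have "indicator {t<..t + real (Suc m) * d} s * \<phi> (t + grid_ceil d (s - t))
        = indicator {t<..t + real m * d} s * \<phi> (t + grid_ceil d (s - t))
          + indicator {t + real m * d<..t + real (Suc m) * d} s * \<phi> (t + grid_ceil d (s - t))"
      using assms later by (auto simp: indicator_def algebra_simps not_le)
    also have "indicator {t + real m * d<..t + real (Suc m) * d} s * \<phi> (t + grid_ceil d (s - t))
        = indicator {t + real m * d<..t + real (Suc m) * d} s * \<phi> (t + real (Suc m) * d)"
      using grid_ceil_eq[OF assms, of m "s - t"] by (auto simp: indicator_def algebra_simps)
    finally show ?case using Suc.IH by simp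
  qed simp
  moreover have "has_bochner_integral lborel
      (\<lambda>s. \<Sum>i<m. indicator {t + real i * d<..t + real (Suc i) * d} s * \<phi> (t + real (Suc i) * d))
      (\<Sum>i<m. d * \<phi> (t + real (Suc i) * d))"
  proof (intro has_bochner_integral_sum)
    fix i
    have "emeasure lborel {t + real i * d<..t + real (Suc i) * d} = ennreal d"
      using assms by (subst emeasure_lborel_Ioc) (auto simp: algebra_simps)
    then have "has_bochner_integral lborel
        (indicator {t + real i * d<..t + real (Suc i) * d} :: real \<Rightarrow> real) d"
      using has_bochner_integral_real_indicator[of "{t + real i * d<..t + real (Suc i) * d}" lborel] assms
      by (simp add: measure_def)
    then show "has_bochner_integral lborel
        (\<lambda>s. indicator {t + real i * d<..t + real (Suc i) * d} s * \<phi> (t + real (Suc i) * d))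
        (d * \<phi> (t + real (Suc i) * d))"
      by (rule has_bochner_integral_mult_left)
  qed
  ultimately show ?thesis by simp
qed

text \<open>The sampled right endpoints approach each \<open>s\<close> from above, so
  right-continuity of \<phi> is enough; measurability of \<phi> on the interval is inherited from
  the step functions. \<open>Suc m\<close> avoids division by zero.\<close>

lemma right_Riemann_sum_tendsto:
  fixes \<phi> :: "real \<Rightarrow> real"
  assumes bound: "\<And>s. \<bar>\<phi> s\<bar> \<le> B" and "r \<ge> 0"
    and rc: "\<And>s u. s > t \<Longrightarrow> u \<longlonglongrightarrow> s \<Longrightarrow> (\<And>n. u n \<ge> s) \<Longrightarrow> (\<lambda>n. \<phi> (u n)) \<longlonglongrightarrow> \<phi> s"
  shows "(\<lambda>m. \<Sum>i<Suc m. r / real (Suc m) * \<phi> (t + real (Suc i) * (r / real (Suc m))))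
           \<longlonglongrightarrow> (LINT s:{t<..t + r}|lborel. \<phi> s)"
proof (cases "r = 0")
  case False
  with \<open>r \<ge> 0\<close> have "r > 0" by simp
  define d where "d m = r / real (Suc m)" for m
  have d_pos: "d m > 0" for m using \<open>r > 0\<close> by (simp add: d_def)
  have d_lim: "d \<longlonglongrightarrow> 0"
    unfolding d_def by (rule LIMSEQ_Suc[OF lim_const_over_n])
  have md: "real (Suc m) * d m = r" for m by (simp add: d_def)
  have hb: "has_bochner_integral lborel (\<lambda>s. indicator {t<..t + r} s * \<phi> (t + grid_ceil (d m) (s - t)))
           (\<Sum>i<Suc m. d m * \<phi> (t + real (Suc i) * d m))" for m
    using right_Riemann_sum_eq_integral[OF d_pos, of t "Suc m" m \<phi>] by (simp only: md)
  have lim: "(\<lambda>m. indicator {t<..t + r} s * \<phi> (t + grid_ceil (d m) (s - t))) \<longlonglongrightarrow> indicator {t<..t + r} s * \<phi> s" for s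
  proof (cases "s \<in> {t<..t + r}")
    case True
    have "(\<lambda>m. \<phi> (t + grid_ceil (d m) (s - t))) \<longlonglongrightarrow> \<phi> s"
    proof (rule rc)
      show "(\<lambda>m. t + grid_ceil (d m) (s - t)) \<longlonglongrightarrow> s"
        using tendsto_add[OF tendsto_const grid_ceil_tendsto[OF d_pos d_lim, of "s - t"], of t] True by simp
      show "t + grid_ceil (d m) (s - t) \<ge> s" for m
        using grid_ceil_ge[OF d_pos, of "s - t" m] by simp
    qed (use True in auto)
    then show ?thesis using True by simp
  qed simp
  have "(\<lambda>m. LINT s|lborel. indicator {t<..t + r} s * \<phi> (t + grid_ceil (d m) (s - t)))
      \<longlonglongrightarrow> (LINT s|lborel. indicator {t<..t + r} s * \<phi> s)"
  proof (rule integral_dominated_convergence[where w = "\<lambda>s. indicator {t<..t + r} s * B"])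
    have "(\<lambda>s. indicator {t<..t + r} s * \<phi> (t + grid_ceil (d m) (s - t))) \<in> borel_measurable lborel" for m
      by (rule borel_measurable_has_bochner_integral[OF hb])
    then show "(\<lambda>s. indicator {t<..t + r} s * \<phi> (t + grid_ceil (d m) (s - t))) \<in> borel_measurable lborel" for m .
    then show "(\<lambda>s. indicator {t<..t + r} s * \<phi> s) \<in> borel_measurable lborel"
      by (rule borel_measurable_LIMSEQ_metric) (rule lim)
    show "integrable lborel (\<lambda>s. indicator {t<..t + r} s * B)"
      by (intro integrable_mult_left) (use \<open>r > 0\<close> in \<open>auto simp: integrable_indicator_iff\<close>)
    show "AE s in lborel. norm (indicator {t<..t + r} s * \<phi> (t + grid_ceil (d m) (s - t)))
            \<le> indicator {t<..t + r} s * B" for m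
      using bound by (auto simp: indicator_def)
  qed (use lim in auto)
  then show ?thesis
    unfolding has_bochner_integral_integral_eq[OF hb] set_lebesgue_integral_def
    by (simp add: d_def)
qed (simp add: set_lebesgue_integral_def)

lemma set_integrable_const_Ioc: "s \<le> t \<Longrightarrow> set_integrable lborel {s<..t} (\<lambda>_. k :: real)" for s t :: real
  unfolding set_integrable_def real_scaleR_def
  by (intro integrable_mult_left) (simp add: integrable_indicator_iff)

lemma abs_set_integral_Ioc_le:
  fixes \<phi> :: "real \<Rightarrow> real"
  assumes int: "set_integrable lborel {s<..t} \<phi>" and "\<And>u. u \<in> {s<..t} \<Longrightarrow> \<bar>\<phi> u\<bar> \<le> B" and "s \<le> t"
  shows "\<bar>LINT u:{s<..t}|lborel. \<phi> u\<bar> \<le> B * (t - s)"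
proof -
  have "\<bar>LINT u:{s<..t}|lborel. \<phi> u\<bar> \<le> (LINT u:{s<..t}|lborel. \<bar>\<phi> u\<bar>)"
    using set_integral_norm_bound[OF int] by simp
  also have "\<dots> \<le> (LINT u:{s<..t}|lborel. B)"
    by (rule set_integral_mono[OF set_integrable_abs[OF int] set_integrable_const_Ioc[OF \<open>s \<le> t\<close>]]) (rule assms)
  also have "\<dots> = B * (t - s)" using \<open>s \<le> t\<close> by (simp add: set_lebesgue_integral_def)
  finally show ?thesis .
qed

section \<open>Filtrations, expectations and joint measurability of the process\<close>

locale feller_process = standard_markov_process \<Omega> P F X
  for \<Omega> :: "'w set"
    and P :: "'e::{metric_space, second_countable_topology} \<Rightarrow> 'w measure"
    and F :: "'e \<Rightarrow> ennreal \<Rightarrow> 'w measure"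
    and X :: "real \<Rightarrow> 'w \<Rightarrow> 'e" +
  assumes feller: "C0_feller P X"
begin

lemma prob_space_P: "prob_space (P x)"
  using usual_conditions_P[of x] by (simp add: usual_conditions_def)

lemma complete_measure_P: "complete_measure (P x)"
  using usual_conditions_P[of x] by (simp add: usual_conditions_def)

lemma filtration_F: "filtration \<Omega> (F x)"
  using usual_conditions_P[of x] by (simp add: usual_conditions_def space_P)

lemma space_F: "space (F x t) = \<Omega>"
  using filtration_F[of x] by (simp add: filtration_def)

lemma sets_F_mono: "s \<le> t \<Longrightarrow> sets (F x s) \<subseteq> sets (F x t)"
  using filtration_F[of x] by (simp add: filtration_def)

lemma subalgebra_F: "subalgebra (P x) (F x t)"
  using usual_conditions_P[of x] by (simp add: usual_conditions_def usual_conditions_axioms_def)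

lemma sets_F_P: "sets (F x t) \<subseteq> sets (P x)"
  using subalgebra_F by (auto simp: subalgebra_def)

lemma null_sets_F: "null_sets (P x) \<subseteq> sets (F x t)"
proof -
  have "null_sets (P x) \<subseteq> sets (F x 0)"
    using usual_conditions_P[of x] unfolding usual_conditions_def usual_conditions_axioms_def by blast
  also have "\<dots> \<subseteq> sets (F x t)" by (rule sets_F_mono) simp
  finally show ?thesis .
qed

lemma right_continuous_F: "t < \<infinity> \<Longrightarrow> sets (F x t) = (\<Inter>s\<in>{t<..}. sets (F x s))"
  using usual_conditions_P[of x] by (simp add: usual_conditions_def usual_conditions_axioms_def)

lemma measurable_F_mono: "f \<in> measurable (F x s) N \<Longrightarrow> s \<le> t \<Longrightarrow> f \<in> measurable (F x t) N"
  using sets_F_mono[of s t x] by (auto simp: measurable_def space_F)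

lemma measurable_F_P: "f \<in> measurable (F x t) N \<Longrightarrow> f \<in> measurable (P x) N"
  by (rule measurable_from_subalg[OF subalgebra_F])

lemma X_measurable_F: "0 \<le> s \<Longrightarrow> ennreal s \<le> t \<Longrightarrow> X s \<in> borel_measurable (F x t)"
  by (rule measurable_F_mono[OF adapted])

lemma X_measurable: "0 \<le> t \<Longrightarrow> X t \<in> borel_measurable (P x)"
  by (rule measurable_F_P[OF adapted])

lemma AE_P_I: "(\<And>\<omega>. \<omega> \<in> \<Omega> \<Longrightarrow> Q \<omega>) \<Longrightarrow> AE \<omega> in P x. Q \<omega>"
  by (rule AE_I2) (simp add: space_P)

lemma integrable_P_bounded:
  fixes f :: "'w \<Rightarrow> real"
  assumes "f \<in> borel_measurable (P x)" "\<And>\<omega>. \<omega> \<in> \<Omega> \<Longrightarrow> \<bar>f \<omega>\<bar> \<le> B"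
  shows "integrable (P x) f"
proof -
  interpret prob_space "P x" by (rule prob_space_P)
  show ?thesis
    by (rule integrable_const_bound[where B = B]) (use assms in \<open>auto intro!: AE_P_I\<close>)
qed

lemma abs_integral_P_le:
  fixes f :: "'w \<Rightarrow> real"
  assumes "\<And>\<omega>. \<omega> \<in> \<Omega> \<Longrightarrow> \<bar>f \<omega>\<bar> \<le> B" "B \<ge> 0"
  shows "\<bar>\<integral>\<omega>. f \<omega> \<partial>P x\<bar> \<le> B"
proof (cases "integrable (P x) f")
  case True
  interpret prob_space "P x" by (rule prob_space_P)
  have "\<bar>\<integral>\<omega>. f \<omega> \<partial>P x\<bar> \<le> (\<integral>\<omega>. \<bar>f \<omega>\<bar> \<partial>P x)" by (rule integral_abs_bound)
  also have "\<dots> \<le> (\<integral>\<omega>. B \<partial>P x)"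
    by (rule integral_mono) (use True assms space_P in auto)
  finally show ?thesis by (simp add: prob_space)
qed (use assms(2) in \<open>simp add: not_integrable_integral_eq\<close>)

lemma X_right_continuous:
  assumes "\<omega> \<in> \<Omega>" "t \<ge> 0" "u \<longlonglongrightarrow> t" "\<And>n. u n \<ge> t"
  shows "(\<lambda>n. X (u n) \<omega>) \<longlonglongrightarrow> X t \<omega>"
proof -
  have "at t within {t..} = at t within {t<..}"
    unfolding at_within_def by (intro arg_cong2[where f=inf] arg_cong[where f=principal]) auto
  then have "continuous (at t within {t..}) (\<lambda>s. X s \<omega>)"
    using right_continuous_paths[OF assms(1,2)] by (simp add: continuous_within)
  then show ?thesis
    using assms(3,4) by (auto simp: continuous_within_sequentially o_def)
qed

text \<open>Rounding the time up leaves countably many fixed-time variables, and right-continuity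
  gives the limit. The truncation \<open>max 0\<close> discards negative times, at which nothing is
  assumed about \<open>X\<close>.\<close>

lemma X_joint_measurable [measurable]:
  "(\<lambda>p. X (max 0 (fst p)) (snd p)) \<in> borel_measurable (borel \<Otimes>\<^sub>M P x)"
proof (rule borel_measurable_LIMSEQ_metric)
  define d :: "nat \<Rightarrow> real" where "d n = 1 / real (Suc n)" for n
  have d_pos: "d n > 0" for n by (simp add: d_def)
  have d_lim: "d \<longlonglongrightarrow> 0"
    unfolding d_def by (rule LIMSEQ_Suc[OF lim_const_over_n])
  show "(\<lambda>p. X (grid_ceil (d n) (max 0 (fst p))) (snd p)) \<in> borel_measurable (borel \<Otimes>\<^sub>M P x)" for n
    unfolding grid_ceil_def
  proof (rule measurable_compose_countable)
    show "(\<lambda>p. X (d n * real i) (snd p)) \<in> borel_measurable (borel \<Otimes>\<^sub>M P x)" for i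
      using d_pos[of n] by (intro measurable_compose[OF measurable_snd X_measurable]) auto
  qed measurable
  fix p :: "real \<times> 'w" assume "p \<in> space (borel \<Otimes>\<^sub>M P x)"
  then have "snd p \<in> \<Omega>" by (auto simp: space_pair_measure space_P)
  then show "(\<lambda>n. X (grid_ceil (d n) (max 0 (fst p))) (snd p)) \<longlonglongrightarrow> X (max 0 (fst p)) (snd p)"
    by (intro X_right_continuous grid_ceil_tendsto d_pos d_lim grid_ceil_ge) auto
qed

lemma X_random_time_measurable:
  assumes "\<tau> \<in> borel_measurable (P x)" "\<And>\<omega>. \<omega> \<in> \<Omega> \<Longrightarrow> \<tau> \<omega> \<ge> 0"
  shows "(\<lambda>\<omega>. X (\<tau> \<omega>) \<omega>) \<in> borel_measurable (P x)"
proof -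
  have "(\<lambda>\<omega>. X (max 0 (fst (\<tau> \<omega>, \<omega>))) (snd (\<tau> \<omega>, \<omega>))) \<in> borel_measurable (P x)"
    by (rule measurable_compose[OF _ X_joint_measurable]) (use assms in measurable)
  then show ?thesis
    by (rule measurable_cong[THEN iffD1, rotated]) (use assms in \<open>auto simp: space_P max_absorb2\<close>)
qed

end

section \<open>The additive functional \<open>I\<close>\<close>

locale killed_feller_process = feller_process \<Omega> P F X
  for \<Omega> :: "'w set"
    and P :: "'e::{metric_space, second_countable_topology} \<Rightarrow> 'w measure"
    and F :: "'e \<Rightarrow> ennreal \<Rightarrow> 'w measure"
    and X :: "real \<Rightarrow> 'w \<Rightarrow> 'e" +
  fixes g :: "'e \<Rightarrow> real" and b :: real
  assumes g_continuous: "continuous_on UNIV g"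
    and g_nonneg: "\<And>x. 0 \<le> g x" and g_le: "\<And>x. g x \<le> b"
begin

definition I :: "real \<Rightarrow> 'w \<Rightarrow> real" where
  "I t \<omega> = (LINT s:{0..t}|lborel. g (X s \<omega>))"

lemma b_nonneg: "b \<ge> 0"
  using g_nonneg g_le order_trans by blast

lemma g_measurable [measurable]: "g \<in> borel_measurable borel"
  by (rule borel_measurable_continuous_onI[OF g_continuous])

lemma abs_g_le: "\<bar>g x\<bar> \<le> b"
  using g_nonneg[of x] g_le[of x] by simp

lemma path_measurable:
  assumes "\<omega> \<in> \<Omega>"
  shows "(\<lambda>s. g (X (max 0 s) \<omega>)) \<in> borel_measurable borel"
proof -
  have "\<omega> \<in> space (P x)" for x using assms by (simp add: space_P)
  then have "(\<lambda>s. X (max 0 (fst (s, \<omega>))) (snd (s, \<omega>))) \<in> borel_measurable borel" for x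
    using measurable_compose[OF measurable_Pair2' X_joint_measurable] by blast
  then show ?thesis by simp
qed

lemma path_set_integrable:
  assumes "\<omega> \<in> \<Omega>" "A \<in> sets borel" "A \<subseteq> {0..}" "emeasure lborel A < \<infinity>"
  shows "set_integrable lborel A (\<lambda>s. g (X s \<omega>))"
proof -
  have "integrable lborel (\<lambda>s. indicator A s *\<^sub>R g (X (max 0 s) \<omega>))"
    by (rule integrableI_bounded_set_indicator[where B = b])
       (use assms path_measurable abs_g_le in auto)
  also have "(\<lambda>s. indicator A s *\<^sub>R g (X (max 0 s) \<omega>)) = (\<lambda>s. indicator A s *\<^sub>R g (X s \<omega>))"
    using assms(3) by (auto simp: indicator_def fun_eq_iff max_absorb2)
  finally show ?thesis by (simp add: set_integrable_def)
qed

lemma I_diff: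
  assumes "\<omega> \<in> \<Omega>" "0 \<le> s" "s \<le> t"
  shows "I t \<omega> - I s \<omega> = (LINT u:{s<..t}|lborel. g (X u \<omega>))"
proof -
  have "{0..t} = {0..s} \<union> {s<..t}" using assms by auto
  moreover have "(LINT u:{0..s} \<union> {s<..t}|lborel. g (X u \<omega>))
      = (LINT u:{0..s}|lborel. g (X u \<omega>)) + (LINT u:{s<..t}|lborel. g (X u \<omega>))"
    by (intro set_integral_Un path_set_integrable) (use assms in auto)
  ultimately show ?thesis by (simp add: I_def)
qed

lemma I_0: "I 0 \<omega> = 0"
proof -
  have "AE s in lborel. indicator {0..0::real} s *\<^sub>R g (X s \<omega>) = 0"
    using AE_lborel_singleton[of 0] by eventually_elim simp
  then show ?thesis
    unfolding I_def set_lebesgue_integral_def by (rule integral_eq_zero_AE)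
qed

lemma I_diff_le:
  assumes "\<omega> \<in> \<Omega>" "0 \<le> s" "s \<le> t"
  shows "I t \<omega> - I s \<omega> \<le> b * (t - s)"
proof -
  have "(LINT u:{s<..t}|lborel. g (X u \<omega>)) \<le> (LINT u:{s<..t}|lborel. b)"
    by (rule set_integral_mono) (use assms g_le in \<open>auto intro!: path_set_integrable set_integrable_const_Ioc\<close>)
  also have "\<dots> = b * (t - s)"
    using assms by (simp add: set_lebesgue_integral_def)
  finally show ?thesis using I_diff[OF assms] by simp
qed

lemma I_diff_ge:
  assumes "\<omega> \<in> \<Omega>" "0 \<le> s" "s \<le> t" "\<And>x. c \<le> g x"
  shows "c * (t - s) \<le> I t \<omega> - I s \<omega>"
proof -
  have "c * (t - s) = (LINT u:{s<..t}|lborel. c)"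
    using assms by (simp add: set_lebesgue_integral_def)
  also have "\<dots> \<le> (LINT u:{s<..t}|lborel. g (X u \<omega>))"
    by (rule set_integral_mono) (use assms in \<open>auto intro!: path_set_integrable set_integrable_const_Ioc\<close>)
  finally show ?thesis using I_diff[OF assms(1-3)] by simp
qed

lemma I_mono: "\<omega> \<in> \<Omega> \<Longrightarrow> 0 \<le> s \<Longrightarrow> s \<le> t \<Longrightarrow> I s \<omega> \<le> I t \<omega>"
  using I_diff_ge[of \<omega> s t 0] g_nonneg by simp

lemma I_nonneg: "\<omega> \<in> \<Omega> \<Longrightarrow> 0 \<le> t \<Longrightarrow> 0 \<le> I t \<omega>"
  using I_mono[of \<omega> 0 t] by (simp add: I_0)

lemma I_le: "\<omega> \<in> \<Omega> \<Longrightarrow> 0 \<le> t \<Longrightarrow> I t \<omega> \<le> b * t"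
  using I_diff_le[of \<omega> 0 t] by (simp add: I_0)

lemma I_tendsto:
  assumes "\<omega> \<in> \<Omega>" "t \<ge> 0" "u \<longlonglongrightarrow> t" "\<And>n. u n \<ge> 0"
  shows "(\<lambda>n. I (u n) \<omega>) \<longlonglongrightarrow> I t \<omega>"
proof -
  have "\<bar>I (u n) \<omega> - I t \<omega>\<bar> \<le> b * \<bar>u n - t\<bar>" for n
  proof (cases "u n \<le> t")
    case True
    with assms show ?thesis using I_diff_le[of \<omega> "u n" t] I_mono[of \<omega> "u n" t] by simp
  next
    case False
    with assms show ?thesis using I_diff_le[of \<omega> t "u n"] I_mono[of \<omega> t "u n"] by simp
  qed
  moreover have "(\<lambda>n. b * \<bar>u n - t\<bar>) \<longlonglongrightarrow> 0"
    using tendsto_mult_right_zero[OF tendsto_rabs_zero[OF LIM_zero[OF assms(3)]]] by simp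
  ultimately have "(\<lambda>n. I (u n) \<omega> - I t \<omega>) \<longlonglongrightarrow> 0"
    by (intro Lim_null_comparison[of "\<lambda>n. I (u n) \<omega> - I t \<omega>"]) auto
  then show ?thesis by (rule LIM_zero_cancel)
qed

lemma Riemann_sum_I:
  assumes "\<omega> \<in> \<Omega>" "t \<ge> 0" "r \<ge> 0"
  shows "(\<lambda>m. \<Sum>i<Suc m. r / real (Suc m) * g (X (t + real (Suc i) * (r / real (Suc m))) \<omega>))
           \<longlonglongrightarrow> I (t + r) \<omega> - I t \<omega>"
proof -
  have "(\<lambda>m. \<Sum>i<Suc m. r / real (Suc m) * g (X (t + real (Suc i) * (r / real (Suc m))) \<omega>))
           \<longlonglongrightarrow> (LINT s:{t<..t + r}|lborel. g (X s \<omega>))"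
  proof (rule right_Riemann_sum_tendsto)
    fix s u assume "t < s" "u \<longlonglongrightarrow> s" "\<And>n. s \<le> u n"
    then have "(\<lambda>n. X (u n) \<omega>) \<longlonglongrightarrow> X s \<omega>"
      using assms by (intro X_right_continuous) auto
    then show "(\<lambda>n. g (X (u n) \<omega>)) \<longlonglongrightarrow> g (X s \<omega>)"
      by (rule continuous_on_tendsto_compose[OF g_continuous]) auto
  qed (use assms abs_g_le in auto)
  then show ?thesis using I_diff[of \<omega> t "t + r"] assms by simp
qed

text \<open>Riemann sums over the interval from 0 to \<open>s\<close> use the process only up to
  time \<open>s\<close>, so adaptedness of \<open>I\<close> follows from that of \<open>X\<close>
  without an appeal to progressive measurability.\<close>

lemma I_measurable_F:
  assumes "0 \<le> s" "ennreal s \<le> t"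
  shows "I s \<in> borel_measurable (F x t)"
proof (rule borel_measurable_LIMSEQ_metric)
  show "(\<lambda>m. \<Sum>i<Suc m. s / real (Suc m) * g (X (0 + real (Suc i) * (s / real (Suc m))) \<omega>)) \<longlonglongrightarrow> I s \<omega>"
    if "\<omega> \<in> space (F x t)" for \<omega>
    using Riemann_sum_I[of \<omega> 0 s] that assms by (simp add: space_F I_0)
  fix m
  have "real (Suc i) * (s / real (Suc m)) \<le> s" if "i < Suc m" for i
  proof -
    have "real (Suc i) * (s / real (Suc m)) \<le> real (Suc m) * (s / real (Suc m))"
      using that assms by (intro mult_right_mono) auto
    then show ?thesis by simp
  qed
  then have "ennreal (real (Suc i) * (s / real (Suc m))) \<le> t" if "i < Suc m" for i
    using that assms ennreal_leI order_trans by blast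
  then show "(\<lambda>\<omega>. \<Sum>i<Suc m. s / real (Suc m) * g (X (0 + real (Suc i) * (s / real (Suc m))) \<omega>)) \<in> borel_measurable (F x t)"
    using assms by (intro borel_measurable_sum borel_measurable_times measurable_compose[OF X_measurable_F g_measurable]) auto
qed

lemma I_measurable: "0 \<le> t \<Longrightarrow> I t \<in> borel_measurable (P x)"
  by (rule measurable_F_P[OF I_measurable_F[OF _ order_refl]])

lemma I_random_time_measurable:
  assumes [measurable]: "\<tau> \<in> borel_measurable (P x)" and "\<And>\<omega>. \<omega> \<in> \<Omega> \<Longrightarrow> \<tau> \<omega> \<ge> 0"
  shows "(\<lambda>\<omega>. I (\<tau> \<omega>) \<omega>) \<in> borel_measurable (P x)"
proof (rule borel_measurable_LIMSEQ_metric)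
  define d :: "nat \<Rightarrow> real" where "d n = 1 / real (Suc n)" for n
  have d_pos: "d n > 0" for n by (simp add: d_def)
  have d_lim: "d \<longlonglongrightarrow> 0"
    unfolding d_def by (rule LIMSEQ_Suc[OF lim_const_over_n])
  show "(\<lambda>\<omega>. I (grid_ceil (d n) (\<tau> \<omega>)) \<omega>) \<in> borel_measurable (P x)" for n
    unfolding grid_ceil_def
  proof (rule measurable_compose_countable)
    show "(\<lambda>\<omega>. I (d n * real i) \<omega>) \<in> borel_measurable (P x)" for i
      using d_pos[of n] by (intro I_measurable) auto
  qed measurable
  fix \<omega> assume "\<omega> \<in> space (P x)"
  then have "\<omega> \<in> \<Omega>" by (simp add: space_P)
  moreover have "grid_ceil (d n) (\<tau> \<omega>) \<ge> 0" for n
    using d_pos[of n] by (simp add: grid_ceil_def)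
  ultimately show "(\<lambda>n. I (grid_ceil (d n) (\<tau> \<omega>)) \<omega>) \<longlonglongrightarrow> I (\<tau> \<omega>) \<omega>"
    using assms(2) by (intro I_tendsto grid_ceil_tendsto d_pos d_lim) auto
qed

end

section \<open>The Feller semigroup and finite-dimensional distributions\<close>

lemma bcontfunI: "continuous_on UNIV f \<Longrightarrow> bounded (range f) \<Longrightarrow> f \<in> bcontfun"
  by (simp add: bcontfun_def)

lemma bcontfun_continuous: "f \<in> bcontfun \<Longrightarrow> continuous_on UNIV f"
  and bcontfun_bounded: "f \<in> bcontfun \<Longrightarrow> bounded (range f)"
  by (auto simp: bcontfun_def)

lemma bcontfun_bound:
  fixes f :: "'a::topological_space \<Rightarrow> real"
  assumes "f \<in> bcontfun"
  obtains B where "B \<ge> 0" "\<And>x. \<bar>f x\<bar> \<le> B"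
  using bounded_rangeE[OF bcontfun_bounded[OF assms]] by metis

lemma C0_bcontfun: "f \<in> C0 \<Longrightarrow> f \<in> bcontfun" for f :: "'a::topological_space \<Rightarrow> real"
  by (simp add: bcontfun_def C0_def)

lemma bcontfun_mult:
  fixes f g :: "'a::topological_space \<Rightarrow> real"
  assumes f: "f \<in> bcontfun" and g: "g \<in> bcontfun"
  shows "(\<lambda>x. f x * g x) \<in> bcontfun"
proof (rule bcontfunI)
  obtain B where B: "B \<ge> 0" "\<And>x. \<bar>f x\<bar> \<le> B" using bcontfun_bound[OF f] by metis
  obtain B' where B': "B' \<ge> 0" "\<And>x. \<bar>g x\<bar> \<le> B'" using bcontfun_bound[OF g] by metis
  show "bounded (range (\<lambda>x. f x * g x))"
    by (rule bounded_rangeI[of _ "B * B'"]) (auto simp: abs_mult intro!: mult_mono B B')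
qed (intro continuous_intros bcontfun_continuous assms)

text \<open>Continuous minorants that come close at \<open>x\<close> give lower semicontinuity
  there, continuous majorants give upper semicontinuity. Both may depend on the point and on
  \<epsilon>, so no uniform approximation is involved.\<close>

lemma continuous_if_sandwiched:
  fixes f :: "'a::topological_space \<Rightarrow> real"
  assumes lower: "\<And>x \<epsilon>. \<epsilon> > 0 \<Longrightarrow> \<exists>l. continuous_on UNIV l \<and> (\<forall>y. l y \<le> f y) \<and> f x < l x + \<epsilon>"
    and upper: "\<And>x \<epsilon>. \<epsilon> > 0 \<Longrightarrow> \<exists>u. continuous_on UNIV u \<and> (\<forall>y. f y \<le> u y) \<and> u x < f x + \<epsilon>"
  shows "continuous_on UNIV f"
  unfolding continuous_on_def
proof
  fix x
  show "(f \<longlongrightarrow> f x) (at x)"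
  proof (rule order_tendstoI)
    fix a assume "a < f x"
    then obtain l where l: "continuous_on UNIV l" "\<And>y. l y \<le> f y" "f x < l x + (f x - a)"
      using lower[of "f x - a" x] by auto
    have "(l \<longlongrightarrow> l x) (at x)" using l(1) by (simp add: continuous_on_def)
    then have "\<forall>\<^sub>F y in at x. a < l y" using l(3) by (intro order_tendstoD) auto
    then show "\<forall>\<^sub>F y in at x. a < f y"
      by eventually_elim (use l(2) in \<open>auto intro: less_le_trans\<close>)
  next
    fix a assume "f x < a"
    then obtain u where u: "continuous_on UNIV u" "\<And>y. f y \<le> u y" "u x < f x + (a - f x)"
      using upper[of "a - f x" x] by auto
    have "(u \<longlongrightarrow> u x) (at x)" using u(1) by (simp add: continuous_on_def)
    then have "\<forall>\<^sub>F y in at x. u y < a" using u(3) by (intro order_tendstoD) auto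
    then show "\<forall>\<^sub>F y in at x. f y < a"
      by eventually_elim (use u(2) in \<open>auto intro: le_less_trans\<close>)
  qed
qed

text \<open>The remainder of the exponential series has nonnegative coefficients, hence increases on
  nonnegative arguments. The truncation error at any value of \<open>I r\<close> is thus bounded by
  the one at \<open>b * r\<close>.\<close>

lemma exp_tail_mono:
  fixes y z :: real
  assumes "0 \<le> y" "y \<le> z"
  shows "\<bar>exp y - (\<Sum>n<N. y ^ n / fact n)\<bar> \<le> exp z - (\<Sum>n<N. z ^ n / fact n)"
proof -
  have sums: "(\<lambda>n. u ^ n / fact n) sums exp u" for u :: real
    using exp_converges[of u] by (simp add: divide_inverse mult.commute)
  have tail: "exp u - (\<Sum>n<N. u ^ n / fact n) = (\<Sum>n. u ^ (n + N) / fact (n + N))"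
    and summ: "summable (\<lambda>n. u ^ (n + N) / fact (n + N))" for u :: real
    using suminf_minus_initial_segment[OF sums_summable[OF sums[of u]], of N] sums_unique[OF sums[of u]]
      summable_ignore_initial_segment[OF sums_summable[OF sums[of u]], of N] by simp_all
  have "0 \<le> (\<Sum>n. y ^ (n + N) / fact (n + N))"
    by (rule suminf_nonneg[OF summ]) (use assms in auto)
  moreover have "(\<Sum>n. y ^ (n + N) / fact (n + N)) \<le> (\<Sum>n. z ^ (n + N) / fact (n + N))"
    by (rule suminf_le[OF _ summ summ]) (use assms in \<open>auto intro!: divide_right_mono power_mono\<close>)
  ultimately show ?thesis unfolding tail by simp
qed

context feller_process
begin

lemma bcontfun_measurable: "f \<in> bcontfun \<Longrightarrow> f \<in> borel_measurable borel" for f :: "'e \<Rightarrow> real"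
  by (rule borel_measurable_continuous_onI[OF bcontfun_continuous])

lemma f_X_measurable:
  "f \<in> bcontfun \<Longrightarrow> t \<ge> 0 \<Longrightarrow> (\<lambda>\<omega>. f (X t \<omega>)) \<in> borel_measurable (P x)" for f :: "'e \<Rightarrow> real"
  by (rule measurable_compose[OF X_measurable bcontfun_measurable])

lemma f_X_measurable_F:
  "f \<in> bcontfun \<Longrightarrow> s \<ge> 0 \<Longrightarrow> ennreal s \<le> t \<Longrightarrow> (\<lambda>\<omega>. f (X s \<omega>)) \<in> borel_measurable (F x t)" for f :: "'e \<Rightarrow> real"
  by (rule measurable_compose[OF X_measurable_F bcontfun_measurable])

lemma integrable_f_X:
  fixes f :: "'e \<Rightarrow> real"
  assumes "f \<in> bcontfun" "t \<ge> 0"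
  shows "integrable (P x) (\<lambda>\<omega>. f (X t \<omega>))"
proof -
  obtain B where "\<And>x. \<bar>f x\<bar> \<le> B" using bcontfun_bound[OF assms(1)] by metis
  then show ?thesis by (intro integrable_P_bounded[where B = B] f_X_measurable assms)
qed

lemma expectation_const: "(\<integral>\<omega>. k \<partial>P x) = (k :: real)"
proof -
  interpret prob_space "P x" by (rule prob_space_P)
  show ?thesis by (simp add: prob_space)
qed

lemma expectation_X_0:
  fixes f :: "'e \<Rightarrow> real"
  assumes "f \<in> bcontfun"
  shows "(\<integral>\<omega>. f (X 0 \<omega>) \<partial>P x) = f x"
proof -
  have "(\<integral>\<omega>. f (X 0 \<omega>) \<partial>P x) = (\<integral>\<omega>. f x \<partial>P x)"
    by (rule integral_cong_AE) (use initial[of x] f_X_measurable[OF assms, of 0] in \<open>auto elim: eventually_mono\<close>)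
  then show ?thesis by (simp only: expectation_const)
qed

lemma dominated_convergence_P:
  fixes f :: "nat \<Rightarrow> 'w \<Rightarrow> real"
  assumes meas: "\<And>n. f n \<in> borel_measurable (P x)"
    and lim: "\<And>\<omega>. \<omega> \<in> \<Omega> \<Longrightarrow> (\<lambda>n. f n \<omega>) \<longlonglongrightarrow> l \<omega>"
    and bound: "\<And>n \<omega>. \<omega> \<in> \<Omega> \<Longrightarrow> \<bar>f n \<omega>\<bar> \<le> B"
  shows "(\<lambda>n. \<integral>\<omega>. f n \<omega> \<partial>P x) \<longlonglongrightarrow> (\<integral>\<omega>. l \<omega> \<partial>P x)"
proof -
  interpret prob_space "P x" by (rule prob_space_P)
  show ?thesis
  proof (rule integral_dominated_convergence[where w = "\<lambda>_. B"])
    show "l \<in> borel_measurable (P x)"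
      by (rule borel_measurable_LIMSEQ_metric[where f = f, OF meas]) (simp add: space_P lim)
  qed (use meas lim bound in \<open>auto intro!: AE_P_I\<close>)
qed

lemma abs_semigroup_le:
  assumes "\<And>y. \<bar>f y\<bar> \<le> B"
  shows "\<bar>semigroup P X t f x\<bar> \<le> B"
proof -
  have "B \<ge> 0" using order_trans[OF abs_ge_zero assms] .
  then show ?thesis unfolding semigroup_def by (intro abs_integral_P_le assms)
qed

lemma semigroup_C0: "t \<ge> 0 \<Longrightarrow> f \<in> C0 \<Longrightarrow> semigroup P X t f \<in> C0"
  using feller unfolding C0_feller_def by blast

lemma cutoffs:
  obtains \<eta> :: "nat \<Rightarrow> 'e \<Rightarrow> real" where
    "\<And>m. \<eta> m \<in> C0" "\<And>m x. 0 \<le> \<eta> m x" "\<And>m x. \<eta> m x \<le> 1"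
    "\<And>m x. \<eta> m x \<le> \<eta> (Suc m) x"
    "\<And>m. \<exists>K. compact K \<and> (\<forall>x. x \<notin> K \<longrightarrow> \<eta> m x = 0)"
    "\<And>x. \<exists>U M. open U \<and> x \<in> U \<and> (\<forall>m\<ge>M. \<forall>y\<in>U. \<eta> m y = 1)"
proof -
  obtain \<eta> :: "nat \<Rightarrow> 'e \<Rightarrow> real" where \<eta>:
    "\<And>m. continuous_on UNIV (\<eta> m)" "\<And>m x. 0 \<le> \<eta> m x" "\<And>m x. \<eta> m x \<le> 1"
    "\<And>m x. \<eta> m x \<le> \<eta> (Suc m) x"
    "\<And>m. \<exists>K. compact K \<and> (\<forall>x. x \<notin> K \<longrightarrow> \<eta> m x = 0)"
    "\<And>x. \<exists>U M. open U \<and> x \<in> U \<and> (\<forall>m\<ge>M. \<forall>y\<in>U. \<eta> m y = 1)"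
    by (rule locally_compact_cutoffs[OF locally_compact_E]) (rule that)
  have \<eta>_C0: "\<eta> m \<in> C0" for m
  proof (rule C0I[OF \<eta>(1)])
    show "bounded (range (\<eta> m))"
      by (rule bounded_rangeI[of _ 1]) (use \<eta>(2,3) in auto)
    show "\<exists>K. compact K \<and> (\<forall>x. x \<notin> K \<longrightarrow> \<bar>\<eta> m x\<bar> < \<epsilon>)" if "\<epsilon> > 0" for \<epsilon>
      using \<eta>(5)[of m] that by auto
  qed
  show thesis by (rule that[OF \<eta>_C0 \<eta>(2-6)])
qed

text \<open>
  Since the process does not leave \<open>E\<close>, the semigroup preserves bounded continuous functions:
  \<open>P\<^sub>t f\<close> is locally approximated by \<open>P\<^sub>t (\<eta> f)\<close> with error \<open>B (1 - P\<^sub>t \<eta>)\<close> for cutoffs \<open>\<eta>\<close>.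
\<close>

lemma semigroup_continuous:
  fixes f :: "'e \<Rightarrow> real"
  assumes "t \<ge> 0" and f: "f \<in> bcontfun"
  shows "continuous_on UNIV (semigroup P X t f)"
proof -
  obtain B where B: "B \<ge> 0" "\<And>x. \<bar>f x\<bar> \<le> B" using bcontfun_bound[OF f] by metis
  obtain \<eta> :: "nat \<Rightarrow> 'e \<Rightarrow> real" where \<eta>: "\<And>m. \<eta> m \<in> C0" "\<And>m x. 0 \<le> \<eta> m x" "\<And>m x. \<eta> m x \<le> 1"
    and \<eta>_one: "\<And>x. \<exists>U M. open U \<and> x \<in> U \<and> (\<forall>m\<ge>M. \<forall>y\<in>U. \<eta> m y = 1)"
    by (rule cutoffs) blast
  define u where "u m y = semigroup P X t (\<lambda>z. f z * \<eta> m z) y" for m y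
  define v where "v m y = B * (1 - semigroup P X t (\<eta> m) y)" for m y
  have u_cont: "continuous_on UNIV (u m)" for m
    unfolding u_def[abs_def]
    by (intro C0_continuous semigroup_C0 C0_mult_bounded \<eta> bcontfun_continuous bcontfun_bounded f \<open>t \<ge> 0\<close>)
  have v_cont: "continuous_on UNIV (v m)" for m
    unfolding v_def[abs_def] by (intro continuous_intros C0_continuous semigroup_C0 \<eta> \<open>t \<ge> 0\<close>)
  have approx: "\<bar>semigroup P X t f y - u m y\<bar> \<le> v m y" for m y
  proof -
    have int: "integrable (P y) (\<lambda>\<omega>. f (X t \<omega>))" "integrable (P y) (\<lambda>\<omega>. f (X t \<omega>) * \<eta> m (X t \<omega>))"
      "integrable (P y) (\<lambda>\<omega>. \<eta> m (X t \<omega>))"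
      using integrable_f_X[OF f \<open>t \<ge> 0\<close>] integrable_f_X[OF bcontfun_mult[OF f C0_bcontfun[OF \<eta>(1)]] \<open>t \<ge> 0\<close>]
        integrable_f_X[OF C0_bcontfun[OF \<eta>(1)] \<open>t \<ge> 0\<close>] by blast+
    interpret prob_space "P y" by (rule prob_space_P)
    have "semigroup P X t f y - u m y = (\<integral>\<omega>. f (X t \<omega>) - f (X t \<omega>) * \<eta> m (X t \<omega>) \<partial>P y)"
      unfolding semigroup_def u_def by (rule Bochner_Integration.integral_diff[symmetric]) (intro int)+
    also have "\<bar>\<dots>\<bar> \<le> (\<integral>\<omega>. \<bar>f (X t \<omega>) - f (X t \<omega>) * \<eta> m (X t \<omega>)\<bar> \<partial>P y)"
      by (rule integral_abs_bound)
    also have "\<dots> \<le> (\<integral>\<omega>. B * (1 - \<eta> m (X t \<omega>)) \<partial>P y)"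
    proof (rule integral_mono)
      fix \<omega>
      have "f (X t \<omega>) - f (X t \<omega>) * \<eta> m (X t \<omega>) = f (X t \<omega>) * (1 - \<eta> m (X t \<omega>))"
        by (simp add: right_diff_distrib)
      then have "\<bar>f (X t \<omega>) - f (X t \<omega>) * \<eta> m (X t \<omega>)\<bar> = \<bar>f (X t \<omega>)\<bar> * (1 - \<eta> m (X t \<omega>))"
        using \<eta>(3)[of m "X t \<omega>"] by (simp add: abs_mult)
      also have "\<dots> \<le> B * (1 - \<eta> m (X t \<omega>))"
        using B \<eta>(3) by (intro mult_right_mono) auto
      finally show "\<bar>f (X t \<omega>) - f (X t \<omega>) * \<eta> m (X t \<omega>)\<bar> \<le> B * (1 - \<eta> m (X t \<omega>))" .
    qed (use int in auto)
    also have "\<dots> = v m y"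
      using int by (simp add: v_def semigroup_def prob_space)
    finally show ?thesis .
  qed
  have "(\<lambda>m. semigroup P X t (\<eta> m) y) \<longlonglongrightarrow> (\<integral>\<omega>. 1 \<partial>P y)" for y
    unfolding semigroup_def
  proof (rule dominated_convergence_P[where B = 1])
    fix \<omega>
    obtain U M where "X t \<omega> \<in> U" "\<forall>m\<ge>M. \<forall>y\<in>U. \<eta> m y = 1" using \<eta>_one by blast
    then show "(\<lambda>m. \<eta> m (X t \<omega>)) \<longlonglongrightarrow> 1"
      by (intro tendsto_eventually) (auto simp: eventually_sequentially)
  qed (use \<eta> \<open>t \<ge> 0\<close> in \<open>auto intro: f_X_measurable C0_bcontfun\<close>)
  then have v_lim: "(\<lambda>m. v m y) \<longlonglongrightarrow> 0" for y
    using tendsto_mult[OF tendsto_const tendsto_diff[OF tendsto_const], of _ 1 sequentially B 1]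
    unfolding v_def expectation_const by simp
  have small: "\<exists>m. 2 * v m x < \<epsilon>" if "\<epsilon> > 0" for x \<epsilon>
  proof -
    have "\<forall>\<^sub>F m in sequentially. v m x < \<epsilon> / 2"
      using order_tendstoD(2)[OF v_lim[of x], of "\<epsilon> / 2"] that by simp
    then obtain m where "v m x < \<epsilon> / 2" by (auto simp: eventually_sequentially)
    then show ?thesis by (intro exI[of _ m]) simp
  qed
  show ?thesis
  proof (rule continuous_if_sandwiched)
    fix x \<epsilon> :: real assume "\<epsilon> > 0" fix x
    obtain m where m: "2 * v m x < \<epsilon>" using small[OF \<open>\<epsilon> > 0\<close>] by auto
    have bounds: "u m y - v m y \<le> semigroup P X t f y" "semigroup P X t f y \<le> u m y + v m y" for y
      using approx[of y m] by (simp_all add: abs_le_iff)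
    have close: "semigroup P X t f x < u m x - v m x + \<epsilon>" "u m x + v m x < semigroup P X t f x + \<epsilon>"
      using m bounds[of x] by linarith+
    show "\<exists>l. continuous_on UNIV l \<and> (\<forall>y. l y \<le> semigroup P X t f y) \<and> semigroup P X t f x < l x + \<epsilon>"
      by (rule exI[of _ "\<lambda>y. u m y - v m y"])
         (use close bounds in \<open>auto intro!: continuous_intros u_cont v_cont\<close>)
    show "\<exists>l. continuous_on UNIV l \<and> (\<forall>y. semigroup P X t f y \<le> l y) \<and> l x < semigroup P X t f x + \<epsilon>"
      by (rule exI[of _ "\<lambda>y. u m y + v m y"])
         (use close bounds in \<open>auto intro!: continuous_intros u_cont v_cont\<close>)
  qed
qed

lemma semigroup_bcontfun:
  fixes f :: "'e \<Rightarrow> real"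
  assumes "t \<ge> 0" "f \<in> bcontfun"
  shows "semigroup P X t f \<in> bcontfun"
proof -
  obtain B where "\<And>x. \<bar>f x\<bar> \<le> B" using bcontfun_bound[OF assms(2)] by metis
  then have "bounded (range (semigroup P X t f))"
    by (intro bounded_rangeI[of _ B] abs_semigroup_le)
  then show ?thesis using semigroup_continuous[OF assms] by (rule bcontfunI[rotated])
qed

text \<open>The strong Markov property at a constant time, in integrated form: testing against
  bounded \<open>Z\<close> known at time \<open>t\<close> keeps conditional expectations out of all
  that follows.\<close>

lemma markov:
  fixes f :: "'e \<Rightarrow> real"
  assumes "t \<ge> 0" "s \<ge> 0" and f: "f \<in> bcontfun"
    and Z: "Z \<in> borel_measurable (F x (ennreal t))" "\<And>\<omega>. \<omega> \<in> \<Omega> \<Longrightarrow> \<bar>Z \<omega>\<bar> \<le> B"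
  shows "(\<integral>\<omega>. Z \<omega> * f (X (t + s) \<omega>) \<partial>P x) = (\<integral>\<omega>. Z \<omega> * semigroup P X s f (X t \<omega>) \<partial>P x)"
proof -
  interpret fil: filtration \<Omega> "F x" by (rule filtration_F)
  interpret prob_space "P x" by (rule prob_space_P)
  let ?\<sigma> = "\<lambda>_ :: 'w. ennreal t"
  let ?G = "fil.pre_sigma ?\<sigma>"
  have st: "stopping_time (F x) ?\<sigma>" by (rule stopping_time_const)
  \<comment> \<open>This inclusion makes \<open>Z\<close> measurable for the \<sigma>-algebra of the
    constant stopping time, with respect to which \<open>strong_markov\<close> is
    formulated.\<close>
  have "sets (F x (ennreal t)) \<subseteq> sets ?G"
  proof
    fix A assume A: "A \<in> sets (F x (ennreal t))"
    show "A \<in> sets ?G"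
    proof (rule fil.sets_pre_sigmaI[OF st])
      fix t' show "{\<omega> \<in> A. ennreal t \<le> t'} \<in> sets (F x t')"
        using A sets_F_mono[of "ennreal t" t' x] by (cases "ennreal t \<le> t'") auto
    qed
  qed
  then have Z': "Z \<in> borel_measurable ?G"
    using Z(1) by (auto simp: measurable_def space_F fil.space_pre_sigma)
  have "sets ?G \<subseteq> sets (P x)"
    using fil.sets_pre_sigmaD[OF st, of _ "ennreal t"] sets_F_P by fastforce
  then interpret fms: finite_measure_subalgebra "P x" ?G
    by unfold_locales (auto simp: subalgebra_def fil.space_pre_sigma space_P)
  have fX: "(\<lambda>\<omega>. f (X (t + s) \<omega>)) \<in> borel_measurable (P x)"
    using assms by (intro f_X_measurable) auto
  have ZP: "Z \<in> borel_measurable (P x)" by (rule measurable_F_P[OF Z(1)])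
  obtain B' where B': "B' \<ge> 0" "\<And>x. \<bar>f x\<bar> \<le> B'" using bcontfun_bound[OF f] by metis
  have "integrable (P x) (\<lambda>\<omega>. Z \<omega> * f (X (t + s) \<omega>))"
    by (rule integrable_P_bounded[where B = "B * B'"])
       (use Z(2) B' ZP fX in \<open>auto simp: abs_mult intro!: mult_mono intro: order_trans[OF abs_ge_zero]\<close>)
  then have "(\<integral>\<omega>. Z \<omega> * f (X (t + s) \<omega>) \<partial>P x)
      = (\<integral>\<omega>. Z \<omega> * real_cond_exp (P x) ?G (\<lambda>\<omega>. f (X (t + s) \<omega>)) \<omega> \<partial>P x)"
    by (rule fms.real_cond_exp_intg(2)[symmetric]) (rule Z' fX)+
  also have "\<dots> = (\<integral>\<omega>. Z \<omega> * semigroup P X s f (X t \<omega>) \<partial>P x)"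
  proof (rule integral_cong_AE)
    show "(\<lambda>\<omega>. Z \<omega> * real_cond_exp (P x) ?G (\<lambda>\<omega>. f (X (t + s) \<omega>)) \<omega>) \<in> borel_measurable (P x)"
      using ZP by measurable
    show "(\<lambda>\<omega>. Z \<omega> * semigroup P X s f (X t \<omega>)) \<in> borel_measurable (P x)"
      using assms by (intro borel_measurable_times ZP f_X_measurable semigroup_bcontfun) auto
    show "AE \<omega> in P x. Z \<omega> * real_cond_exp (P x) ?G (\<lambda>\<omega>. f (X (t + s) \<omega>)) \<omega> = Z \<omega> * semigroup P X s f (X t \<omega>)"
      using strong_markov[OF st \<open>s \<ge> 0\<close> bcontfun_measurable[OF f] bcontfun_bounded[OF f]]
      by eventually_elim (simp add: semigroup_def \<open>t \<ge> 0\<close>)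
  qed
  finally show ?thesis .
qed

lemma semigroup_add:
  fixes f :: "'e \<Rightarrow> real"
  assumes "t \<ge> 0" "s \<ge> 0" "f \<in> bcontfun"
  shows "semigroup P X (t + s) f x = semigroup P X t (semigroup P X s f) x"
  using markov[OF assms, of "\<lambda>_. 1" x 1] by (simp add: semigroup_def)

section \<open>Products at finitely many times, and Fubini in time\<close>

definition evaluations :: "(real \<times> ('e \<Rightarrow> real)) list \<Rightarrow> 'w \<Rightarrow> real" where
  "evaluations xs \<omega> = prod_list (map (\<lambda>(t, f). f (X t \<omega>)) xs)"

lemma evaluations_measurable_F:
  assumes "\<And>t f. (t, f) \<in> set xs \<Longrightarrow> 0 \<le> t \<and> ennreal t \<le> T \<and> f \<in> bcontfun"
  shows "evaluations xs \<in> borel_measurable (F x T)"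
  using assms
proof (induction xs)
  case (Cons a xs)
  obtain t f where a: "a = (t, f)" by (cases a)
  have "evaluations (a # xs) = (\<lambda>\<omega>. f (X t \<omega>) * evaluations xs \<omega>)"
    by (auto simp: evaluations_def a)
  with Cons show ?case by (auto simp: a intro!: borel_measurable_times f_X_measurable_F)
qed (simp add: evaluations_def[abs_def])

lemma evaluations_measurable:
  assumes "\<And>t f. (t, f) \<in> set xs \<Longrightarrow> 0 \<le> t \<and> f \<in> bcontfun"
  shows "evaluations xs \<in> borel_measurable (P x)"
  by (rule measurable_F_P[OF evaluations_measurable_F[where T = \<top>]]) (use assms in auto)

lemma evaluations_bounded:
  assumes "\<And>t f. (t, f) \<in> set xs \<Longrightarrow> f \<in> bcontfun"
  shows "\<exists>B\<ge>0. \<forall>\<omega>. \<bar>evaluations xs \<omega>\<bar> \<le> B"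
  using assms
proof (induction xs)
  case Nil
  show ?case by (intro exI[of _ 1]) (simp add: evaluations_def)
next
  case (Cons a xs)
  obtain t f where a: "a = (t, f)" by (cases a)
  obtain B where "B \<ge> 0" "\<And>\<omega>. \<bar>evaluations xs \<omega>\<bar> \<le> B" using Cons by force
  moreover have "f \<in> bcontfun" using Cons.prems[of t f] by (simp add: a)
  then obtain B' where "B' \<ge> 0" "\<And>x. \<bar>f x\<bar> \<le> B'" using bcontfun_bound by metis
  ultimately show ?case
    by (intro exI[of _ "B' * B"]) (auto simp: evaluations_def a abs_mult intro!: mult_mono)
qed

text \<open>The Markov property at the last but one time \<open>s\<close> merges the two final
  factors into \<open>h\<close> times P_(t-s) f, which is again bounded and continuous; the list has
  become shorter. A single factor is the semigroup itself.\<close>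

lemma evaluations_sorted_continuous:
  assumes "sorted (map fst xs)" "\<And>t f. (t, f) \<in> set xs \<Longrightarrow> 0 \<le> t \<and> f \<in> bcontfun"
  shows "continuous_on UNIV (\<lambda>x. \<integral>\<omega>. evaluations xs \<omega> \<partial>P x)"
  using assms
proof (induction "length xs" arbitrary: xs rule: less_induct)
  case less
  show ?case
  proof (cases xs rule: rev_cases)
    case Nil
    then show ?thesis by (simp add: evaluations_def[abs_def] prob_space.prob_space[OF prob_space_P])
  next
    case (snoc ys p)
    obtain t f where p: "p = (t, f)" by (cases p)
    have tf: "t \<ge> 0" "f \<in> bcontfun" using less.prems(2)[of t f] by (auto simp: snoc p)
    show ?thesis
    proof (cases ys rule: rev_cases)
      case Nil
      then show ?thesis
        using semigroup_continuous[OF tf] by (simp add: snoc p evaluations_def[abs_def] semigroup_def[abs_def])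
    next
      case (snoc zs q)
      obtain s h where q: "q = (s, h)" by (cases q)
      have xs: "xs = zs @ [(s, h), (t, f)]" by (simp add: \<open>xs = ys @ [p]\<close> snoc p q)
      have sh: "s \<ge> 0" "h \<in> bcontfun" using less.prems(2)[of s h] by (auto simp: xs)
      have "s \<le> t" using less.prems(1) by (simp add: xs sorted_append)
      have le_s: "0 \<le> u \<and> ennreal u \<le> ennreal s \<and> k \<in> bcontfun" if "(u, k) \<in> set (zs @ [(s, h)])" for u k
        using less.prems that by (fastforce simp: xs sorted_append intro: ennreal_leI)
      let ?ws = "zs @ [(s, \<lambda>y. h y * semigroup P X (t - s) f y)]"
      have hs: "(\<lambda>y. h y * semigroup P X (t - s) f y) \<in> bcontfun"
        using sh tf \<open>s \<le> t\<close> by (intro bcontfun_mult semigroup_bcontfun) auto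
      have "(\<integral>\<omega>. evaluations xs \<omega> \<partial>P x) = (\<integral>\<omega>. evaluations ?ws \<omega> \<partial>P x)" for x
      proof -
        obtain B where B: "\<And>\<omega>. \<bar>evaluations (zs @ [(s, h)]) \<omega>\<bar> \<le> B"
          using evaluations_bounded[of "zs @ [(s, h)]"] le_s by blast
        have "(\<integral>\<omega>. evaluations xs \<omega> \<partial>P x)
            = (\<integral>\<omega>. evaluations (zs @ [(s, h)]) \<omega> * f (X (s + (t - s)) \<omega>) \<partial>P x)"
          by (simp add: xs evaluations_def mult.assoc)
        also have "\<dots> = (\<integral>\<omega>. evaluations (zs @ [(s, h)]) \<omega> * semigroup P X (t - s) f (X s \<omega>) \<partial>P x)"
          by (rule markov[where B = B]) (use \<open>s \<le> t\<close> sh tf B le_s in \<open>auto intro!: evaluations_measurable_F\<close>)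
        also have "\<dots> = (\<integral>\<omega>. evaluations ?ws \<omega> \<partial>P x)"
          by (simp add: evaluations_def mult.assoc)
        finally show ?thesis .
      qed
      moreover have "continuous_on UNIV (\<lambda>x. \<integral>\<omega>. evaluations ?ws \<omega> \<partial>P x)"
      proof (rule less.hyps)
        show "length ?ws < length xs" by (simp add: xs)
        show "sorted (map fst ?ws)" using less.prems(1) by (simp add: xs sorted_append)
        show "\<And>u k. (u, k) \<in> set ?ws \<Longrightarrow> 0 \<le> u \<and> k \<in> bcontfun"
          using less.prems(2) hs sh by (auto simp: xs)
      qed
      ultimately show ?thesis by simp
    qed
  qed
qed

text \<open>Sorting by time leaves the product unchanged. Unsorted lists occur because each power of
  \<open>I\<close> brings in a factor at an arbitrary time.\<close>

lemma evaluations_continuous: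
  assumes "\<And>t f. (t, f) \<in> set xs \<Longrightarrow> 0 \<le> t \<and> f \<in> bcontfun"
  shows "continuous_on UNIV (\<lambda>x. \<integral>\<omega>. evaluations xs \<omega> \<partial>P x)"
proof -
  have "evaluations xs = evaluations (sort_key fst xs)"
    unfolding evaluations_def[abs_def] by (simp flip: prod_mset_prod_list)
  then show ?thesis
    using evaluations_sorted_continuous[of "sort_key fst xs"] assms by simp
qed

text \<open>Fubini for the process integrated over a set of times. The measurability in time of the
  inner expectation is recorded as well, because dominated convergence in the time variable will use
  it.\<close>

lemma time_integral_swap:
  fixes \<phi> :: "'e \<Rightarrow> real"
  assumes \<phi>: "\<phi> \<in> bcontfun"
    and Y: "Y \<in> borel_measurable (P x)" "\<And>\<omega>. \<omega> \<in> \<Omega> \<Longrightarrow> \<bar>Y \<omega>\<bar> \<le> B"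
    and A: "A \<in> sets borel" "A \<subseteq> {0..}" "emeasure lborel A < \<infinity>"
  shows "(\<integral>\<omega>. (LINT s:A|lborel. \<phi> (X s \<omega>)) * Y \<omega> \<partial>P x)
           = (LINT s:A|lborel. (\<integral>\<omega>. \<phi> (X s \<omega>) * Y \<omega> \<partial>P x))"
    and "(\<lambda>s. indicator A s * (\<integral>\<omega>. \<phi> (X s \<omega>) * Y \<omega> \<partial>P x)) \<in> borel_measurable lborel"
proof -
  interpret prob_space "P x" by (rule prob_space_P)
  interpret pair_sigma_finite lborel "P x" ..
  obtain B' where B': "B' \<ge> 0" "\<And>x. \<bar>\<phi> x\<bar> \<le> B'" using bcontfun_bound[OF \<phi>] by metis
  let ?f = "\<lambda>s \<omega>. indicator A s * (\<phi> (X (max 0 s) \<omega>) * Y \<omega>)"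
  have [measurable]: "\<phi> \<in> borel_measurable borel" by (rule bcontfun_measurable[OF \<phi>])
  have [measurable]: "(\<lambda>p. X (max 0 (fst p)) (snd p)) \<in> borel_measurable (lborel \<Otimes>\<^sub>M P x)"
    by (subst measurable_cong_sets[OF sets_pair_measure_cong[OF sets_lborel refl] refl]) (rule X_joint_measurable)
  have meas: "case_prod ?f \<in> borel_measurable (lborel \<Otimes>\<^sub>M P x)"
    using Y(1) A(1) unfolding case_prod_beta by measurable
  have int: "integrable (lborel \<Otimes>\<^sub>M P x) (case_prod ?f)"
  proof (rule integrableI_bounded_set[where A = "A \<times> space (P x)" and B = "B' * B"])
    show "A \<times> space (P x) \<in> sets (lborel \<Otimes>\<^sub>M P x)" using A by auto
    have "emeasure (lborel \<Otimes>\<^sub>M P x) (A \<times> space (P x)) = emeasure lborel A * emeasure (P x) (space (P x))"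
      using A by (intro sigma_finite_measure.emeasure_pair_measure_Times[OF prob_space_imp_sigma_finite[OF prob_space_P]]) auto
    then show "emeasure (lborel \<Otimes>\<^sub>M P x) (A \<times> space (P x)) < \<infinity>"
      using A(3) by (simp add: emeasure_space_1)
    have "\<bar>Y \<omega>\<bar> \<le> B" "B \<ge> 0" if "\<omega> \<in> \<Omega>" for \<omega>
      using Y(2)[OF that] by auto
    then show "AE p in lborel \<Otimes>\<^sub>M P x. p \<in> A \<times> space (P x) \<longrightarrow> norm (case p of (s, \<omega>) \<Rightarrow> ?f s \<omega>) \<le> B' * B"
      using B' by (auto intro!: AE_I2 mult_mono simp: abs_mult space_P)
    show "AE p in lborel \<Otimes>\<^sub>M P x. p \<notin> A \<times> space (P x) \<longrightarrow> (case p of (s, \<omega>) \<Rightarrow> ?f s \<omega>) = 0"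
      by (rule AE_I2) (auto simp: space_pair_measure indicator_def)
  qed (rule meas)
  have nonneg_time: "?f s \<omega> = indicator A s * \<phi> (X s \<omega>) * Y \<omega>" for s \<omega>
    using A(2) by (auto simp: indicator_def max_absorb2)
  have inner: "(\<integral>\<omega>. ?f s \<omega> \<partial>P x) = indicator A s * (\<integral>\<omega>. \<phi> (X s \<omega>) * Y \<omega> \<partial>P x)" for s
    unfolding nonneg_time mult.assoc by (rule integral_mult_right_zero)
  have "(\<integral>\<omega>. (\<integral>s. ?f s \<omega> \<partial>lborel) \<partial>P x) = (\<integral>s. (\<integral>\<omega>. ?f s \<omega> \<partial>P x) \<partial>lborel)"
    by (rule Fubini_integral[OF int])
  then show "(\<integral>\<omega>. (LINT s:A|lborel. \<phi> (X s \<omega>)) * Y \<omega> \<partial>P x)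
           = (LINT s:A|lborel. (\<integral>\<omega>. \<phi> (X s \<omega>) * Y \<omega> \<partial>P x))"
    unfolding inner unfolding nonneg_time by (simp add: set_lebesgue_integral_def)
  show "(\<lambda>s. indicator A s * (\<integral>\<omega>. \<phi> (X s \<omega>) * Y \<omega> \<partial>P x)) \<in> borel_measurable lborel"
    using borel_measurable_integrable[OF integrable_fst[OF int]] unfolding inner .
qed

end

section \<open>The Feynman--Kac semigroup\<close>

context killed_feller_process
begin

lemma g_bcontfun: "g \<in> bcontfun"
  by (rule bcontfunI[OF g_continuous bounded_rangeI[of _ b]]) (rule abs_g_le)

text \<open>One factor of the power is a time integral of \<open>g (X s \<omega>)\<close>. Fubini
  takes this integral out of the expectation; the induction hypothesis with \<open>(s, g)\<close>
  added to the list gives continuity for each \<open>s\<close>, and dominated convergence restores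
  the integral. The list in the statement is what lets the induction run.\<close>

lemma I_power_continuous:
  assumes "r \<ge> 0" "\<And>t f. (t, f) \<in> set xs \<Longrightarrow> 0 \<le> t \<and> f \<in> bcontfun"
  shows "continuous_on UNIV (\<lambda>x. \<integral>\<omega>. I r \<omega> ^ n * evaluations xs \<omega> \<partial>P x)"
  using assms(2)
proof (induction n arbitrary: xs)
  case 0
  then show ?case using evaluations_continuous[of xs] by simp
next
  case (Suc n)
  obtain B where B: "B \<ge> 0" "\<And>\<omega>. \<bar>evaluations xs \<omega>\<bar> \<le> B"
    using evaluations_bounded[of xs] Suc.prems by blast
  define Y where "Y \<omega> = I r \<omega> ^ n * evaluations xs \<omega>" for \<omega>
  define C where "C = (b * r) ^ n * B"
  have "C \<ge> 0" using B b_nonneg \<open>r \<ge> 0\<close> by (simp add: C_def)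
  have Y_meas: "Y \<in> borel_measurable (P x)" for x
    unfolding Y_def by (intro borel_measurable_times borel_measurable_power I_measurable
        evaluations_measurable \<open>r \<ge> 0\<close> Suc.prems)
  have Y_bound: "\<bar>Y \<omega>\<bar> \<le> C" if "\<omega> \<in> \<Omega>" for \<omega>
    unfolding Y_def C_def abs_mult power_abs
    using I_nonneg[OF that \<open>r \<ge> 0\<close>] I_le[OF that \<open>r \<ge> 0\<close>] B b_nonneg \<open>r \<ge> 0\<close>
    by (intro mult_mono power_mono) auto
  define \<phi> where "\<phi> s x = (\<integral>\<omega>. g (X s \<omega>) * Y \<omega> \<partial>P x)" for s x
  have \<phi>_cont: "continuous_on UNIV (\<phi> s)" if "s \<ge> 0" for s
  proof -
    have "continuous_on UNIV (\<lambda>x. \<integral>\<omega>. I r \<omega> ^ n * evaluations ((s, g) # xs) \<omega> \<partial>P x)"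
      using Suc.prems that g_bcontfun by (intro Suc.IH) auto
    then show ?thesis by (simp add: \<phi>_def[abs_def] Y_def evaluations_def mult.left_commute)
  qed
  have \<phi>_bound: "\<bar>\<phi> s x\<bar> \<le> b * C" for s x
    unfolding \<phi>_def abs_mult using \<open>C \<ge> 0\<close> b_nonneg
    by (intro abs_integral_P_le) (auto simp: abs_mult intro!: mult_mono abs_g_le Y_bound)
  have rep: "(\<integral>\<omega>. I r \<omega> ^ Suc n * evaluations xs \<omega> \<partial>P x) = (\<integral>s. indicator {0..r} s * \<phi> s x \<partial>lborel)"
    and meas: "(\<lambda>s. indicator {0..r} s * \<phi> s x) \<in> borel_measurable lborel" for x
  proof -
    have "I r \<omega> ^ Suc n * evaluations xs \<omega> = (LINT s:{0..r}|lborel. g (X s \<omega>)) * Y \<omega>" for \<omega>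
      by (simp add: Y_def I_def mult.assoc)
    then show "(\<integral>\<omega>. I r \<omega> ^ Suc n * evaluations xs \<omega> \<partial>P x) = (\<integral>s. indicator {0..r} s * \<phi> s x \<partial>lborel)"
      using time_integral_swap(1)[OF g_bcontfun Y_meas Y_bound, of "{0..r}" x] \<open>r \<ge> 0\<close>
      by (simp add: \<phi>_def set_lebesgue_integral_def)
    show "(\<lambda>s. indicator {0..r} s * \<phi> s x) \<in> borel_measurable lborel"
      using time_integral_swap(2)[OF g_bcontfun Y_meas Y_bound, of "{0..r}" x] \<open>r \<ge> 0\<close>
      by (simp add: \<phi>_def)
  qed
  show ?case
    unfolding rep continuous_on_sequentially
  proof (intro allI ballI impI, elim conjE)
    fix u :: "nat \<Rightarrow> 'e" and x assume u: "u \<longlonglongrightarrow> x"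
    have "(\<lambda>n. \<integral>s. indicator {0..r} s * \<phi> s (u n) \<partial>lborel) \<longlonglongrightarrow> (\<integral>s. indicator {0..r} s * \<phi> s x \<partial>lborel)"
    proof (rule integral_dominated_convergence[where w = "\<lambda>s. indicator {0..r} s * (b * C)"])
      show "integrable lborel (\<lambda>s. indicator {0..r} s * (b * C))"
        using \<open>r \<ge> 0\<close> by (intro integrable_mult_left) (simp add: integrable_indicator_iff)
      show "AE s in lborel. (\<lambda>n. indicator {0..r} s * \<phi> s (u n)) \<longlonglongrightarrow> indicator {0..r} s * \<phi> s x"
      proof (rule AE_I2)
        fix s :: real
        show "(\<lambda>n. indicator {0..r} s * \<phi> s (u n)) \<longlonglongrightarrow> indicator {0..r} s * \<phi> s x"
          using continuous_on_tendsto_compose[OF \<phi>_cont u, of s]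
          by (cases "s \<in> {0..r}") auto
      qed
      show "AE s in lborel. norm (indicator {0..r} s * \<phi> s (u n)) \<le> indicator {0..r} s * (b * C)" for n
        using \<phi>_bound by (auto simp: indicator_def)
    qed (rule meas)+
    then show "((\<lambda>x. \<integral>s. indicator {0..r} s * \<phi> s x \<partial>lborel) \<circ> u) \<longlonglongrightarrow> (\<integral>s. indicator {0..r} s * \<phi> s x \<partial>lborel)"
      by (simp add: o_def)
  qed
qed

definition Q :: "real \<Rightarrow> ('e \<Rightarrow> real) \<Rightarrow> 'e \<Rightarrow> real" where
  "Q r f x = (\<integral>\<omega>. exp (I r \<omega>) * f (X r \<omega>) \<partial>P x)"

lemma exp_I_f_measurable:
  assumes "r \<ge> 0" "f \<in> bcontfun"
  shows "(\<lambda>\<omega>. exp (I r \<omega>) * f (X r \<omega>)) \<in> borel_measurable (P x)"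
  using I_measurable[OF assms(1), of x] f_X_measurable[OF assms(2,1), of x] by measurable

lemma exp_I_f_bound:
  assumes "r \<ge> 0" "\<And>y. \<bar>f y\<bar> \<le> B" "\<omega> \<in> \<Omega>"
  shows "\<bar>exp (I r \<omega>) * f (X r \<omega>)\<bar> \<le> exp (b * r) * B"
  unfolding abs_mult using I_le[OF assms(3,1)] assms(2) by (intro mult_mono) auto

lemma integrable_exp_I_f:
  assumes "r \<ge> 0" "f \<in> bcontfun"
  shows "integrable (P x) (\<lambda>\<omega>. exp (I r \<omega>) * f (X r \<omega>))"
proof -
  obtain B where "\<And>x. \<bar>f x\<bar> \<le> B" using bcontfun_bound[OF assms(2)] by metis
  then show ?thesis
    by (intro integrable_P_bounded[OF exp_I_f_measurable[OF assms], where B = "exp (b * r) * B"] exp_I_f_bound[OF assms(1)])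
qed

lemma abs_Q_le:
  assumes "r \<ge> 0" "\<And>y. \<bar>f y\<bar> \<le> B"
  shows "\<bar>Q r f x\<bar> \<le> exp (b * r) * B"
proof -
  have "B \<ge> 0" using order_trans[OF abs_ge_zero assms(2)] .
  then show ?thesis unfolding Q_def by (intro abs_integral_P_le exp_I_f_bound assms) auto
qed

text \<open>Partial sums of the exponential series give continuous functions by
  \<open>I_power_continuous\<close>. Since \<open>I r\<close> lies between 0 and
  \<open>b * r\<close>, the error of truncating the series is uniform in the starting point.\<close>

lemma Q_continuous:
  assumes "r \<ge> 0" and f: "f \<in> bcontfun"
  shows "continuous_on UNIV (Q r f)"
proof -
  obtain B where B: "B \<ge> 0" "\<And>x. \<bar>f x\<bar> \<le> B" using bcontfun_bound[OF f] by metis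
  define p where "p N y = (\<Sum>n<N. y ^ n / fact n)" for N and y :: real
  define S where "S N x = (\<integral>\<omega>. p N (I r \<omega>) * f (X r \<omega>) \<partial>P x)" for N x
  have int: "integrable (P x) (\<lambda>\<omega>. I r \<omega> ^ n * f (X r \<omega>))" for n x
  proof (rule integrable_P_bounded[where B = "(b * r) ^ n * B"])
    show "(\<lambda>\<omega>. I r \<omega> ^ n * f (X r \<omega>)) \<in> borel_measurable (P x)"
      by (intro borel_measurable_times borel_measurable_power I_measurable f_X_measurable assms)
    show "\<bar>I r \<omega> ^ n * f (X r \<omega>)\<bar> \<le> (b * r) ^ n * B" if "\<omega> \<in> \<Omega>" for \<omega>
      unfolding abs_mult power_abs
      using I_nonneg[OF that \<open>r \<ge> 0\<close>] I_le[OF that \<open>r \<ge> 0\<close>] B b_nonneg \<open>r \<ge> 0\<close>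
      by (intro mult_mono power_mono) auto
  qed
  have S_eq: "S N x = (\<Sum>n<N. (\<integral>\<omega>. I r \<omega> ^ n * evaluations [(r, f)] \<omega> \<partial>P x) / fact n)" for N x
  proof -
    have "S N x = (\<integral>\<omega>. (\<Sum>n<N. (I r \<omega> ^ n * f (X r \<omega>)) / fact n) \<partial>P x)"
      by (simp add: S_def p_def sum_distrib_right)
    also have "\<dots> = (\<Sum>n<N. (\<integral>\<omega>. (I r \<omega> ^ n * f (X r \<omega>)) / fact n \<partial>P x))"
      by (rule Bochner_Integration.integral_sum) (intro integrable_divide_zero int)
    finally show ?thesis by (simp add: evaluations_def)
  qed
  have S_cont: "continuous_on UNIV (S N)" for N
    unfolding S_eq[abs_def]
    by (intro continuous_on_sum continuous_on_divide I_power_continuous continuous_on_const) (use assms in auto)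
  have S_int: "integrable (P x) (\<lambda>\<omega>. p N (I r \<omega>) * f (X r \<omega>))" for N x
  proof -
    have "integrable (P x) (\<lambda>\<omega>. (\<Sum>n<N. (I r \<omega> ^ n * f (X r \<omega>)) / fact n))"
      by (intro Bochner_Integration.integrable_sum integrable_divide_zero int)
    then show ?thesis by (simp add: p_def sum_distrib_right)
  qed
  define err where "err N = (exp (b * r) - p N (b * r)) * B" for N
  have close: "\<bar>Q r f x - S N x\<bar> \<le> err N" for N x
  proof -
    have tail: "0 \<le> exp (b * r) - p N (b * r)"
      unfolding p_def
      by (rule order_trans[OF abs_ge_zero exp_tail_mono[of "b * r" "b * r" N]])
         (use b_nonneg \<open>r \<ge> 0\<close> in auto)
    then have nonneg: "0 \<le> err N" using B by (simp add: err_def)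
    have "Q r f x - S N x = (\<integral>\<omega>. exp (I r \<omega>) * f (X r \<omega>) - p N (I r \<omega>) * f (X r \<omega>) \<partial>P x)"
      unfolding Q_def S_def
      by (rule Bochner_Integration.integral_diff[symmetric]) (intro integrable_exp_I_f assms S_int)+
    also have "\<bar>\<dots>\<bar> \<le> err N"
    proof (rule abs_integral_P_le[OF _ nonneg])
      fix \<omega> assume \<omega>: "\<omega> \<in> \<Omega>"
      have "\<bar>exp (I r \<omega>) * f (X r \<omega>) - p N (I r \<omega>) * f (X r \<omega>)\<bar>
          = \<bar>exp (I r \<omega>) - p N (I r \<omega>)\<bar> * \<bar>f (X r \<omega>)\<bar>"
        by (simp add: left_diff_distrib flip: abs_mult)
      also have "\<dots> \<le> err N"
        unfolding err_def p_def using B \<omega> \<open>r \<ge> 0\<close> exp_tail_mono[of "I r \<omega>" "b * r" N] tail[unfolded p_def]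
        by (intro mult_mono) (auto intro: I_nonneg I_le)
      finally show "\<bar>exp (I r \<omega>) * f (X r \<omega>) - p N (I r \<omega>) * f (X r \<omega>)\<bar> \<le> err N" .
    qed
    finally show ?thesis .
  qed
  have "err \<longlonglongrightarrow> (exp (b * r) - exp (b * r)) * B"
  proof -
    have "(\<lambda>n. (b * r) ^ n / fact n) sums exp (b * r)"
      using exp_converges[of "b * r"] by (simp add: divide_inverse mult.commute)
    then have "(\<lambda>N. p N (b * r)) \<longlonglongrightarrow> exp (b * r)" by (simp add: sums_def p_def)
    then show ?thesis unfolding err_def[abs_def] by (intro tendsto_intros)
  qed
  then have err_lim: "err \<longlonglongrightarrow> 0" by simp
  have "uniform_limit UNIV S (Q r f) sequentially"
  proof (rule uniform_limitI)
    fix e :: real assume "e > 0"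
    then have "\<forall>\<^sub>F N in sequentially. err N < e" using order_tendstoD(2)[OF err_lim] by blast
    then show "\<forall>\<^sub>F N in sequentially. \<forall>x\<in>UNIV. dist (S N x) (Q r f x) < e"
      by eventually_elim (use close in \<open>auto simp: dist_real_def abs_minus_commute intro: le_less_trans\<close>)
  qed
  then show ?thesis
    by (rule uniform_limit_theorem[rotated]) (use S_cont in auto)
qed

lemma Q_bcontfun:
  assumes "r \<ge> 0" "f \<in> bcontfun"
  shows "Q r f \<in> bcontfun"
proof -
  obtain B where "\<And>x. \<bar>f x\<bar> \<le> B" using bcontfun_bound[OF assms(2)] by metis
  then have "bounded (range (Q r f))"
    by (intro bounded_rangeI[of _ "exp (b * r) * B"] abs_Q_le assms)
  then show ?thesis using Q_continuous[OF assms] by (rule bcontfunI[rotated])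
qed

text \<open>One step of a time discretisation of \<open>Q\<close>: over a mesh interval the cost
  rate is frozen at the right end, so that finitely many times enter and \<open>markov\<close>
  applies.\<close>

definition kac_step :: "real \<Rightarrow> ('e \<Rightarrow> real) \<Rightarrow> 'e \<Rightarrow> real" where
  "kac_step d f = semigroup P X d (\<lambda>y. exp (d * g y) * f y)"

lemma exp_g_bcontfun: "(\<lambda>y. exp (d * g y)) \<in> bcontfun" if "d \<ge> 0"
proof (rule bcontfunI)
  show "bounded (range (\<lambda>y. exp (d * g y)))"
    by (rule bounded_rangeI[of _ "exp (d * b)"]) (use that g_le in \<open>auto intro!: mult_left_mono\<close>)
qed (intro continuous_intros g_continuous)

lemma kac_step_bcontfun: "d \<ge> 0 \<Longrightarrow> f \<in> bcontfun \<Longrightarrow> kac_step d f \<in> bcontfun"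
  unfolding kac_step_def by (intro semigroup_bcontfun bcontfun_mult exp_g_bcontfun)

lemma kac_step_pow_bcontfun: "d \<ge> 0 \<Longrightarrow> f \<in> bcontfun \<Longrightarrow> (kac_step d ^^ m) f \<in> bcontfun"
  by (induction m) (auto intro: kac_step_bcontfun)

definition Riemann_I :: "real \<Rightarrow> real \<Rightarrow> nat \<Rightarrow> 'w \<Rightarrow> real" where
  "Riemann_I t d m \<omega> = (\<Sum>i<m. d * g (X (t + real (Suc i) * d) \<omega>))"

lemma Riemann_I_measurable_F:
  assumes "t \<ge> 0" "d \<ge> 0"
  shows "Riemann_I t d m \<in> borel_measurable (F x (ennreal (t + real m * d)))"
proof -
  have "0 \<le> t + real (Suc i) * d \<and> t + real (Suc i) * d \<le> t + real m * d" if "i < m" for i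
    using assms that by (auto intro!: mult_right_mono)
  then show ?thesis
    unfolding Riemann_I_def using assms
    by (intro borel_measurable_sum borel_measurable_times[OF borel_measurable_const f_X_measurable_F] g_bcontfun ennreal_leI) auto
qed

lemma Riemann_I_bounds:
  assumes "d \<ge> 0"
  shows "0 \<le> Riemann_I t d m \<omega>" "Riemann_I t d m \<omega> \<le> b * (real m * d)"
proof -
  show "0 \<le> Riemann_I t d m \<omega>"
    unfolding Riemann_I_def using assms g_nonneg by (intro sum_nonneg) auto
  have "Riemann_I t d m \<omega> \<le> (\<Sum>i<m. d * b)"
    unfolding Riemann_I_def using assms g_le by (intro sum_mono mult_left_mono) auto
  then show "Riemann_I t d m \<omega> \<le> b * (real m * d)" by (simp add: mult_ac)
qed

text \<open>\<open>markov\<close> at the last but one grid time absorbs the last weight and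
  \<open>f\<close> into \<open>kac_step d f\<close>. The induction therefore has to range over all
  \<open>f\<close>.\<close>

lemma markov_kac_step:
  assumes "t \<ge> 0" "d \<ge> 0" "f \<in> bcontfun"
    and Z: "Z \<in> borel_measurable (F x (ennreal t))" "\<And>\<omega>. \<omega> \<in> \<Omega> \<Longrightarrow> \<bar>Z \<omega>\<bar> \<le> B"
  shows "(\<integral>\<omega>. Z \<omega> * (exp (Riemann_I t d m \<omega>) * f (X (t + real m * d) \<omega>)) \<partial>P x)
           = (\<integral>\<omega>. Z \<omega> * (kac_step d ^^ m) f (X t \<omega>) \<partial>P x)"
  using assms(3)
proof (induction m arbitrary: f)
  case 0
  then show ?case by (simp add: Riemann_I_def)
next
  case (Suc m)
  let ?t = "t + real m * d"
  let ?Z = "\<lambda>\<omega>. Z \<omega> * exp (Riemann_I t d m \<omega>)"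
  have t: "?t \<ge> 0" "t \<le> ?t" using assms by auto
  have "(\<integral>\<omega>. Z \<omega> * (exp (Riemann_I t d (Suc m) \<omega>) * f (X (t + real (Suc m) * d) \<omega>)) \<partial>P x)
      = (\<integral>\<omega>. ?Z \<omega> * (exp (d * g (X (?t + d) \<omega>)) * f (X (?t + d) \<omega>)) \<partial>P x)"
    by (simp add: Riemann_I_def exp_add algebra_simps)
  also have "\<dots> = (\<integral>\<omega>. ?Z \<omega> * semigroup P X d (\<lambda>y. exp (d * g y) * f y) (X ?t \<omega>) \<partial>P x)"
  proof (rule markov[where B = "B * exp (b * (real m * d))"])
    show "?Z \<in> borel_measurable (F x (ennreal ?t))"
      using measurable_F_mono[OF Z(1) ennreal_leI[OF t(2)]] Riemann_I_measurable_F[OF assms(1,2), of m x]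
      by measurable
    show "\<bar>?Z \<omega>\<bar> \<le> B * exp (b * (real m * d))" if "\<omega> \<in> \<Omega>" for \<omega>
      unfolding abs_mult using Z(2)[OF that] Riemann_I_bounds[OF assms(2), of t m \<omega>]
      by (intro mult_mono) auto
  qed (use assms Suc.prems t in \<open>auto intro!: bcontfun_mult exp_g_bcontfun\<close>)
  also have "\<dots> = (\<integral>\<omega>. Z \<omega> * (exp (Riemann_I t d m \<omega>) * kac_step d f (X ?t \<omega>)) \<partial>P x)"
    by (simp add: kac_step_def mult.assoc)
  also have "\<dots> = (\<integral>\<omega>. Z \<omega> * (kac_step d ^^ m) (kac_step d f) (X t \<omega>) \<partial>P x)"
    by (rule Suc.IH[OF kac_step_bcontfun[OF assms(2) Suc.prems]])
  finally show ?case by (simp add: funpow_swap1)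
qed

lemma kac_step_pow_eq:
  assumes "d \<ge> 0" "f \<in> bcontfun"
  shows "(kac_step d ^^ m) f x = (\<integral>\<omega>. exp (Riemann_I 0 d m \<omega>) * f (X (real m * d) \<omega>) \<partial>P x)"
proof -
  have "(\<integral>\<omega>. 1 * (exp (Riemann_I 0 d m \<omega>) * f (X (0 + real m * d) \<omega>)) \<partial>P x)
           = (\<integral>\<omega>. 1 * (kac_step d ^^ m) f (X 0 \<omega>) \<partial>P x)"
    by (rule markov_kac_step[where B = 1]) (use assms in auto)
  then show ?thesis
    using expectation_X_0[OF kac_step_pow_bcontfun[OF assms]] by simp
qed

lemma abs_kac_step_pow_le:
  assumes "d \<ge> 0" "f \<in> bcontfun" "\<And>y. \<bar>f y\<bar> \<le> B"
  shows "\<bar>(kac_step d ^^ m) f x\<bar> \<le> exp (b * (real m * d)) * B"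
proof -
  have "B \<ge> 0" using order_trans[OF abs_ge_zero assms(3)] .
  then show ?thesis
    unfolding kac_step_pow_eq[OF assms(1,2)] using Riemann_I_bounds[OF assms(1)] assms(3)
    by (intro abs_integral_P_le) (auto simp: abs_mult intro!: mult_mono)
qed

lemma exp_Riemann_I_tendsto:
  assumes "t \<ge> 0" "r \<ge> 0" and f: "f \<in> bcontfun"
    and Z: "Z \<in> borel_measurable (P x)" "\<And>\<omega>. \<omega> \<in> \<Omega> \<Longrightarrow> \<bar>Z \<omega>\<bar> \<le> B"
  shows "(\<lambda>m. \<integral>\<omega>. Z \<omega> * (exp (Riemann_I t (r / real (Suc m)) (Suc m) \<omega>) * f (X (t + r) \<omega>)) \<partial>P x)
           \<longlonglongrightarrow> (\<integral>\<omega>. Z \<omega> * (exp (I (t + r) \<omega> - I t \<omega>) * f (X (t + r) \<omega>)) \<partial>P x)"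
proof -
  obtain B' where B': "B' \<ge> 0" "\<And>x. \<bar>f x\<bar> \<le> B'" using bcontfun_bound[OF f] by metis
  show ?thesis
  proof (rule dominated_convergence_P[where B = "B * (exp (b * r) * B')"])
    fix m
    show "(\<lambda>\<omega>. Z \<omega> * (exp (Riemann_I t (r / real (Suc m)) (Suc m) \<omega>) * f (X (t + r) \<omega>))) \<in> borel_measurable (P x)"
    proof -
      have [measurable]: "Riemann_I t (r / real (Suc m)) (Suc m) \<in> borel_measurable (P x)"
        by (rule measurable_F_P[OF Riemann_I_measurable_F]) (use assms in auto)
      have [measurable]: "(\<lambda>\<omega>. f (X (t + r) \<omega>)) \<in> borel_measurable (P x)"
        using assms by (intro f_X_measurable f) auto
      show ?thesis using Z(1) by measurable
    qed
    fix \<omega> assume \<omega>: "\<omega> \<in> \<Omega>"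
    show "\<bar>Z \<omega> * (exp (Riemann_I t (r / real (Suc m)) (Suc m) \<omega>) * f (X (t + r) \<omega>))\<bar> \<le> B * (exp (b * r) * B')"
      unfolding abs_mult using Z(2)[OF \<omega>] Riemann_I_bounds[of "r / real (Suc m)" t "Suc m" \<omega>] B' assms(2)
      by (intro mult_mono) auto
  next
    fix \<omega> assume \<omega>: "\<omega> \<in> \<Omega>"
    show "(\<lambda>m. Z \<omega> * (exp (Riemann_I t (r / real (Suc m)) (Suc m) \<omega>) * f (X (t + r) \<omega>)))
        \<longlonglongrightarrow> Z \<omega> * (exp (I (t + r) \<omega> - I t \<omega>) * f (X (t + r) \<omega>))"
      unfolding Riemann_I_def by (intro tendsto_intros Riemann_sum_I \<omega> assms)
  qed
qed

lemma kac_step_pow_tendsto: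
  assumes "r \<ge> 0" "f \<in> bcontfun"
  shows "(\<lambda>m. (kac_step (r / real (Suc m)) ^^ Suc m) f x) \<longlonglongrightarrow> Q r f x"
proof -
  have "(kac_step (r / real (Suc m)) ^^ Suc m) f x
      = (\<integral>\<omega>. 1 * (exp (Riemann_I 0 (r / real (Suc m)) (Suc m) \<omega>) * f (X (0 + r) \<omega>)) \<partial>P x)" for m
    using kac_step_pow_eq[of "r / real (Suc m)" f "Suc m" x] assms
    by (simp del: funpow.simps of_nat_Suc)
  moreover have "(\<lambda>m. \<integral>\<omega>. 1 * (exp (Riemann_I 0 (r / real (Suc m)) (Suc m) \<omega>) * f (X (0 + r) \<omega>)) \<partial>P x)
           \<longlonglongrightarrow> (\<integral>\<omega>. 1 * (exp (I (0 + r) \<omega> - I 0 \<omega>) * f (X (0 + r) \<omega>)) \<partial>P x)"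
    by (rule exp_Riemann_I_tendsto[where B = 1]) (use assms in auto)
  ultimately show ?thesis by (simp add: Q_def I_0 del: funpow.simps of_nat_Suc)
qed

text \<open>The weight between \<open>t\<close> and \<open>t + r\<close> involves the whole path in
  between, beyond the reach of \<open>markov\<close>. Both sides are limits of their discretised
  versions, which agree by \<open>markov_kac_step\<close>.\<close>

lemma markov_Q:
  assumes "t \<ge> 0" "r \<ge> 0" and f: "f \<in> bcontfun"
    and Z: "Z \<in> borel_measurable (F x (ennreal t))" "\<And>\<omega>. \<omega> \<in> \<Omega> \<Longrightarrow> \<bar>Z \<omega>\<bar> \<le> B"
  shows "(\<integral>\<omega>. Z \<omega> * (exp (I (t + r) \<omega> - I t \<omega>) * f (X (t + r) \<omega>)) \<partial>P x)
           = (\<integral>\<omega>. Z \<omega> * Q r f (X t \<omega>) \<partial>P x)"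
proof (rule LIMSEQ_unique)
  obtain B' where B': "B' \<ge> 0" "\<And>x. \<bar>f x\<bar> \<le> B'" using bcontfun_bound[OF f] by metis
  have ZP: "Z \<in> borel_measurable (P x)" by (rule measurable_F_P[OF Z(1)])
  show "(\<lambda>m. \<integral>\<omega>. Z \<omega> * (exp (Riemann_I t (r / real (Suc m)) (Suc m) \<omega>) * f (X (t + r) \<omega>)) \<partial>P x)
           \<longlonglongrightarrow> (\<integral>\<omega>. Z \<omega> * (exp (I (t + r) \<omega> - I t \<omega>) * f (X (t + r) \<omega>)) \<partial>P x)"
    by (rule exp_Riemann_I_tendsto[OF assms(1,2) f ZP Z(2)])
  have "(\<lambda>m. \<integral>\<omega>. Z \<omega> * (kac_step (r / real (Suc m)) ^^ Suc m) f (X t \<omega>) \<partial>P x)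
      \<longlonglongrightarrow> (\<integral>\<omega>. Z \<omega> * Q r f (X t \<omega>) \<partial>P x)"
  proof (rule dominated_convergence_P[where B = "B * (exp (b * r) * B')"])
    fix m
    have d: "r / real (Suc m) \<ge> 0" using assms(2) by simp
    show "(\<lambda>\<omega>. Z \<omega> * (kac_step (r / real (Suc m)) ^^ Suc m) f (X t \<omega>)) \<in> borel_measurable (P x)"
      by (intro borel_measurable_times ZP f_X_measurable kac_step_pow_bcontfun d f assms)
    fix \<omega> assume \<omega>: "\<omega> \<in> \<Omega>"
    have "\<bar>(kac_step (r / real (Suc m)) ^^ Suc m) f (X t \<omega>)\<bar> \<le> exp (b * r) * B'"
      using abs_kac_step_pow_le[OF d f B'(2), of "Suc m" "X t \<omega>"] by (simp del: funpow.simps of_nat_Suc)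
    then show "\<bar>Z \<omega> * (kac_step (r / real (Suc m)) ^^ Suc m) f (X t \<omega>)\<bar> \<le> B * (exp (b * r) * B')"
      unfolding abs_mult using Z(2)[OF \<omega>] B' by (intro mult_mono) auto
  qed (intro tendsto_intros kac_step_pow_tendsto assms)
  moreover have "(\<integral>\<omega>. Z \<omega> * (exp (Riemann_I t (r / real (Suc m)) (Suc m) \<omega>) * f (X (t + r) \<omega>)) \<partial>P x)
      = (\<integral>\<omega>. Z \<omega> * (kac_step (r / real (Suc m)) ^^ Suc m) f (X t \<omega>) \<partial>P x)" for m
    using markov_kac_step[OF assms(1) _ f Z, of "r / real (Suc m)" "Suc m"] assms(2)
    by (simp del: funpow.simps of_nat_Suc)
  ultimately show "(\<lambda>m. \<integral>\<omega>. Z \<omega> * (exp (Riemann_I t (r / real (Suc m)) (Suc m) \<omega>) * f (X (t + r) \<omega>)) \<partial>P x)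
      \<longlonglongrightarrow> (\<integral>\<omega>. Z \<omega> * Q r f (X t \<omega>) \<partial>P x)"
    by simp
qed

text \<open>\<open>markov_Q\<close> with the weight accumulated up to time \<open>s\<close> as the
  test variable.\<close>

lemma Q_add:
  assumes "s \<ge> 0" "t \<ge> 0" "f \<in> bcontfun"
  shows "Q (s + t) f x = Q s (Q t f) x"
proof -
  have "Q (s + t) f x = (\<integral>\<omega>. exp (I s \<omega>) * (exp (I (s + t) \<omega> - I s \<omega>) * f (X (s + t) \<omega>)) \<partial>P x)"
    unfolding Q_def by (simp flip: mult.assoc exp_add)
  also have "\<dots> = (\<integral>\<omega>. exp (I s \<omega>) * Q t f (X s \<omega>) \<partial>P x)"
  proof (rule markov_Q[where B = "exp (b * s)"])
    show "(\<lambda>\<omega>. exp (I s \<omega>)) \<in> borel_measurable (F x (ennreal s))"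
      using I_measurable_F[OF assms(1) order_refl, of x] by measurable
  qed (use assms I_le in auto)
  finally show ?thesis by (simp add: Q_def)
qed

lemma Q_mono:
  assumes "r \<ge> 0" "f \<in> bcontfun" "h \<in> bcontfun" "\<And>y. f y \<le> h y"
  shows "Q r f x \<le> Q r h x"
  unfolding Q_def by (intro integral_mono integrable_exp_I_f assms) (auto intro: assms)

lemma Q_add_fun:
  assumes "r \<ge> 0" "f \<in> bcontfun" "h \<in> bcontfun"
  shows "Q r (\<lambda>y. f y + h y) x = Q r f x + Q r h x"
  unfolding Q_def distrib_left
  by (rule Bochner_Integration.integral_add) (intro integrable_exp_I_f assms)+

lemma Q_cmult: "Q r (\<lambda>y. a * f y) x = a * Q r f x"
  unfolding Q_def by (simp add: mult.left_commute)

lemma Q_one_ge: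
  assumes "r \<ge> 0" "\<And>y. c \<le> g y"
  shows "exp (c * r) \<le> Q r (\<lambda>_. 1) x"
proof -
  have one: "(\<lambda>_. 1 :: real) \<in> bcontfun" by (rule const_bcontfun)
  have "exp (c * r) = (\<integral>\<omega>. exp (c * r) \<partial>P x)" by (simp only: expectation_const)
  also have "\<dots> \<le> (\<integral>\<omega>. exp (I r \<omega>) * 1 \<partial>P x)"
  proof (rule integral_mono_AE)
    show "integrable (P x) (\<lambda>\<omega>. exp (I r \<omega>) * 1)" by (rule integrable_exp_I_f[OF assms(1) one])
    show "integrable (P x) (\<lambda>\<omega>. exp (c * r))" by (rule integrable_P_bounded) auto
    show "AE \<omega> in P x. exp (c * r) \<le> exp (I r \<omega>) * 1"
      using I_diff_ge[of _ 0 r c] assms by (intro AE_P_I) (simp add: I_0)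
  qed
  finally show ?thesis by (simp add: Q_def)
qed

lemma Q_one_le: "r \<ge> 0 \<Longrightarrow> Q r (\<lambda>_. 1) x \<le> exp (b * r)"
  using abs_Q_le[of r "\<lambda>_. 1" 1 x] by simp

end

section \<open>Strong continuity\<close>

context feller_process
begin

lemma semigroup_linear:
  fixes u v :: "'e \<Rightarrow> real"
  assumes "t \<ge> 0" "u \<in> bcontfun" "v \<in> bcontfun"
  shows "semigroup P X t (\<lambda>y. a * u y + k * v y) x = a * semigroup P X t u x + k * semigroup P X t v x"
  unfolding semigroup_def
  by (subst Bochner_Integration.integral_add) (auto intro!: integrable_f_X assms)

lemma semigroup_diff:
  fixes u v :: "'e \<Rightarrow> real"
  assumes "t \<ge> 0" "u \<in> bcontfun" "v \<in> bcontfun"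
  shows "semigroup P X t (\<lambda>y. u y - v y) x = semigroup P X t u x - semigroup P X t v x"
  using semigroup_linear[OF assms, of 1 "-1" x] by simp

lemma semigroup_right_continuous:
  fixes f :: "'e \<Rightarrow> real"
  assumes "f \<in> bcontfun" "t \<ge> 0" "u \<longlonglongrightarrow> t" "\<And>n. u n \<ge> t"
  shows "(\<lambda>n. semigroup P X (u n) f x) \<longlonglongrightarrow> semigroup P X t f x"
  unfolding semigroup_def
proof -
  obtain B where B: "\<And>x. \<bar>f x\<bar> \<le> B" using bcontfun_bound[OF assms(1)] by metis
  have "u n \<ge> 0" for n using assms(2,4) order_trans by blast
  then show "(\<lambda>n. \<integral>\<omega>. f (X (u n) \<omega>) \<partial>P x) \<longlonglongrightarrow> (\<integral>\<omega>. f (X t \<omega>) \<partial>P x)"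
  proof (intro dominated_convergence_P[where B = B] f_X_measurable assms)
    fix \<omega> assume "\<omega> \<in> \<Omega>"
    then show "(\<lambda>n. f (X (u n) \<omega>)) \<longlonglongrightarrow> f (X t \<omega>)"
      using continuous_on_tendsto_compose[OF bcontfun_continuous[OF assms(1)] X_right_continuous] assms by auto
  qed (use B in auto)
qed

lemma semigroup_0: "f \<in> bcontfun \<Longrightarrow> semigroup P X 0 f x = f x" for f :: "'e \<Rightarrow> real"
  by (simp add: semigroup_def expectation_X_0)

text \<open>A smoothing in time: the averages tend to \<open>f\<close> pointwise as \<open>d\<close>
  tends to 0, and the semigroup moves each of them at a bounded speed.\<close>

definition time_average :: "real \<Rightarrow> ('e \<Rightarrow> real) \<Rightarrow> 'e \<Rightarrow> real" where
  "time_average d f x = (LINT s:{0<..d}|lborel. semigroup P X s f x) / d"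

lemma semigroup_set_integrable:
  fixes f :: "'e \<Rightarrow> real"
  assumes "f \<in> bcontfun" "A \<in> sets borel" "A \<subseteq> {0..}" "emeasure lborel A < \<infinity>"
  shows "set_integrable lborel A (\<lambda>s. semigroup P X s f x)"
proof -
  obtain B where B: "\<And>x. \<bar>f x\<bar> \<le> B" using bcontfun_bound[OF assms(1)] by metis
  have bound: "\<bar>semigroup P X s f x\<bar> \<le> B" for s by (rule abs_semigroup_le[where f = f, OF B])
  have meas: "(\<lambda>s. indicator A s * semigroup P X s f x) \<in> borel_measurable lborel"
    using time_integral_swap(2)[where Y = "\<lambda>_. 1" and B = 1 and x = x, OF assms(1) _ _ assms(2-4)]
    by (simp add: semigroup_def)
  show ?thesis
    unfolding set_integrable_def
    by (rule integrableI_bounded_set[where A = A and B = B])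
       (use assms meas bound in \<open>auto simp: abs_mult indicator_def\<close>)
qed

lemma semigroup_Ioc_integrable:
  fixes f :: "'e \<Rightarrow> real"
  assumes "f \<in> bcontfun" "0 \<le> s" "s \<le> t"
  shows "set_integrable lborel {s<..t} (\<lambda>s. semigroup P X s f x)"
  by (rule semigroup_set_integrable[OF assms(1)]) (use assms in auto)

lemma semigroup_Ioc_measurable:
  fixes f :: "'e \<Rightarrow> real"
  assumes "f \<in> bcontfun" "0 \<le> s" "s \<le> t"
  shows "(\<lambda>u. indicator {s<..t} u * semigroup P X u f x) \<in> borel_measurable lborel"
  using borel_measurable_integrable[OF semigroup_Ioc_integrable[OF assms, unfolded set_integrable_def]] by simp

lemma semigroup_Riemann_sum:
  fixes f :: "'e \<Rightarrow> real"
  assumes f: "f \<in> bcontfun" and "t \<ge> 0" "d \<ge> 0"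
  shows "(\<lambda>m. \<Sum>i<Suc m. d / real (Suc m) * semigroup P X (t + real (Suc i) * (d / real (Suc m))) f x)
           \<longlonglongrightarrow> (LINT s:{t<..t + d}|lborel. semigroup P X s f x)"
proof -
  obtain B where B: "\<And>x. \<bar>f x\<bar> \<le> B" using bcontfun_bound[OF f] by metis
  show ?thesis
  proof (rule right_Riemann_sum_tendsto)
    show "\<bar>semigroup P X s f x\<bar> \<le> B" for s by (rule abs_semigroup_le[where f = f, OF B])
    fix s u assume "t < s" "u \<longlonglongrightarrow> s" "\<And>n. s \<le> u n"
    then show "(\<lambda>n. semigroup P X (u n) f x) \<longlonglongrightarrow> semigroup P X s f x"
      using \<open>t \<ge> 0\<close> by (intro semigroup_right_continuous f) auto
  qed (rule \<open>d \<ge> 0\<close>)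
qed

lemma abs_time_average_le:
  fixes f :: "'e \<Rightarrow> real"
  assumes "f \<in> bcontfun" "\<And>x. \<bar>f x\<bar> \<le> B" "d > 0"
  shows "\<bar>time_average d f x\<bar> \<le> B"
proof -
  have "\<bar>LINT s:{0<..d}|lborel. semigroup P X s f x\<bar> \<le> B * (d - 0)"
    by (rule abs_set_integral_Ioc_le[OF semigroup_Ioc_integrable])
       (use assms abs_semigroup_le[where f = f, OF assms(2)] in auto)
  then show ?thesis using assms(3) by (simp add: time_average_def field_simps)
qed

text \<open>Stated for arbitrary sequences of points so as to serve twice: convergent sequences give
  continuity of the average, sequences leaving every compact set give its decay at infinity.\<close>

lemma time_average_bound_sequence:
  fixes f :: "'e \<Rightarrow> real"
  assumes f: "f \<in> bcontfun" and "d > 0"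
    and lim: "\<And>s. s > 0 \<Longrightarrow> (\<lambda>n. semigroup P X s f (u n)) \<longlonglongrightarrow> \<phi> s"
    and \<phi>: "(\<lambda>s. indicator {0<..d} s * \<phi> s) \<in> borel_measurable lborel"
  shows "(\<lambda>n. time_average d f (u n)) \<longlonglongrightarrow> (LINT s:{0<..d}|lborel. \<phi> s) / d"
  unfolding time_average_def set_lebesgue_integral_def
proof (intro tendsto_divide tendsto_const)
  obtain B where B: "\<And>x. \<bar>f x\<bar> \<le> B" using bcontfun_bound[OF f] by metis
  show "(\<lambda>n. \<integral>s. indicator {0<..d} s *\<^sub>R semigroup P X s f (u n) \<partial>lborel)
      \<longlonglongrightarrow> (\<integral>s. indicator {0<..d} s *\<^sub>R \<phi> s \<partial>lborel)"
  proof (rule integral_dominated_convergence[where w = "\<lambda>s. indicator {0<..d} s * B"])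
    show "integrable lborel (\<lambda>s. indicator {0<..d} s * B)"
      using \<open>d > 0\<close> by (intro integrable_mult_left) (simp add: integrable_indicator_iff)
    show "(\<lambda>s. indicator {0<..d} s *\<^sub>R semigroup P X s f (u n)) \<in> borel_measurable lborel" for n
      using semigroup_Ioc_measurable[OF f, of 0 d "u n"] \<open>d > 0\<close> by simp
    show "AE s in lborel. (\<lambda>n. indicator {0<..d} s *\<^sub>R semigroup P X s f (u n)) \<longlonglongrightarrow> indicator {0<..d} s *\<^sub>R \<phi> s"
      using lim by (intro AE_I2) (auto simp: indicator_def)
    show "AE s in lborel. norm (indicator {0<..d} s *\<^sub>R semigroup P X s f (u n)) \<le> indicator {0<..d} s * B" for n
      using abs_semigroup_le[where f = f, OF B] by (auto simp: indicator_def)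
  qed (use \<phi> in auto)
qed (use \<open>d > 0\<close> in auto)

lemma time_average_C0:
  assumes f: "f \<in> C0" and "d > 0"
  shows "time_average d f \<in> C0"
proof -
  have fb: "f \<in> bcontfun" by (rule C0_bcontfun[OF f])
  obtain B where B: "\<And>x. \<bar>f x\<bar> \<le> B" using bcontfun_bound[OF fb] by metis
  obtain \<eta> :: "nat \<Rightarrow> 'e \<Rightarrow> real" where
    \<eta>_supp: "\<And>m. \<exists>K. compact K \<and> (\<forall>x. x \<notin> K \<longrightarrow> \<eta> m x = 0)" and
    \<eta>_one: "\<And>x. \<exists>U M. open U \<and> x \<in> U \<and> (\<forall>m\<ge>M. \<forall>y\<in>U. \<eta> m y = 1)"
    by (rule cutoffs) blast
  obtain K where K: "\<And>m. compact (K m)" "\<And>m x. x \<notin> K m \<Longrightarrow> \<eta> m x = 0"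
    using \<eta>_supp by metis
  \<comment> \<open>The sets \<open>K m\<close> swallow every compact set eventually, although they
    are not arranged to increase: a finite subcover provides an index beyond which
    \<open>\<eta> m\<close> equals 1 on all of \<open>L\<close>, and \<open>\<eta> m\<close>
    vanishes off \<open>K m\<close>.\<close>
  have absorb: "\<exists>M. \<forall>m\<ge>M. L \<subseteq> K m" if "compact L" for L
  proof -
    obtain U M where UM: "\<And>x. open (U x)" "\<And>x. x \<in> U x" "\<And>x m y. m \<ge> M x \<Longrightarrow> y \<in> U x \<Longrightarrow> \<eta> m y = 1"
      using \<eta>_one by metis
    obtain D where D: "finite D" "L \<subseteq> (\<Union>x\<in>D. U x)"
      using compactE_image[OF \<open>compact L\<close>, of UNIV U] UM by (metis UN_I UNIV_I subsetI)
    have "L \<subseteq> K m" if "m \<ge> Max (M ` D)" for m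
    proof
      fix y assume "y \<in> L"
      then obtain x where "x \<in> D" "y \<in> U x" using D by auto
      moreover have "m \<ge> M x" by (rule order_trans[OF Max_ge that]) (use D(1) \<open>x \<in> D\<close> in auto)
      ultimately have "\<eta> m y = 1" by (intro UM(3))
      then show "y \<in> K m" using K(2) by force
    qed
    then show ?thesis by auto
  qed
  show ?thesis
  proof (rule C0I)
    show "bounded (range (time_average d f))"
      by (rule bounded_rangeI) (rule abs_time_average_le[OF fb B \<open>d > 0\<close>])
    show "continuous_on UNIV (time_average d f)"
      unfolding continuous_on_sequentially
    proof (intro allI ballI impI, elim conjE)
      fix u :: "nat \<Rightarrow> 'e" and x assume u: "u \<longlonglongrightarrow> x"
      have "(\<lambda>n. time_average d f (u n)) \<longlonglongrightarrow> (LINT s:{0<..d}|lborel. semigroup P X s f x) / d"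
      proof (rule time_average_bound_sequence[OF fb \<open>d > 0\<close>])
        show "(\<lambda>n. semigroup P X s f (u n)) \<longlonglongrightarrow> semigroup P X s f x" if "s > 0" for s
          using continuous_on_tendsto_compose[OF semigroup_continuous[OF _ fb] u] that by auto
        show "(\<lambda>s. indicator {0<..d} s * semigroup P X s f x) \<in> borel_measurable lborel"
          using \<open>d > 0\<close> by (intro semigroup_Ioc_measurable fb) auto
      qed
      then show "(time_average d f \<circ> u) \<longlonglongrightarrow> time_average d f x"
        by (simp add: o_def time_average_def)
    qed
    fix \<epsilon> :: real assume "\<epsilon> > 0"
    show "\<exists>K. compact K \<and> (\<forall>x. x \<notin> K \<longrightarrow> \<bar>time_average d f x\<bar> < \<epsilon>)"
    \<comment> \<open>Without decay there would be points \<open>u m\<close> outside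
      \<open>K m\<close> with large averages. They leave every compact set, so P_s f tends to 0
      along them for each \<open>s\<close>, and so do the averages.\<close>
    proof (rule ccontr)
      assume "\<not> ?thesis"
      then have "\<exists>x. x \<notin> K m \<and> \<not> \<bar>time_average d f x\<bar> < \<epsilon>" for m
        using K(1) by blast
      then obtain u where u: "\<And>m. u m \<notin> K m" "\<And>m. \<bar>time_average d f (u m)\<bar> \<ge> \<epsilon>"
        by (metis not_less)
      have "(\<lambda>n. time_average d f (u n)) \<longlonglongrightarrow> (LINT s:{0<..d}|lborel. 0) / d"
      proof (rule time_average_bound_sequence[OF fb \<open>d > 0\<close>])
        fix s :: real assume "s > 0"
        then have C0: "semigroup P X s f \<in> C0" by (intro semigroup_C0 f) auto
        show "(\<lambda>n. semigroup P X s f (u n)) \<longlonglongrightarrow> 0"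
        proof (rule tendstoI)
          fix e :: real assume "e > 0"
          from C0_vanishes[OF C0 this] obtain L where L: "compact L" "\<And>x. x \<notin> L \<Longrightarrow> \<bar>semigroup P X s f x\<bar> < e"
            by auto
          obtain M where "\<And>m. m \<ge> M \<Longrightarrow> L \<subseteq> K m" using absorb[OF L(1)] by auto
          then show "\<forall>\<^sub>F n in sequentially. dist (semigroup P X s f (u n)) 0 < e"
            using L(2) u(1) unfolding eventually_sequentially by (intro exI[of _ M]) (auto simp: subset_iff)
        qed
      qed simp
      then have "(\<lambda>n. \<bar>time_average d f (u n)\<bar>) \<longlonglongrightarrow> 0"
        by (intro tendsto_rabs_zero) (simp add: set_lebesgue_integral_def)
      then have "\<epsilon> \<le> 0" by (rule LIMSEQ_le_const) (use u(2) in auto)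
      with \<open>\<epsilon> > 0\<close> show False by simp
    qed
  qed
qed

text \<open>On Riemann sums of the average, P_t acts termwise and shifts all times by
  \<open>t\<close> through the semigroup law. Both sides are limits of these sums.\<close>

lemma semigroup_time_average:
  fixes f :: "'e \<Rightarrow> real"
  assumes f: "f \<in> C0" and "d > 0" "t \<ge> 0"
  shows "semigroup P X t (time_average d f) x = (LINT s:{t<..t + d}|lborel. semigroup P X s f x) / d"
proof -
  have fb: "f \<in> bcontfun" by (rule C0_bcontfun[OF f])
  obtain B where B: "B \<ge> 0" "\<And>x. \<bar>f x\<bar> \<le> B" using bcontfun_bound[OF fb] by metis
  define R where "R m y = (\<Sum>i<Suc m. d / real (Suc m) * semigroup P X (real (Suc i) * (d / real (Suc m))) f y)" for m y
  have R_bcont: "semigroup P X (real (Suc i) * (d / real (Suc m))) f \<in> bcontfun" for i m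
    using \<open>d > 0\<close> by (intro semigroup_bcontfun fb) auto
  have R_meas: "(\<lambda>\<omega>. R m (X t \<omega>)) \<in> borel_measurable (P x)" for m
    unfolding R_def
    by (intro borel_measurable_sum borel_measurable_times[OF borel_measurable_const f_X_measurable] R_bcont \<open>t \<ge> 0\<close>)
  have R_bound: "\<bar>R m y\<bar> \<le> d * B" for m y
  proof -
    have "\<bar>R m y\<bar> \<le> (\<Sum>i<Suc m. d / real (Suc m) * B)"
      unfolding R_def
      by (rule order_trans[OF sum_abs], rule sum_mono)
         (use \<open>d > 0\<close> abs_semigroup_le[where f = f, OF B(2)] in \<open>auto simp: abs_mult intro!: mult_left_mono divide_right_mono\<close>)
    then show ?thesis by simp
  qed
  have "(\<lambda>m. \<integral>\<omega>. R m (X t \<omega>) \<partial>P x) \<longlonglongrightarrow> (\<integral>\<omega>. d * time_average d f (X t \<omega>) \<partial>P x)"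
  proof (rule dominated_convergence_P[OF R_meas _ R_bound])
    show "(\<lambda>m. R m (X t \<omega>)) \<longlonglongrightarrow> d * time_average d f (X t \<omega>)" for \<omega>
      using semigroup_Riemann_sum[OF fb, of 0 d "X t \<omega>"] \<open>d > 0\<close>
      by (simp add: R_def time_average_def del: sum.lessThan_Suc)
  qed
  moreover have "(\<integral>\<omega>. R m (X t \<omega>) \<partial>P x)
      = (\<Sum>i<Suc m. d / real (Suc m) * semigroup P X (t + real (Suc i) * (d / real (Suc m))) f x)" for m
  proof -
    have "(\<integral>\<omega>. R m (X t \<omega>) \<partial>P x)
        = (\<Sum>i<Suc m. (\<integral>\<omega>. d / real (Suc m) * semigroup P X (real (Suc i) * (d / real (Suc m))) f (X t \<omega>) \<partial>P x))"
      unfolding R_def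
      by (intro Bochner_Integration.integral_sum integrable_mult_right integrable_f_X R_bcont \<open>t \<ge> 0\<close>)
    also have "\<dots> = (\<Sum>i<Suc m. d / real (Suc m) * semigroup P X (t + real (Suc i) * (d / real (Suc m))) f x)"
    proof (rule sum.cong[OF refl])
      fix i
      have "0 \<le> real (Suc i) * (d / real (Suc m))" using \<open>d > 0\<close> by simp
      from semigroup_add[OF \<open>t \<ge> 0\<close> this fb, of x]
      show "(\<integral>\<omega>. d / real (Suc m) * semigroup P X (real (Suc i) * (d / real (Suc m))) f (X t \<omega>) \<partial>P x)
          = d / real (Suc m) * semigroup P X (t + real (Suc i) * (d / real (Suc m))) f x"
        by (subst integral_mult_right_zero) (simp only: semigroup_def[of P X t])
    qed
    finally show ?thesis .
  qed
  ultimately have "(\<lambda>m. \<Sum>i<Suc m. d / real (Suc m) * semigroup P X (t + real (Suc i) * (d / real (Suc m))) f x)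
      \<longlonglongrightarrow> (\<integral>\<omega>. d * time_average d f (X t \<omega>) \<partial>P x)" by (simp only:)
  from LIMSEQ_unique[OF this semigroup_Riemann_sum[OF fb \<open>t \<ge> 0\<close>, of d x]] \<open>d > 0\<close>
  show ?thesis by (simp add: semigroup_def[of P X t "time_average d f"] field_simps)
qed

lemma abs_semigroup_integral_le:
  fixes f :: "'e \<Rightarrow> real"
  assumes "f \<in> bcontfun" "\<And>x. \<bar>f x\<bar> \<le> B" "0 \<le> s" "s \<le> t"
  shows "\<bar>LINT u:{s<..t}|lborel. semigroup P X u f x\<bar> \<le> B * (t - s)"
  by (rule abs_set_integral_Ioc_le[OF semigroup_Ioc_integrable])
     (use assms abs_semigroup_le[where f = f, OF assms(2)] in auto)

text \<open>The integral from \<open>t\<close> to \<open>t + d\<close> minus the one from 0 to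
  \<open>d\<close> equals the integral from \<open>d\<close> to \<open>t + d\<close> minus the one
  from 0 to \<open>t\<close>, also when \<open>t\<close> exceeds \<open>d\<close>. Both of the
  latter intervals have length \<open>t\<close>.\<close>

lemma semigroup_time_average_Lipschitz:
  fixes f :: "'e \<Rightarrow> real"
  assumes f: "f \<in> C0" and B: "\<And>x. \<bar>f x\<bar> \<le> B" and "d > 0" "t \<ge> 0"
  shows "\<bar>semigroup P X t (time_average d f) x - time_average d f x\<bar> \<le> 2 * B / d * t"
proof -
  have fb: "f \<in> bcontfun" by (rule C0_bcontfun[OF f])
  define J where "J s t = (LINT u:{s<..t}|lborel. semigroup P X u f x)" for s t
  have split: "J 0 (t + d) = J 0 s + J s (t + d)" if "0 \<le> s" "s \<le> t + d" for s
  proof -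
    have "{0<..t + d} = {0<..s} \<union> {s<..t + d}" using that by auto
    then show ?thesis
      unfolding J_def using that
      by (simp only:) (intro set_integral_Un semigroup_set_integrable fb, auto)
  qed
  have "J t (t + d) - J 0 d = J d (t + d) - J 0 t"
    using split[of t] split[of d] assms by simp
  also have "\<bar>\<dots>\<bar> \<le> B * t + B * t"
    using abs_semigroup_integral_le[OF fb B, of d "t + d" x] abs_semigroup_integral_le[OF fb B, of 0 t x] assms
    by (intro order_trans[OF abs_triangle_ineq4 add_mono]) (auto simp: J_def)
  finally have "\<bar>J t (t + d) - J 0 d\<bar> / d \<le> (2 * B * t) / d"
    using \<open>d > 0\<close> by (intro divide_right_mono) auto
  moreover have "semigroup P X t (time_average d f) x - time_average d f x = (J t (t + d) - J 0 d) / d"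
    using semigroup_time_average[OF f \<open>d > 0\<close> \<open>t \<ge> 0\<close>, of x]
    by (simp add: time_average_def J_def diff_divide_distrib)
  ultimately show ?thesis using \<open>d > 0\<close> by simp
qed

lemma time_average_tendsto:
  fixes f :: "'e \<Rightarrow> real"
  assumes f: "f \<in> bcontfun"
  shows "(\<lambda>n. time_average (1 / real (Suc n)) f x) \<longlonglongrightarrow> f x"
proof (rule LIMSEQ_I)
  fix e :: real assume "e > 0"
  have "((\<lambda>s. semigroup P X s f x) \<longlongrightarrow> f x) (at_right 0)"
  proof (rule tendsto_at_right_sequentially[of 0 1])
    fix u :: "nat \<Rightarrow> real" assume "\<And>n. 0 < u n" "u \<longlonglongrightarrow> 0"
    then show "(\<lambda>n. semigroup P X (u n) f x) \<longlonglongrightarrow> f x"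
      using semigroup_right_continuous[OF f, of 0 u x] by (simp add: semigroup_0 f less_imp_le)
  qed auto
  from tendstoD[OF this half_gt_zero[OF \<open>e > 0\<close>]]
  obtain \<delta> where \<delta>: "\<delta> > 0" "\<And>s. 0 < s \<Longrightarrow> s < \<delta> \<Longrightarrow> \<bar>semigroup P X s f x - f x\<bar> < e / 2"
    by (auto simp: eventually_at_right_field dist_real_def)
  obtain N where N: "1 / real (Suc N) < \<delta>" using nat_approx_posE[OF \<delta>(1)] by auto
  have "\<bar>time_average (1 / real (Suc n)) f x - f x\<bar> < e" if "n \<ge> N" for n
  proof -
    define d where "d = 1 / real (Suc n)"
    have d: "d > 0" "d < \<delta>"
      using N that by (auto simp: d_def intro!: le_less_trans[OF _ N] divide_left_mono)
    have int: "set_integrable lborel {0<..d} (\<lambda>s. semigroup P X s f x)"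
      using d by (intro semigroup_Ioc_integrable f) auto
    have const: "set_integrable lborel {0<..d} (\<lambda>_. k :: real)" for k
      using d by (intro set_integrable_const_Ioc) auto
    have "(LINT s:{0<..d}|lborel. f x) = d * f x"
      using d by (simp add: set_lebesgue_integral_def)
    then have "d * (time_average d f x - f x) = (LINT s:{0<..d}|lborel. semigroup P X s f x - f x)"
      using d by (simp add: time_average_def right_diff_distrib set_integral_diff(2)[OF int const])
    also have "\<bar>\<dots>\<bar> \<le> e / 2 * (d - 0)"
      using \<delta>(2) d by (intro abs_set_integral_Ioc_le set_integral_diff(1) int const) (auto intro: less_imp_le)
    finally have "d * \<bar>time_average d f x - f x\<bar> \<le> d * (e / 2)" using d by (simp add: abs_mult mult.commute)
    then have "\<bar>time_average d f x - f x\<bar> \<le> e / 2" using d(1) by (rule mult_left_le_imp_le)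
    then show ?thesis using \<open>e > 0\<close> by (simp add: d_def)
  qed
  then show "\<exists>no. \<forall>n\<ge>no. norm (time_average (1 / real (Suc n)) f x - f x) < e"
    by auto
qed

text \<open>
  Convex combinations of the time averages of \<open>f\<close>, along which the semigroup is Lipschitz in time,
  approximate \<open>f\<close> uniformly, because the time averages converge pointwise.
\<close>

lemma semigroup_strongly_continuous:
  assumes f: "f \<in> C0" and "\<epsilon> > 0"
  shows "\<exists>\<delta>>0. \<forall>t x. 0 \<le> t \<longrightarrow> t \<le> \<delta> \<longrightarrow> \<bar>semigroup P X t f x - f x\<bar> \<le> \<epsilon>"
proof -
  have fb: "f \<in> bcontfun" by (rule C0_bcontfun[OF f])
  obtain B where B: "B \<ge> 0" "\<And>x. \<bar>f x\<bar> \<le> B" using bcontfun_bound[OF fb] by metis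
  \<comment> \<open>The functions moved by the semigroup at a bounded speed. They form a convex set,
    so \<open>C0_Mazur\<close> delivers an approximant inside it.\<close>
  define L where "L = {u \<in> bcontfun. \<exists>C\<ge>0. \<forall>t\<ge>0. \<forall>x. \<bar>semigroup P X t u x - u x\<bar> \<le> C * t}"
  have "\<exists>u\<in>L. \<forall>x. \<bar>u x - f x\<bar> < \<epsilon> / 3"
  proof (rule C0_Mazur[where f = "\<lambda>n. time_average (1 / real (Suc n)) f"])
    show "time_average (1 / real (Suc n)) f \<in> C0" for n
      by (rule time_average_C0[OF f]) simp
    then show "time_average (1 / real (Suc n)) f \<in> L" for n
      unfolding L_def using semigroup_time_average_Lipschitz[OF f B(2), of "1 / real (Suc n)"] B(1)
      by (auto intro!: C0_bcontfun exI[of _ "2 * B / (1 / real (Suc n))"])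
    show "\<bar>time_average (1 / real (Suc n)) f x\<bar> \<le> B" for n x
      by (rule abs_time_average_le[OF fb B(2)]) simp
    show "(\<lambda>x. s * u x + t * v x) \<in> L"
      if uv: "u \<in> L" "v \<in> L" and st: "s \<ge> 0" "t \<ge> 0" "s + t = 1" for u v s t
    proof -
      obtain C D where C: "C \<ge> 0" "\<And>r x. r \<ge> 0 \<Longrightarrow> \<bar>semigroup P X r u x - u x\<bar> \<le> C * r"
        and D: "D \<ge> 0" "\<And>r x. r \<ge> 0 \<Longrightarrow> \<bar>semigroup P X r v x - v x\<bar> \<le> D * r"
        using uv by (auto simp: L_def)
      have bc: "u \<in> bcontfun" "v \<in> bcontfun" using uv by (auto simp: L_def)
      have "(\<lambda>x. s * u x + t * v x) \<in> bcontfun"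
        using plus_cont[OF scaleR_cont[OF bc(1), of s] scaleR_cont[OF bc(2), of t]] by simp
      moreover have "\<bar>semigroup P X r (\<lambda>x. s * u x + t * v x) x - (s * u x + t * v x)\<bar> \<le> (s * C + t * D) * r"
        if "r \<ge> 0" for r x
      proof -
        have "semigroup P X r (\<lambda>x. s * u x + t * v x) x - (s * u x + t * v x)
            = s * (semigroup P X r u x - u x) + t * (semigroup P X r v x - v x)"
          by (simp add: semigroup_linear[OF that bc] algebra_simps)
        also have "\<bar>\<dots>\<bar> \<le> s * \<bar>semigroup P X r u x - u x\<bar> + t * \<bar>semigroup P X r v x - v x\<bar>"
          using st abs_triangle_ineq[of "s * (semigroup P X r u x - u x)" "t * (semigroup P X r v x - v x)"] by (simp add: abs_mult)
        also have "\<dots> \<le> s * (C * r) + t * (D * r)"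
          by (intro add_mono mult_left_mono C D st that)
        finally show ?thesis by (simp add: algebra_simps)
      qed
      ultimately show ?thesis
        using C D st by (auto simp: L_def intro!: exI[of _ "s * C + t * D"])
    qed
    show "(\<lambda>n. time_average (1 / real (Suc n)) f x) \<longlonglongrightarrow> f x" for x
      by (rule time_average_tendsto[OF fb])
  qed (use f \<open>\<epsilon> > 0\<close> in auto)
  then obtain u C where u: "u \<in> bcontfun" "\<And>x. \<bar>u x - f x\<bar> < \<epsilon> / 3"
    and C: "C \<ge> 0" "\<And>t x. t \<ge> 0 \<Longrightarrow> \<bar>semigroup P X t u x - u x\<bar> \<le> C * t"
    by (auto simp: L_def)
  show ?thesis
  \<comment> \<open>The error splits into thirds: replacing \<open>f\<close> by \<open>u\<close>
    under the semigroup, moving \<open>u\<close>, and replacing \<open>u\<close> by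
    \<open>f\<close>. The summand 1 in \<open>C + 1\<close> guards against
    \<open>C = 0\<close>.\<close>
  proof (intro exI[of _ "\<epsilon> / 3 / (C + 1)"] conjI allI impI)
    show "0 < \<epsilon> / 3 / (C + 1)" using C(1) \<open>\<epsilon> > 0\<close> by simp
    fix t x assume t: "0 \<le> t" "t \<le> \<epsilon> / 3 / (C + 1)"
    have "t * (C + 1) \<le> \<epsilon> / 3"
      using t(2) pos_le_divide_eq[of "C + 1" t "\<epsilon> / 3"] C(1) by simp
    then have "C * t \<le> \<epsilon> / 3" using t(1) by (simp add: distrib_left mult.commute)
    moreover have "\<bar>semigroup P X t f x - semigroup P X t u x\<bar> \<le> \<epsilon> / 3"
      unfolding semigroup_diff[OF t(1) fb u(1), symmetric]
      using u(2) by (intro abs_semigroup_le) (simp add: abs_minus_commute less_imp_le)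
    moreover note C(2)[OF t(1), of x] u(2)[of x]
    ultimately show "\<bar>semigroup P X t f x - f x\<bar> \<le> \<epsilon>" by linarith
  qed
qed

end

context killed_feller_process
begin

text \<open>The semigroup fixes the constant 1, so strong continuity may be applied to
  \<open>h - 1\<close>; the weight adds at most \<open>(exp (b * t) - 1) * H\<close>. The estimate
  is the price of postponing a stop by \<open>t\<close>, uniformly in the starting point.\<close>

lemma Q_le_at_small_times:
  assumes h: "h \<in> bcontfun" and h_bounds: "\<And>x. 0 \<le> h x" "\<And>x. h x \<le> H"
    and C0: "(\<lambda>x. h x - 1) \<in> C0" and "\<epsilon> > 0"
  shows "\<exists>\<delta>>0. \<forall>t x. 0 \<le> t \<longrightarrow> t \<le> \<delta> \<longrightarrow> Q t h x \<le> h x + \<epsilon>"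
proof -
  obtain \<delta> where \<delta>: "\<delta> > 0" "\<And>t x. 0 \<le> t \<Longrightarrow> t \<le> \<delta> \<Longrightarrow> \<bar>semigroup P X t (\<lambda>x. h x - 1) x - (h x - 1)\<bar> \<le> \<epsilon> / 2"
    using semigroup_strongly_continuous[OF C0 half_gt_zero[OF \<open>\<epsilon> > 0\<close>]] by auto
  have "((\<lambda>t. (exp (b * t) - 1) * H) \<longlongrightarrow> (exp (b * 0) - 1) * H) (at_right 0)"
    by (intro tendsto_intros)
  then have "\<forall>\<^sub>F t in at_right 0. (exp (b * t) - 1) * H < \<epsilon> / 2"
    using \<open>\<epsilon> > 0\<close> by (intro order_tendstoD) auto
  then obtain \<delta>' where \<delta>': "\<delta>' > 0" "\<And>t. 0 < t \<Longrightarrow> t < \<delta>' \<Longrightarrow> (exp (b * t) - 1) * H < \<epsilon> / 2"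
    by (auto simp: eventually_at_right_field)
  have const: "(\<lambda>_. 1 :: real) \<in> bcontfun" by (rule const_bcontfun)
  have "Q t h x \<le> h x + \<epsilon>" if t: "0 \<le> t" "t \<le> min \<delta> (\<delta>' / 2)" for t x
  proof -
    have "(exp (b * t) - 1) * H \<le> \<epsilon> / 2"
    proof (cases "t = 0")
      case False
      with t \<delta>' show ?thesis by (intro less_imp_le \<delta>'(2)) auto
    qed (use \<open>\<epsilon> > 0\<close> in simp)
    have int: "integrable (P x) (\<lambda>\<omega>. exp (I t \<omega>) * h (X t \<omega>))" "integrable (P x) (\<lambda>\<omega>. h (X t \<omega>))"
      by (intro integrable_exp_I_f integrable_f_X h t)+
    have "Q t h x - semigroup P X t h x = (\<integral>\<omega>. exp (I t \<omega>) * h (X t \<omega>) - h (X t \<omega>) \<partial>P x)"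
      unfolding Q_def semigroup_def by (rule Bochner_Integration.integral_diff[symmetric]) (rule int)+
    also have "\<dots> \<le> (\<integral>\<omega>. (exp (b * t) - 1) * H \<partial>P x)"
    proof (rule integral_mono_AE)
      show "integrable (P x) (\<lambda>\<omega>. exp (I t \<omega>) * h (X t \<omega>) - h (X t \<omega>))" by (intro Bochner_Integration.integrable_diff int)
      show "integrable (P x) (\<lambda>\<omega>. (exp (b * t) - 1) * H)" by (rule integrable_P_bounded) auto
      show "AE \<omega> in P x. exp (I t \<omega>) * h (X t \<omega>) - h (X t \<omega>) \<le> (exp (b * t) - 1) * H"
      proof (rule AE_P_I)
        fix \<omega> assume \<omega>: "\<omega> \<in> \<Omega>"
        have "exp (I t \<omega>) * h (X t \<omega>) - h (X t \<omega>) = (exp (I t \<omega>) - 1) * h (X t \<omega>)"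
          by (simp add: algebra_simps)
        also have "\<dots> \<le> (exp (b * t) - 1) * H"
          using I_nonneg[OF \<omega> t(1)] I_le[OF \<omega> t(1)] h_bounds t(1) b_nonneg by (intro mult_mono) auto
        finally show "exp (I t \<omega>) * h (X t \<omega>) - h (X t \<omega>) \<le> (exp (b * t) - 1) * H" .
      qed
    qed
    also have "\<dots> \<le> \<epsilon> / 2" unfolding expectation_const by fact
    finally have "Q t h x \<le> semigroup P X t h x + \<epsilon> / 2" by simp
    moreover have "semigroup P X t (\<lambda>x. h x - 1) x = semigroup P X t h x - 1"
      unfolding semigroup_diff[OF t(1) h const] by (simp add: semigroup_def expectation_const del: Bochner_Integration.lebesgue_integral_const)
    moreover have "\<bar>semigroup P X t (\<lambda>x. h x - 1) x - (h x - 1)\<bar> \<le> \<epsilon> / 2" using t by (intro \<delta>(2)) auto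
    ultimately show ?thesis by linarith
  qed
  then show ?thesis using \<delta>(1) \<delta>'(1) by (intro exI[of _ "min \<delta> (\<delta>' / 2)"]) auto
qed

end

section \<open>The Bellman operator\<close>

locale stopping_problem = killed_feller_process \<Omega> P F X g b
  for \<Omega> :: "'w set"
    and P :: "'e::{metric_space, second_countable_topology} \<Rightarrow> 'w measure"
    and F :: "'e \<Rightarrow> ennreal \<Rightarrow> 'w measure"
    and X :: "real \<Rightarrow> 'w \<Rightarrow> 'e"
    and g :: "'e \<Rightarrow> real" and b :: real +
  fixes c :: real
  assumes c_pos: "0 < c" and g_ge: "\<And>x. c \<le> g x"
begin

text \<open>A predicate instead of the single function \<open>exp (G x)\<close>, because the
  truncations used for continuity of the value are rewards as well, with the same bound
  \<open>H\<close>.\<close>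

definition reward :: "('e \<Rightarrow> real) \<Rightarrow> real \<Rightarrow> bool" where
  "reward h H \<longleftrightarrow> h \<in> bcontfun \<and> (\<forall>x. 1 \<le> h x \<and> h x \<le> H)"

lemma rewardD:
  assumes "reward h H"
  shows "h \<in> bcontfun" "1 \<le> h x" "h x \<le> H" "0 \<le> h x" "\<bar>h x\<bar> \<le> H" "1 \<le> H"
proof -
  show *: "h \<in> bcontfun" "1 \<le> h x" "h x \<le> H" using assms by (auto simp: reward_def)
  then show "0 \<le> h x" "\<bar>h x\<bar> \<le> H" "1 \<le> H" by linarith+
qed

lemma const_bcontfun_real: "(\<lambda>_. k :: real) \<in> bcontfun"
  by (rule const_bcontfun)

lemma affine_bcontfun: "f \<in> bcontfun \<Longrightarrow> (\<lambda>x. a * f x + k) \<in> bcontfun" for f :: "'e \<Rightarrow> real"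
  using plus_cont[OF scaleR_cont[of f a] const_bcontfun_real[of k]] by simp

definition bellman :: "real \<Rightarrow> ('e \<Rightarrow> real) \<Rightarrow> ('e \<Rightarrow> real) \<Rightarrow> 'e \<Rightarrow> real" where
  "bellman d h f x = min (h x) (Q d f x)"

text \<open>The terminal value \<open>f\<close> is kept apart from the obstacle \<open>h\<close>:
  taking \<open>f = h\<close> produces the upper values and \<open>f = 1\<close> the lower ones,
  where the last grid time carries no stopping cost.\<close>

definition V :: "real \<Rightarrow> ('e \<Rightarrow> real) \<Rightarrow> ('e \<Rightarrow> real) \<Rightarrow> nat \<Rightarrow> 'e \<Rightarrow> real" where
  "V d h f n = (bellman d h ^^ n) f"

lemma V_0: "V d h f 0 = f"
  and V_Suc: "V d h f (Suc n) = bellman d h (V d h f n)"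
  and V_add: "V d h f (m + n) = V d h (V d h f n) m"
  by (simp_all add: V_def funpow_add)

lemma V_Suc_right: "V d h f (Suc n) = V d h (bellman d h f) n"
  by (simp add: V_def funpow_swap1)

lemma bellman_bcontfun:
  assumes "d \<ge> 0" "h \<in> bcontfun" "f \<in> bcontfun"
  shows "bellman d h f \<in> bcontfun"
proof (rule bcontfunI)
  obtain B where B: "\<And>x. \<bar>h x\<bar> \<le> B" using bcontfun_bound[OF assms(2)] by metis
  obtain B' where B': "\<And>x. \<bar>Q d f x\<bar> \<le> B'" using bcontfun_bound[OF Q_bcontfun[OF assms(1,3)]] by metis
  show "bounded (range (bellman d h f))"
  proof (rule bounded_rangeI)
    show "\<bar>bellman d h f x\<bar> \<le> max B B'" for x
      using B[of x] B'[of x] by (auto simp: bellman_def min_def)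
  qed
  show "continuous_on UNIV (bellman d h f)"
    unfolding bellman_def[abs_def] by (intro continuous_intros bcontfun_continuous Q_continuous assms)
qed

lemma V_bcontfun: "d \<ge> 0 \<Longrightarrow> h \<in> bcontfun \<Longrightarrow> f \<in> bcontfun \<Longrightarrow> V d h f n \<in> bcontfun"
  by (induction n) (auto simp: V_0 V_Suc bellman_bcontfun)

section \<open>Monotonicity in the terminal value, the horizon and the mesh\<close>

lemma bellman_mono:
  assumes "d \<ge> 0" "f \<in> bcontfun" "f' \<in> bcontfun" "\<And>y. f y \<le> f' y"
  shows "bellman d h f x \<le> bellman d h f' x"
  unfolding bellman_def by (intro min.mono order_refl Q_mono assms)

lemma V_mono:
  assumes "d \<ge> 0" "h \<in> bcontfun" "f \<in> bcontfun" "f' \<in> bcontfun" "\<And>y. f y \<le> f' y"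
  shows "V d h f n x \<le> V d h f' n x"
proof (induction n arbitrary: x)
  case (Suc n)
  then show ?case unfolding V_Suc by (intro bellman_mono V_bcontfun assms)
qed (simp add: V_0 assms)

lemma one_le_bellman:
  assumes "d \<ge> 0" "reward h H"
  shows "1 \<le> bellman d h (\<lambda>_. 1) x"
proof -
  have "1 \<le> exp (c * d)" using assms(1) c_pos by simp
  also have "\<dots> \<le> Q d (\<lambda>_. 1) x" by (rule Q_one_ge[OF assms(1) g_ge])
  finally show ?thesis using rewardD(2)[OF assms(2)] by (simp add: bellman_def)
qed

lemma V_one_incseq:
  assumes "d \<ge> 0" "reward h H" "m \<le> n"
  shows "V d h (\<lambda>_. 1) m x \<le> V d h (\<lambda>_. 1) n x"
  using assms(3)
proof (induction n rule: dec_induct)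
  case (step n)
  have "V d h (\<lambda>_. 1) n x \<le> V d h (\<lambda>_. 1) (Suc n) x"
    unfolding V_Suc_right using assms
    by (intro V_mono bellman_bcontfun const_bcontfun_real one_le_bellman) (auto intro: rewardD)
  with step.IH show ?case by simp
qed simp

lemma V_reward_decseq:
  assumes "d \<ge> 0" "reward h H" "m \<le> n"
  shows "V d h h n x \<le> V d h h m x"
  using assms(3)
proof (induction n rule: dec_induct)
  case (step n)
  have "V d h h (Suc n) x \<le> V d h h n x"
    unfolding V_Suc_right using assms rewardD[OF assms(2)]
    by (intro V_mono bellman_bcontfun) (auto simp: bellman_def)
  with step.IH show ?case by simp
qed simp

lemma V_bounds:
  assumes "d \<ge> 0" "reward h H"
  shows "1 \<le> V d h (\<lambda>_. 1) n x" "V d h (\<lambda>_. 1) n x \<le> V d h h n x" "V d h h n x \<le> h x"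
proof -
  show "1 \<le> V d h (\<lambda>_. 1) n x" using V_one_incseq[OF assms, of 0 n x] by (simp add: V_0)
  show "V d h (\<lambda>_. 1) n x \<le> V d h h n x"
    using assms rewardD[OF assms(2)] by (intro V_mono const_bcontfun_real) auto
  show "V d h h n x \<le> h x" using V_reward_decseq[OF assms, of 0 n x] by (simp add: V_0)
qed

text \<open>The finer grid also allows a stop at the midpoint, which can only lower the cost;
  continuing twice is \<open>Q d f\<close> by the semigroup law.\<close>

lemma bellman_half_step:
  assumes "d \<ge> 0" "h \<in> bcontfun" "f \<in> bcontfun"
  shows "bellman (d / 2) h (bellman (d / 2) h f) x \<le> bellman d h f x"
proof -
  have "Q (d / 2) (bellman (d / 2) h f) x \<le> Q (d / 2) (Q (d / 2) f) x"
    using assms by (intro Q_mono bellman_bcontfun Q_bcontfun) (auto simp: bellman_def)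
  also have "\<dots> = Q d f x" using Q_add[of "d / 2" "d / 2" f x] assms by simp
  finally show ?thesis by (auto simp: bellman_def min_def)
qed

lemma V_half_step:
  assumes "d \<ge> 0" "h \<in> bcontfun" "f \<in> bcontfun"
  shows "V (d / 2) h f (2 * n) x \<le> V d h f n x"
proof (induction n arbitrary: x)
  case (Suc n)
  have d2: "d / 2 \<ge> 0" using assms(1) by simp
  have "V (d / 2) h f (2 * Suc n) x = bellman (d / 2) h (bellman (d / 2) h (V (d / 2) h f (2 * n))) x"
    by (simp add: V_Suc)
  also have "\<dots> \<le> bellman d h (V (d / 2) h f (2 * n)) x"
    by (rule bellman_half_step[OF assms(1,2) V_bcontfun[OF d2 assms(2,3)]])
  also have "\<dots> \<le> bellman d h (V d h f n) x"
    by (rule bellman_mono[OF assms(1) V_bcontfun[OF d2 assms(2,3)] V_bcontfun[OF assms] Suc.IH])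
  finally show ?case by (simp add: V_Suc)
qed (simp add: V_0)

text \<open>
  The Bellman operator is concave, and it moves a constant \<open>a < 1\<close> up to \<open>a e\<^bsup>c d\<^esup>\<close> because the
  running cost is bounded below. Together these give a contraction towards the value function.
\<close>

lemma bellman_concave:
  assumes "d \<ge> 0" and h: "reward h H" and f: "f \<in> bcontfun"
    and \<theta>: "0 \<le> \<theta>" "\<theta> \<le> 1" and "0 \<le> a"
  shows "\<theta> * bellman d h f x + (1 - \<theta>) * min 1 (a * exp (c * d)) \<le> bellman d h (\<lambda>y. \<theta> * f y + (1 - \<theta>) * a) x"
proof -
  have "\<theta> * bellman d h f x + (1 - \<theta>) * min 1 (a * exp (c * d)) \<le> \<theta> * h x + (1 - \<theta>) * h x"
    using \<theta> rewardD(2)[OF h, of x]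
    by (intro add_mono mult_left_mono) (auto simp: bellman_def intro: order_trans[OF min.cobounded1])
  also have "\<dots> = h x" by (simp add: algebra_simps)
  finally have 1: "\<theta> * bellman d h f x + (1 - \<theta>) * min 1 (a * exp (c * d)) \<le> h x" .
  have "a * exp (c * d) \<le> a * Q d (\<lambda>_. 1) x"
    using Q_one_ge[OF assms(1) g_ge] \<open>0 \<le> a\<close> by (rule mult_left_mono)
  then have "\<theta> * bellman d h f x + (1 - \<theta>) * min 1 (a * exp (c * d)) \<le> \<theta> * Q d f x + (1 - \<theta>) * (a * Q d (\<lambda>_. 1) x)"
    using \<theta> by (intro add_mono mult_left_mono) (auto simp: bellman_def intro: min.coboundedI2)
  also have "\<dots> = Q d (\<lambda>y. \<theta> * f y + (1 - \<theta>) * a) x"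
    using Q_add_fun[OF \<open>d \<ge> 0\<close> _ const_bcontfun_real, of "\<lambda>y. \<theta> * f y" "(1 - \<theta>) * a" x]
      affine_bcontfun[OF f, of \<theta> 0] Q_cmult[of d \<theta> f x] Q_cmult[of d "(1 - \<theta>) * a" "\<lambda>_. 1" x]
    by (simp add: mult.assoc)
  finally have "\<theta> * bellman d h f x + (1 - \<theta>) * min 1 (a * exp (c * d)) \<le> Q d (\<lambda>y. \<theta> * f y + (1 - \<theta>) * a) x" .
  with 1 show ?thesis by (simp add: bellman_def)
qed

lemma V_concave:
  assumes "d \<ge> 0" and h: "reward h H" and f: "f \<in> bcontfun"
    and \<theta>: "0 \<le> \<theta>" "\<theta> \<le> 1" and "0 \<le> a" "a \<le> 1"
  shows "\<theta> * V d h f n x + (1 - \<theta>) * min 1 (a * exp (c * (real n * d))) \<le> V d h (\<lambda>y. \<theta> * f y + (1 - \<theta>) * a) n x"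
proof (induction n arbitrary: x)
  case 0
  then show ?case using \<open>a \<le> 1\<close> by (simp add: V_0)
next
  case (Suc n)
  let ?a = "min 1 (a * exp (c * (real n * d)))"
  have e: "1 \<le> exp (c * d)" using assms(1) c_pos by simp
  \<comment> \<open>Once the lifted constant has reached the cap 1 it stays there, because
    \<open>exp (c * d)\<close> is at least 1.\<close>
  have "min 1 (a * exp (c * (real (Suc n) * d))) \<le> min 1 (?a * exp (c * d))"
  proof (cases "a * exp (c * (real n * d)) \<le> 1")
    case True
    then have "?a * exp (c * d) = a * exp (c * (real (Suc n) * d))"
      by (simp add: min_def mult.assoc flip: exp_add) (simp add: algebra_simps)
    then show ?thesis by simp
  next
    case False
    then show ?thesis using e by (simp add: min_def)
  qed
  then have "\<theta> * V d h f (Suc n) x + (1 - \<theta>) * min 1 (a * exp (c * (real (Suc n) * d)))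
      \<le> \<theta> * bellman d h (V d h f n) x + (1 - \<theta>) * min 1 (?a * exp (c * d))"
    using \<theta> by (intro add_mono mult_left_mono) (auto simp: V_Suc)
  also have "\<dots> \<le> bellman d h (\<lambda>y. \<theta> * V d h f n y + (1 - \<theta>) * ?a) x"
    using assms by (intro bellman_concave[OF _ h] V_bcontfun) (auto intro: rewardD[OF h])
  also have "\<dots> \<le> bellman d h (V d h (\<lambda>y. \<theta> * f y + (1 - \<theta>) * a) n) x"
    by (intro bellman_mono assms affine_bcontfun V_bcontfun rewardD(1)[OF h] Suc.IH)
  finally show ?case by (simp add: V_Suc)
qed

text \<open>The solution \<open>r\<close> of \<open>(1 - r) * H + r * exp (- c) = 1\<close>: a
  function bounded by \<open>H\<close>, mixed with weight \<open>r\<close> on the constant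
  \<open>exp (- c)\<close>, stays below 1.\<close>

definition gap_ratio :: "real \<Rightarrow> real" where
  "gap_ratio H = (H - 1) / (H - exp (- c))"

lemma gap_ratio_bounds:
  assumes "1 \<le> H"
  shows "0 \<le> gap_ratio H" "gap_ratio H < 1" "1 - gap_ratio H * exp (- c) = (1 - gap_ratio H) * H"
proof -
  have "exp (- c) < 1" using c_pos by simp
  then have pos: "H - exp (- c) > 0" using assms by linarith
  show "0 \<le> gap_ratio H" unfolding gap_ratio_def using assms pos by simp
  show "gap_ratio H < 1" unfolding gap_ratio_def using \<open>exp (- c) < 1\<close> pos by (subst pos_divide_less_eq) auto
  have "gap_ratio H * (H - exp (- c)) = H - 1" unfolding gap_ratio_def using pos by simp
  then show "1 - gap_ratio H * exp (- c) = (1 - gap_ratio H) * H" by (simp add: algebra_simps)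
qed

text \<open>A block of \<open>N\<close> steps lasts one unit of time and lifts the constant
  \<open>exp (- c)\<close> to 1. Each block shrinks the gap by the same ratio, whatever the
  mesh.\<close>

lemma V_gap:
  assumes "d \<ge> 0" and h: "reward h H" and N: "real N * d = 1"
  shows "V d h h (j * N) x \<le> V d h (\<lambda>_. 1) (j * N) x + gap_ratio H ^ j * H"
proof -
  define r where "r = gap_ratio H"
  have r: "0 \<le> r" "r < 1" "1 - r * exp (- c) = (1 - r) * H"
    using gap_ratio_bounds[OF rewardD(6)[OF h]] by (auto simp: r_def)
  have hb: "h \<in> bcontfun" by (rule rewardD(1)[OF h])
  have rj: "0 \<le> r ^ j" "r ^ j \<le> 1" for j
    using r by (auto intro: power_le_one)
  \<comment> \<open>The gap in the form preserved by concavity: the lower iteration dominates the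
    upper one mixed with weight \<open>r ^ j\<close> on the constant 1.\<close>
  have "(1 - r ^ j) * V d h h (j * N) x + (1 - (1 - r ^ j)) \<le> V d h (\<lambda>_. 1) (j * N) x" for j x
  proof (induction j arbitrary: x)
    case 0
    then show ?case by (simp add: V_0)
  next
    case (Suc j)
    let ?B = "V d h h (j * N)" and ?A = "V d h (\<lambda>_. 1) (j * N)"
    let ?\<theta> = "1 - r ^ Suc j"
    have bc: "?B \<in> bcontfun" "?A \<in> bcontfun"
      using V_bcontfun[OF \<open>d \<ge> 0\<close> hb] hb const_bcontfun_real by blast+
    \<comment> \<open>The equation defining the ratio allows the weight of \<open>?B\<close> to rise
      from \<open>1 - r ^ j\<close> to \<open>1 - r ^ Suc j\<close> in exchange for lowering the
      constant from 1 to \<open>exp (- c)\<close>. The next block of steps brings the constant back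
      to 1.\<close>
    have below: "?\<theta> * ?B y + (1 - ?\<theta>) * exp (- c) \<le> ?A y" for y
    proof -
      have "?B y \<le> H" using V_bounds(3)[OF \<open>d \<ge> 0\<close> h] rewardD(3)[OF h] order_trans by blast
      then have "(1 - r) * ?B y \<le> 1 - r * exp (- c)"
        unfolding r(3) using r by (intro mult_left_mono) auto
      then have "r ^ j * ((1 - r) * ?B y) \<le> r ^ j * (1 - r * exp (- c))"
        by (rule mult_left_mono) (rule rj)
      then have "?\<theta> * ?B y + (1 - ?\<theta>) * exp (- c) \<le> (1 - r ^ j) * ?B y + (1 - (1 - r ^ j))"
        by (simp add: algebra_simps)
      also have "\<dots> \<le> ?A y" by (rule Suc.IH)
      finally show ?thesis .
    qed
    have "?\<theta> * V d h h (Suc j * N) x + (1 - ?\<theta>)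
        = ?\<theta> * V d h ?B N x + (1 - ?\<theta>) * min 1 (exp (- c) * exp (c * (real N * d)))"
      unfolding N by (simp add: V_add flip: exp_add)
    also have "\<dots> \<le> V d h (\<lambda>y. ?\<theta> * ?B y + (1 - ?\<theta>) * exp (- c)) N x"
      using rj[of "Suc j"] c_pos by (intro V_concave[OF \<open>d \<ge> 0\<close> h bc(1)]) auto
    also have "\<dots> \<le> V d h ?A N x"
      by (rule V_mono[OF \<open>d \<ge> 0\<close> hb affine_bcontfun[OF bc(1)] bc(2) below])
    finally show ?case by (simp add: V_add)
  qed
  from this[of j x] have "V d h h (j * N) x \<le> V d h (\<lambda>_. 1) (j * N) x + r ^ j * (V d h h (j * N) x - 1)"
    by (simp add: algebra_simps)
  also have "r ^ j * (V d h h (j * N) x - 1) \<le> r ^ j * H"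
  proof (rule mult_left_mono[OF _ rj(1)])
    show "V d h h (j * N) x - 1 \<le> H"
      using V_bounds(3)[OF \<open>d \<ge> 0\<close> h, of "j * N" x] rewardD(3)[OF h, of x] by simp
  qed
  finally show ?thesis by (simp add: r_def)
qed

text \<open>A stop on the fine grid is postponed to the next coarse time, at most \<open>d\<close>
  later, at the price \<open>\<omega>\<close>. As there is a single stop, the price is paid once and
  merely grows with the weight up to the horizon; the bound does not depend on
  \<open>m\<close>.\<close>

lemma V_refinement_bound:
  assumes "d \<ge> 0" and h: "reward h H" and "m \<ge> 1"
    and \<omega>: "\<omega> \<ge> 0" "\<And>t x. 0 \<le> t \<Longrightarrow> t \<le> d \<Longrightarrow> Q t h x \<le> h x + \<omega>"
  shows "V d h h n x \<le> V (d / real m) h h (m * n) x + exp (b * (real n * d)) * \<omega>"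
proof -
  define \<delta> where "\<delta> = d / real m"
  have \<delta>: "\<delta> \<ge> 0" "real m * \<delta> = d" using assms by (auto simp: \<delta>_def)
  have hb: "h \<in> bcontfun" by (rule rewardD(1)[OF h])
  \<comment> \<open>The price \<open>\<omega>\<close> carried through \<open>k\<close> fine steps,
    each of which multiplies constants by at most \<open>exp (b * \<delta>)\<close>.\<close>
  define E where "E k = exp (b * (real k * \<delta>)) * \<omega>" for k
  have E_ge: "\<omega> \<le> E k" for k
    unfolding E_def using \<omega>(1) b_nonneg \<delta>(1) mult_right_mono[of 1 "exp (b * (real k * \<delta>))" \<omega>] by simp
  have bc: "V d h h n \<in> bcontfun" "V \<delta> h h n \<in> bcontfun" for n
    using V_bcontfun hb \<delta>(1) assms(1) by blast+
  have Q0: "Q 0 f x = f x" if "f \<in> bcontfun" for f x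
    using expectation_X_0[OF that] by (simp add: Q_def I_0)
  \<comment> \<open>\<open>j\<close> counts the fine steps left until the next coarse time.
    Continuing is covered by the bound for one step less, stopping by the bound
    \<open>h x + \<omega>\<close> for the reward after the delay.\<close>
  have inner: "Q (real j * \<delta>) (V d h h n) x \<le> V \<delta> h h (m * n + j) x + E (m * n + j)"
    if "j \<le> m" and base: "\<And>x. V d h h n x \<le> V \<delta> h h (m * n) x + E (m * n)" for n j x
    using that(1)
  proof (induction j arbitrary: x)
    case 0
    then show ?case using base by (simp add: Q0 bc)
  next
    case (Suc j)
    have j: "0 \<le> real j * \<delta>" "0 \<le> real (Suc j) * \<delta>" using \<delta>(1) by auto
    have "real (Suc j) * \<delta> \<le> real m * \<delta>" using Suc.prems \<delta>(1) by (intro mult_right_mono) auto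
    then have jd: "real (Suc j) * \<delta> \<le> d" by (simp add: \<delta>(2))
    have "Q (real (Suc j) * \<delta>) (V d h h n) x = Q \<delta> (Q (real j * \<delta>) (V d h h n)) x"
      using Q_add[OF \<delta>(1) j(1) bc(1), of n x] by (simp add: algebra_simps)
    also have "\<dots> \<le> Q \<delta> (\<lambda>y. V \<delta> h h (m * n + j) y + E (m * n + j)) x"
      using Suc by (intro Q_mono \<delta> Q_bcontfun j bc plus_cont const_bcontfun_real) auto
    also have "\<dots> = Q \<delta> (V \<delta> h h (m * n + j)) x + E (m * n + j) * Q \<delta> (\<lambda>_. 1) x"
      using Q_add_fun[OF \<delta>(1) bc(2) const_bcontfun_real, of "m * n + j" "E (m * n + j)" x]
        Q_cmult[of \<delta> "E (m * n + j)" "\<lambda>_. 1" x] by simp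
    also have "\<dots> \<le> Q \<delta> (V \<delta> h h (m * n + j)) x + E (m * n + j) * exp (b * \<delta>)"
      using Q_one_le[OF \<delta>(1), of x] E_ge[of "m * n + j"] \<omega>(1) by (intro add_left_mono mult_left_mono) auto
    also have "E (m * n + j) * exp (b * \<delta>) = E (m * n + Suc j)"
      by (simp add: E_def algebra_simps exp_add)
    finally have 1: "Q (real (Suc j) * \<delta>) (V d h h n) x - E (m * n + Suc j) \<le> Q \<delta> (V \<delta> h h (m * n + j)) x" by simp
    have "Q (real (Suc j) * \<delta>) (V d h h n) x \<le> Q (real (Suc j) * \<delta>) h x"
      by (intro Q_mono j bc hb V_bounds(3)[OF assms(1) h])
    also have "\<dots> \<le> h x + \<omega>" by (rule \<omega>(2)[OF j(2) jd])
    finally have "Q (real (Suc j) * \<delta>) (V d h h n) x - E (m * n + Suc j) \<le> h x"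
      using E_ge[of "m * n + Suc j"] by linarith
    with 1 have "Q (real (Suc j) * \<delta>) (V d h h n) x - E (m * n + Suc j) \<le> V \<delta> h h (Suc (m * n + j)) x"
      by (simp add: V_Suc bellman_def)
    then show ?case by simp
  qed
  have "V d h h n x \<le> V \<delta> h h (m * n) x + E (m * n)" for n x
  proof (induction n arbitrary: x)
    case 0
    then show ?case using E_ge[of 0] \<omega>(1) by (simp add: V_0)
  next
    case (Suc n)
    have "V d h h (Suc n) x \<le> Q (real m * \<delta>) (V d h h n) x"
      by (simp add: V_Suc bellman_def \<delta>(2))
    also have "\<dots> \<le> V \<delta> h h (m * n + m) x + E (m * n + m)"
      by (rule inner[OF order_refl Suc.IH])
    finally show ?case by (simp add: add.commute)
  qed
  from this[of n x] have "V d h h n x \<le> V \<delta> h h (m * n) x + exp (b * (real (m * n) * \<delta>)) * \<omega>"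
    by (simp only: E_def)
  also have "real (m * n) * \<delta> = real n * d"
    by (simp flip: \<delta>(2))
  finally show ?thesis by (simp only: \<delta>_def)
qed

end

section \<open>Hitting times and stopping on a grid\<close>

context feller_process
begin

definition hitting :: "'e set \<Rightarrow> 'w \<Rightarrow> ennreal" where
  "hitting U \<omega> = Inf {ennreal t | t. t \<ge> 0 \<and> X t \<omega> \<in> U}"

lemma hitting_le: "0 \<le> t \<Longrightarrow> X t \<omega> \<in> U \<Longrightarrow> hitting U \<omega> \<le> ennreal t"
  unfolding hitting_def by (rule Inf_lower) auto

lemma hitting_less_iff: "hitting U \<omega> < s \<longleftrightarrow> (\<exists>t\<ge>0. ennreal t < s \<and> X t \<omega> \<in> U)"
  unfolding hitting_def Inf_less_iff by auto

lemma hitting_antimono: "U \<subseteq> V \<Longrightarrow> hitting V \<omega> \<le> hitting U \<omega>"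
  unfolding hitting_def by (rule Inf_superset_mono) auto

text \<open>After a visit to an open set a right-continuous path stays there for a short while, so
  rational times detect the visit.\<close>

lemma hitting_less_measurable:
  assumes "open U"
  shows "{\<omega> \<in> \<Omega>. hitting U \<omega> < s} \<in> sets (F x s)"
proof -
  let ?R = "{q \<in> \<rat>. 0 \<le> q \<and> ennreal q < s}"
  have "{\<omega> \<in> \<Omega>. hitting U \<omega> < s} = (\<Union>q\<in>?R. {\<omega> \<in> \<Omega>. X q \<omega> \<in> U})"
  proof (intro equalityI subsetI)
    fix \<omega> assume "\<omega> \<in> {\<omega> \<in> \<Omega>. hitting U \<omega> < s}"
    then obtain t where t: "\<omega> \<in> \<Omega>" "t \<ge> 0" "ennreal t < s" "X t \<omega> \<in> U"
      by (auto simp: hitting_less_iff)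
    have "((\<lambda>s. X s \<omega>) \<longlongrightarrow> X t \<omega>) (at_right t)"
      using right_continuous_paths[OF t(1,2)] by (simp add: continuous_within)
    then have "\<forall>\<^sub>F r in at_right t. X r \<omega> \<in> U"
      using assms t(4) by (rule topological_tendstoD)
    moreover have "((\<lambda>r. ennreal r) \<longlongrightarrow> ennreal t) (at_right t)"
      by (intro tendsto_ennrealI tendsto_ident_at)
    then have "\<forall>\<^sub>F r in at_right t. ennreal r < s"
      using t(3) by (rule order_tendstoD(2))
    ultimately have "\<forall>\<^sub>F r in at_right t. X r \<omega> \<in> U \<and> ennreal r < s"
      by (rule eventually_conj)
    then obtain \<delta> where \<delta>: "\<delta> > t" "\<And>r. t < r \<Longrightarrow> r < \<delta> \<Longrightarrow> X r \<omega> \<in> U \<and> ennreal r < s"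
      by (auto simp: eventually_at_right_field)
    obtain q where "q \<in> \<rat>" "t < q" "q < \<delta>" using Rats_dense_in_real[OF \<delta>(1)] by auto
    then show "\<omega> \<in> (\<Union>q\<in>?R. {\<omega> \<in> \<Omega>. X q \<omega> \<in> U})"
      using \<delta>(2)[of q] t by auto
  qed (auto simp: hitting_less_iff)
  also have "\<dots> \<in> sets (F x s)"
  proof (rule sets.countable_UN'')
    show "countable ?R" by (rule countable_subset[OF _ countable_rat]) auto
    fix q assume "q \<in> ?R"
    then have "X q \<in> borel_measurable (F x s)" by (intro X_measurable_F) auto
    from measurable_sets[OF this, of U] assms
    show "{\<omega> \<in> \<Omega>. X q \<omega> \<in> U} \<in> sets (F x s)"
      by (simp add: space_F vimage_def Int_def conj_commute)
  qed
  finally show ?thesis .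
qed

text \<open>The weak inequality is a countable intersection of strict ones with bounds decreasing to
  \<open>t\<close>. This places the event in \<open>F x s\<close> for every later \<open>s\<close>,
  and right-continuity of the filtration brings it down to \<open>t\<close>.\<close>

lemma hitting_stopping_time:
  assumes "open U"
  shows "stopping_time (F x) (hitting U)"
proof (rule stopping_timeI)
  fix t
  have "{\<omega> \<in> \<Omega>. hitting U \<omega> \<le> t} \<in> sets (F x t)"
  proof (cases "t < \<infinity>")
    case True
    have "{\<omega> \<in> \<Omega>. hitting U \<omega> \<le> t} \<in> sets (F x s)" if "t < s" for s
    proof -
      \<comment> \<open>The cap \<open>s\<close> keeps all the approximating events inside
        \<open>F x s\<close>.\<close>
      let ?r = "\<lambda>n. min s (t + ennreal (1 / real (Suc n)))"
      obtain r where r: "r \<ge> 0" "t = ennreal r" using True by (cases t) auto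
      have gt: "t < ?r n" for n
        using that r by (simp add: ennreal_less_iff flip: ennreal_plus)
      have lim: "(\<lambda>n. t + ennreal (1 / real (Suc n))) \<longlonglongrightarrow> t + ennreal 0"
        by (intro tendsto_add tendsto_const tendsto_ennrealI LIMSEQ_Suc[OF lim_const_over_n])
      have "{\<omega> \<in> \<Omega>. hitting U \<omega> \<le> t} = (\<Inter>n. {\<omega> \<in> \<Omega>. hitting U \<omega> < ?r n})"
      proof (intro equalityI subsetI)
        fix \<omega> assume "\<omega> \<in> {\<omega> \<in> \<Omega>. hitting U \<omega> \<le> t}"
        then show "\<omega> \<in> (\<Inter>n. {\<omega> \<in> \<Omega>. hitting U \<omega> < ?r n})"
          using gt by (auto intro: le_less_trans)
      next
        fix \<omega> assume \<omega>: "\<omega> \<in> (\<Inter>n. {\<omega> \<in> \<Omega>. hitting U \<omega> < ?r n})"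
        then have "hitting U \<omega> \<le> t + ennreal (1 / real (Suc n))" for n by (auto intro: less_imp_le)
        then have "hitting U \<omega> \<le> t + ennreal 0" by (intro LIMSEQ_le_const[OF lim]) auto
        then show "\<omega> \<in> {\<omega> \<in> \<Omega>. hitting U \<omega> \<le> t}" using \<omega> by simp
      qed
      also have "\<dots> \<in> sets (F x s)"
        using hitting_less_measurable[OF assms, of "?r _" x] sets_F_mono[of "?r _" s x]
        by (intro sets.countable_INT') auto
      finally show ?thesis .
    qed
    then show ?thesis unfolding right_continuous_F[OF True] by auto
  next
    case False
    then have "t = \<top>" by (metis infinity_ennreal_def less_top)
    then have "{\<omega> \<in> \<Omega>. hitting U \<omega> \<le> t} = space (F x t)" by (simp add: space_F)
    then show ?thesis by simp
  qed
  then show "Measurable.pred (F x t) (\<lambda>\<omega>. hitting U \<omega> \<le> t)"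
    by (simp add: pred_def space_F)
qed

text \<open>At the hitting time the process lies in the closure of \<open>U\<close> but perhaps not
  in \<open>U\<close>. The approaching visits carry inequalities between continuous functions from
  \<open>U\<close> over to that time.\<close>

lemma hitting_approached:
  assumes "\<omega> \<in> \<Omega>" "hitting U \<omega> < \<infinity>"
  obtains u where "\<And>n. X (u n) \<omega> \<in> U" "(\<lambda>n. X (u n) \<omega>) \<longlonglongrightarrow> X (enn2real (hitting U \<omega>)) \<omega>"
proof -
  define s where "s = enn2real (hitting U \<omega>)"
  have s: "hitting U \<omega> = ennreal s" "s \<ge> 0" using assms(2) by (simp_all add: s_def)
  have "\<exists>t\<ge>0. ennreal t < ennreal (s + 1 / real (Suc n)) \<and> X t \<omega> \<in> U" for n
    using s by (subst hitting_less_iff[symmetric]) (simp add: ennreal_lessI)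
  then obtain u where u: "\<And>n. u n \<ge> 0" "\<And>n. ennreal (u n) < ennreal (s + 1 / real (Suc n))" "\<And>n. X (u n) \<omega> \<in> U"
    by metis
  have upper: "u n \<le> s + 1 / real (Suc n)" for n
    using u(2)[of n] unfolding ennreal_less_iff[OF u(1)] by (rule less_imp_le)
  have lower: "s \<le> u n" for n
    using hitting_le[OF u(1,3), of n] u(1)[of n] by (simp add: s(1))
  have "u \<longlonglongrightarrow> s"
  proof (rule tendsto_sandwich[OF _ _ tendsto_const])
    have "(\<lambda>n. s + 1 / real (Suc n)) \<longlonglongrightarrow> s + 0"
      by (intro tendsto_add tendsto_const LIMSEQ_Suc[OF lim_const_over_n])
    then show "(\<lambda>n. s + 1 / real (Suc n)) \<longlonglongrightarrow> s" by simp
  qed (use upper lower in auto)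
  then have "(\<lambda>n. X (u n) \<omega>) \<longlonglongrightarrow> X s \<omega>"
    by (rule X_right_continuous[OF assms(1) s(2) _ lower])
  with u(3) show thesis by (intro that[of u]) (simp_all add: s_def)
qed

lemma stopping_time_measurable:
  "stopping_time (F x) \<tau> \<Longrightarrow> \<tau> \<in> borel_measurable (P x)"
  by (rule measurable_stopping_time[of "F x"]) (use sets_F_P in \<open>auto simp: space_F space_P\<close>)

text \<open>The hitting times of \<open>{y. \<eta> m y < 1}\<close> increase with \<open>m\<close>.
  If their supremum were finite, quasi-left-continuity would let the positions at these times
  converge to a point near which \<open>\<eta> m\<close> is eventually 1, a contradiction. So the
  supremum is infinite almost surely, and the probability of hitting by time \<open>T\<close> tends
  to 0.\<close>

lemma compact_containment:
  fixes \<eta> :: "nat \<Rightarrow> 'e \<Rightarrow> real" and \<epsilon> :: real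
  assumes cont: "\<And>m. continuous_on UNIV (\<eta> m)" and mono: "\<And>m y. \<eta> m y \<le> \<eta> (Suc m) y"
    and one: "\<And>x. \<exists>U M. open U \<and> x \<in> U \<and> (\<forall>m\<ge>M. \<forall>y\<in>U. \<eta> m y = 1)"
    and "\<epsilon> > 0"
  shows "\<exists>m. (\<integral>\<omega>. indicator {\<omega> \<in> \<Omega>. hitting {y. \<eta> m y < 1} \<omega> \<le> ennreal T} \<omega> \<partial>P x) < \<epsilon>"
proof -
  define \<sigma> where "\<sigma> m = hitting {y. \<eta> m y < 1}" for m
  have st: "stopping_time (F x) (\<sigma> m)" for m
    unfolding \<sigma>_def by (intro hitting_stopping_time open_Collect_less cont continuous_on_const)
  have inc: "incseq (\<lambda>m. \<sigma> m \<omega>)" for \<omega>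
    unfolding \<sigma>_def by (intro incseq_SucI hitting_antimono) (use mono le_less_trans in blast)
  have SUP_inf: "AE \<omega> in P x. (SUP m. \<sigma> m \<omega>) = \<infinity>"
    using quasi_left_continuous[of x \<sigma>, OF st inc] AE_space
  proof eventually_elim
    fix \<omega>
    assume qlc: "(SUP n. \<sigma> n \<omega>) < \<infinity> \<longrightarrow> (\<lambda>n. X (enn2real (\<sigma> n \<omega>)) \<omega>) \<longlonglongrightarrow> X (enn2real (SUP n. \<sigma> n \<omega>)) \<omega>"
      and "\<omega> \<in> space (P x)"
    then have \<omega>: "\<omega> \<in> \<Omega>" by (simp add: space_P)
    show "(SUP m. \<sigma> m \<omega>) = \<infinity>"
    proof (rule ccontr)
      assume "(SUP m. \<sigma> m \<omega>) \<noteq> \<infinity>"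
      then have fin: "(SUP m. \<sigma> m \<omega>) < \<infinity>" by (metis infinity_ennreal_def less_top)
      obtain U M where UM: "open U" "X (enn2real (SUP n. \<sigma> n \<omega>)) \<omega> \<in> U" "\<And>m y. m \<ge> M \<Longrightarrow> y \<in> U \<Longrightarrow> \<eta> m y = 1"
        using one by metis
      have "\<forall>\<^sub>F n in sequentially. X (enn2real (\<sigma> n \<omega>)) \<omega> \<in> U"
        using qlc fin UM(1,2) by (intro topological_tendstoD) auto
      then obtain n where n: "n \<ge> M" "X (enn2real (\<sigma> n \<omega>)) \<omega> \<in> U"
        using eventually_happens'[OF sequentially_bot eventually_conj[OF _ eventually_ge_at_top[of M]]] by blast
      \<comment> \<open>The position at \<open>\<sigma> n\<close> need not satisfy the strict
        inequality itself, so the approaching visits are used: the open set \<open>U\<close>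
        contains one of them.\<close>
      have "\<sigma> n \<omega> < \<infinity>" using fin SUP_upper[of n UNIV "\<lambda>m. \<sigma> m \<omega>"] by (auto intro: le_less_trans)
      then obtain u where u: "\<And>k. X (u k) \<omega> \<in> {y. \<eta> n y < 1}" "(\<lambda>k. X (u k) \<omega>) \<longlonglongrightarrow> X (enn2real (\<sigma> n \<omega>)) \<omega>"
        using hitting_approached[OF \<omega>, of "{y. \<eta> n y < 1}"] unfolding \<sigma>_def by metis
      have "\<forall>\<^sub>F k in sequentially. X (u k) \<omega> \<in> U"
        using u(2) UM(1) n(2) by (rule topological_tendstoD)
      then obtain k where "X (u k) \<omega> \<in> U"
        using eventually_happens'[OF sequentially_bot] by blast
      then show False using UM(3)[OF n(1)] u(1)[of k] by auto
    qed
  qed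
  have meas: "{\<omega> \<in> \<Omega>. \<sigma> m \<omega> \<le> ennreal T} \<in> sets (P x)" for m
    using stopping_timeD[OF st[of m], of "ennreal T"] sets_F_P[of x "ennreal T"] by (auto simp: pred_def space_F)
  interpret prob_space "P x" by (rule prob_space_P)
  have "(\<lambda>m. \<integral>\<omega>. indicator {\<omega> \<in> \<Omega>. \<sigma> m \<omega> \<le> ennreal T} \<omega> \<partial>P x) \<longlonglongrightarrow> (\<integral>\<omega>. (0 :: real) \<partial>P x)"
  proof (rule integral_dominated_convergence[where w = "\<lambda>_. 1"])
    show "AE \<omega> in P x. (\<lambda>m. indicator {\<omega> \<in> \<Omega>. \<sigma> m \<omega> \<le> ennreal T} \<omega>) \<longlonglongrightarrow> (0 :: real)"
      using SUP_inf
    proof eventually_elim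
      fix \<omega> assume eq: "(SUP m. \<sigma> m \<omega>) = \<infinity>"
      have "ennreal T < (SUP m. \<sigma> m \<omega>)" unfolding eq by simp
      then obtain M where M: "ennreal T < \<sigma> M \<omega>" unfolding less_SUP_iff by auto
      have "indicator {\<omega> \<in> \<Omega>. \<sigma> m \<omega> \<le> ennreal T} \<omega> = (0 :: real)" if "m \<ge> M" for m
        using less_le_trans[OF M incseqD[OF inc that]] by (auto simp: indicator_def)
      then show "(\<lambda>m. indicator {\<omega> \<in> \<Omega>. \<sigma> m \<omega> \<le> ennreal T} \<omega>) \<longlonglongrightarrow> (0 :: real)"
        by (intro tendsto_eventually) (auto simp: eventually_sequentially)
    qed
    show "(\<lambda>\<omega>. indicator {\<omega> \<in> \<Omega>. \<sigma> m \<omega> \<le> ennreal T} \<omega> :: real) \<in> borel_measurable (P x)" for m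
      by (rule borel_measurable_indicator[OF meas])
  qed auto
  then have "\<forall>\<^sub>F m in sequentially. (\<integral>\<omega>. indicator {\<omega> \<in> \<Omega>. \<sigma> m \<omega> \<le> ennreal T} \<omega> \<partial>P x) < \<epsilon>"
    using \<open>\<epsilon> > 0\<close> by (intro order_tendstoD(2)[of _ 0]) simp_all
  then show ?thesis
    using eventually_happens'[OF sequentially_bot] by (simp add: \<sigma>_def)
qed

end

section \<open>Optional sampling and dynamic programming on a grid\<close>

context stopping_problem
begin

text \<open>A stopping time of the grid, recorded as a number of steps; stopped quantities then
  become finite sums over indices.\<close>

definition grid_time :: "'e \<Rightarrow> real \<Rightarrow> ('w \<Rightarrow> nat) \<Rightarrow> bool" where
  "grid_time x d \<kappa> \<longleftrightarrow> (\<forall>j. {\<omega> \<in> \<Omega>. \<kappa> \<omega> \<le> j} \<in> sets (F x (ennreal (real j * d))))"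

lemma grid_time_measurable:
  assumes "grid_time x d \<kappa>"
  shows "\<kappa> \<in> measurable (P x) (count_space UNIV)"
proof -
  have "\<kappa> \<in> borel_measurable (P x)"
  proof (rule borel_measurableI_le)
    show "{\<omega> \<in> space (P x). \<kappa> \<omega> \<le> j} \<in> sets (P x)" for j
      using assms sets_F_P unfolding grid_time_def space_P by blast
  qed
  then show ?thesis
    unfolding measurable_cong_sets[OF refl sets_borel_eq_count_space] .
qed

definition gain :: "real \<Rightarrow> ('e \<Rightarrow> real) \<Rightarrow> nat \<Rightarrow> 'w \<Rightarrow> real" where
  "gain d u j \<omega> = exp (I (real j * d) \<omega>) * u (X (real j * d) \<omega>)"

lemma gain_measurable: "d \<ge> 0 \<Longrightarrow> u \<in> bcontfun \<Longrightarrow> gain d u j \<in> borel_measurable (P x)"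
  unfolding gain_def by (intro exp_I_f_measurable) auto

lemma gain_integrable: "d \<ge> 0 \<Longrightarrow> u \<in> bcontfun \<Longrightarrow> integrable (P x) (gain d u j)"
  unfolding gain_def by (intro integrable_exp_I_f) auto

lemma gain_stopped_integrable:
  assumes "d \<ge> 0" "\<And>j. u j \<in> bcontfun" "\<kappa> \<in> measurable (P x) (count_space UNIV)"
    and "\<And>\<omega>. \<omega> \<in> \<Omega> \<Longrightarrow> \<kappa> \<omega> \<le> N"
  shows "integrable (P x) (\<lambda>\<omega>. gain d (u (\<kappa> \<omega>)) (\<kappa> \<omega>) \<omega>)"
proof -
  have "integrable (P x) (\<lambda>\<omega>. \<Sum>j\<le>N. \<bar>gain d (u j) j \<omega>\<bar>)"
    by (intro Bochner_Integration.integrable_sum integrable_abs gain_integrable assms)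
  then show ?thesis
  proof (rule Bochner_Integration.integrable_bound)
    show "(\<lambda>\<omega>. gain d (u (\<kappa> \<omega>)) (\<kappa> \<omega>) \<omega>) \<in> borel_measurable (P x)"
      by (rule measurable_compose_countable[OF gain_measurable assms(3)]) (rule assms)+
    show "AE \<omega> in P x. norm (gain d (u (\<kappa> \<omega>)) (\<kappa> \<omega>) \<omega>) \<le> norm (\<Sum>j\<le>N. \<bar>gain d (u j) j \<omega>\<bar>)"
    proof (rule AE_P_I)
      fix \<omega> assume "\<omega> \<in> \<Omega>"
      then have "\<bar>gain d (u (\<kappa> \<omega>)) (\<kappa> \<omega>) \<omega>\<bar> \<le> (\<Sum>j\<le>N. \<bar>gain d (u j) j \<omega>\<bar>)"
        by (intro member_le_sum[of "\<kappa> \<omega>" "{..N}" "\<lambda>j. \<bar>gain d (u j) j \<omega>\<bar>"]) (use assms(4) in auto)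
      then show "norm (gain d (u (\<kappa> \<omega>)) (\<kappa> \<omega>) \<omega>) \<le> norm (\<Sum>j\<le>N. \<bar>gain d (u j) j \<omega>\<bar>)" by simp
    qed
  qed
qed

text \<open>\<open>markov_Q\<close> over one mesh interval: the test variable is the indicator of an
  event known at step \<open>j\<close>, times the weight accumulated so far.\<close>

lemma gain_step:
  assumes "d \<ge> 0" "u \<in> bcontfun" "A \<in> sets (F x (ennreal (real j * d)))"
  shows "(\<integral>\<omega>. indicator A \<omega> * gain d u (Suc j) \<omega> \<partial>P x) = (\<integral>\<omega>. indicator A \<omega> * gain d (Q d u) j \<omega> \<partial>P x)"
proof -
  let ?t = "real j * d"
  have t: "?t \<ge> 0" "real (Suc j) * d = ?t + d" using assms by (auto simp: algebra_simps)
  let ?Z = "\<lambda>\<omega>. indicator A \<omega> * exp (I ?t \<omega>)"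
  have "(\<integral>\<omega>. indicator A \<omega> * gain d u (Suc j) \<omega> \<partial>P x)
      = (\<integral>\<omega>. ?Z \<omega> * (exp (I (?t + d) \<omega> - I ?t \<omega>) * u (X (?t + d) \<omega>)) \<partial>P x)"
    unfolding gain_def t(2) by (simp add: exp_diff)
  also have "\<dots> = (\<integral>\<omega>. ?Z \<omega> * Q d u (X ?t \<omega>) \<partial>P x)"
  proof (rule markov_Q[OF t(1) assms(1,2), where B = "exp (b * ?t)"])
    have [measurable]: "A \<in> sets (F x (ennreal ?t))" by (rule assms(3))
    show "?Z \<in> borel_measurable (F x (ennreal ?t))"
      using I_measurable_F[OF t(1) order_refl, of x] by measurable
    show "\<bar>?Z \<omega>\<bar> \<le> exp (b * ?t)" if "\<omega> \<in> \<Omega>" for \<omega>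
      using I_le[OF that t(1)] by (auto simp: indicator_def)
  qed
  finally show ?thesis by (simp add: gain_def mult.assoc)
qed

text \<open>Doob's decomposition: the difference telescopes over the steps between
  \<open>\<iota>\<close> and \<open>\<kappa>\<close>. Being between them at step \<open>j\<close> is
  an event known at that step, so \<open>gain_step\<close> replaces the next value by
  \<open>Q\<close> of it. The functions \<open>u j\<close> vary with \<open>j\<close> because values
  depend on the remaining horizon.\<close>

lemma gain_optional_sampling:
  assumes "d \<ge> 0" and u: "\<And>j. u j \<in> bcontfun"
    and \<kappa>: "grid_time x d \<iota>" "grid_time x d \<kappa>"
    and le: "\<And>\<omega>. \<omega> \<in> \<Omega> \<Longrightarrow> \<iota> \<omega> \<le> \<kappa> \<omega>" "\<And>\<omega>. \<omega> \<in> \<Omega> \<Longrightarrow> \<kappa> \<omega> \<le> N"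
  shows "(\<integral>\<omega>. gain d (u (\<kappa> \<omega>)) (\<kappa> \<omega>) \<omega> \<partial>P x) - (\<integral>\<omega>. gain d (u (\<iota> \<omega>)) (\<iota> \<omega>) \<omega> \<partial>P x)
    = (\<Sum>j<N. \<integral>\<omega>. indicator {\<omega> \<in> \<Omega>. \<iota> \<omega> \<le> j \<and> j < \<kappa> \<omega>} \<omega> * (gain d (Q d (u (Suc j))) j \<omega> - gain d (u j) j \<omega>) \<partial>P x)"
proof -
  define A where "A j = {\<omega> \<in> \<Omega>. \<iota> \<omega> \<le> j \<and> j < \<kappa> \<omega>}" for j
  have A_F: "A j \<in> sets (F x (ennreal (real j * d)))" for j
  proof -
    have "A j = {\<omega> \<in> \<Omega>. \<iota> \<omega> \<le> j} - {\<omega> \<in> \<Omega>. \<kappa> \<omega> \<le> j}" by (auto simp: A_def)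
    with \<kappa> show ?thesis by (auto simp: grid_time_def)
  qed
  have A_P: "A j \<in> sets (P x)" for j using A_F sets_F_P by blast
  have int_ind: "integrable (P x) (\<lambda>\<omega>. indicator (A j) \<omega> * gain d v i \<omega>)" if "v \<in> bcontfun" for v i j
    using integrable_mult_indicator[OF A_P gain_integrable[OF \<open>d \<ge> 0\<close> that]] by simp
  have int1: "integrable (P x) (\<lambda>\<omega>. gain d (u (\<iota> \<omega>)) (\<iota> \<omega>) \<omega>)"
    and int2: "integrable (P x) (\<lambda>\<omega>. gain d (u (\<kappa> \<omega>)) (\<kappa> \<omega>) \<omega>)"
    using le by (auto intro!: gain_stopped_integrable[where N = N] assms(1) u grid_time_measurable \<kappa> intro: order_trans)
  have "(\<integral>\<omega>. gain d (u (\<kappa> \<omega>)) (\<kappa> \<omega>) \<omega> \<partial>P x) - (\<integral>\<omega>. gain d (u (\<iota> \<omega>)) (\<iota> \<omega>) \<omega> \<partial>P x)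
      = (\<integral>\<omega>. gain d (u (\<kappa> \<omega>)) (\<kappa> \<omega>) \<omega> - gain d (u (\<iota> \<omega>)) (\<iota> \<omega>) \<omega> \<partial>P x)"
    using int1 int2 by simp
  also have "\<dots> = (\<integral>\<omega>. (\<Sum>j<N. indicator (A j) \<omega> * gain d (u (Suc j)) (Suc j) \<omega> - indicator (A j) \<omega> * gain d (u j) j \<omega>) \<partial>P x)"
  proof (rule Bochner_Integration.integral_cong[OF refl])
    fix \<omega> assume "\<omega> \<in> space (P x)"
    then have \<omega>: "\<omega> \<in> \<Omega>" by (simp add: space_P)
    have "(\<Sum>j<N. indicator (A j) \<omega> * gain d (u (Suc j)) (Suc j) \<omega> - indicator (A j) \<omega> * gain d (u j) j \<omega>)
        = (\<Sum>j=\<iota> \<omega>..<\<kappa> \<omega>. gain d (u (Suc j)) (Suc j) \<omega> - gain d (u j) j \<omega>)"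
      using \<omega> le(2)[OF \<omega>] by (intro sum.mono_neutral_cong_right) (auto simp: A_def indicator_def)
    also have "\<dots> = gain d (u (\<kappa> \<omega>)) (\<kappa> \<omega>) \<omega> - gain d (u (\<iota> \<omega>)) (\<iota> \<omega>) \<omega>"
      by (rule sum_Suc_diff'[OF le(1)[OF \<omega>]])
    finally show "gain d (u (\<kappa> \<omega>)) (\<kappa> \<omega>) \<omega> - gain d (u (\<iota> \<omega>)) (\<iota> \<omega>) \<omega>
        = (\<Sum>j<N. indicator (A j) \<omega> * gain d (u (Suc j)) (Suc j) \<omega> - indicator (A j) \<omega> * gain d (u j) j \<omega>)" ..
  qed
  also have "\<dots> = (\<Sum>j<N. \<integral>\<omega>. indicator (A j) \<omega> * gain d (u (Suc j)) (Suc j) \<omega> - indicator (A j) \<omega> * gain d (u j) j \<omega> \<partial>P x)"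
    by (intro Bochner_Integration.integral_sum Bochner_Integration.integrable_diff int_ind u)
  also have "\<dots> = (\<Sum>j<N. \<integral>\<omega>. indicator (A j) \<omega> * (gain d (Q d (u (Suc j))) j \<omega> - gain d (u j) j \<omega>) \<partial>P x)"
  proof (rule sum.cong[OF refl])
    fix j
    show "(\<integral>\<omega>. indicator (A j) \<omega> * gain d (u (Suc j)) (Suc j) \<omega> - indicator (A j) \<omega> * gain d (u j) j \<omega> \<partial>P x)
        = (\<integral>\<omega>. indicator (A j) \<omega> * (gain d (Q d (u (Suc j))) j \<omega> - gain d (u j) j \<omega>) \<partial>P x)"
      using int_ind[OF u] int_ind[OF Q_bcontfun[OF assms(1) u]] gain_step[OF assms(1) u A_F]
      by (simp add: right_diff_distrib)
  qed
  finally show ?thesis by (simp add: A_def)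
qed

lemma gain_submartingale:
  assumes "d \<ge> 0" and u: "\<And>j. u j \<in> bcontfun" and sub: "\<And>j y. j < N \<Longrightarrow> u j y \<le> Q d (u (Suc j)) y"
    and \<kappa>: "grid_time x d \<iota>" "grid_time x d \<kappa>"
    and le: "\<And>\<omega>. \<omega> \<in> \<Omega> \<Longrightarrow> \<iota> \<omega> \<le> \<kappa> \<omega>" "\<And>\<omega>. \<omega> \<in> \<Omega> \<Longrightarrow> \<kappa> \<omega> \<le> N"
  shows "(\<integral>\<omega>. gain d (u (\<iota> \<omega>)) (\<iota> \<omega>) \<omega> \<partial>P x) \<le> (\<integral>\<omega>. gain d (u (\<kappa> \<omega>)) (\<kappa> \<omega>) \<omega> \<partial>P x)"
proof -
  have "0 \<le> (\<Sum>j<N. \<integral>\<omega>. indicator {\<omega> \<in> \<Omega>. \<iota> \<omega> \<le> j \<and> j < \<kappa> \<omega>} \<omega> * (gain d (Q d (u (Suc j))) j \<omega> - gain d (u j) j \<omega>) \<partial>P x)"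
    by (intro sum_nonneg Bochner_Integration.integral_nonneg mult_nonneg_nonneg)
       (simp_all add: gain_def sub)
  then show ?thesis using gain_optional_sampling[where u = u, OF assms(1) u \<kappa> le] by simp
qed

lemma grid_time_const: "grid_time x d (\<lambda>_. i)"
proof -
  have "{\<omega> \<in> \<Omega>. i \<le> j} \<in> {{}, \<Omega>}" for j by auto
  then show ?thesis
    unfolding grid_time_def using sets.top[of "F x _"] by (auto simp: space_F)
qed

lemma gain_0: "u \<in> bcontfun \<Longrightarrow> (\<integral>\<omega>. gain d u 0 \<omega> \<partial>P x) = u x"
  by (simp add: gain_def I_0 expectation_X_0)

text \<open>The values \<open>u j\<close> with \<open>N - j\<close> steps to go satisfy the
  submartingale inequality by the definition of \<open>bellman\<close>. When stopped, they are at
  most \<open>h\<close> before step \<open>N\<close> and equal \<open>f\<close> at step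
  \<open>N\<close>.\<close>

lemma V_le_stopped_gain:
  assumes "d \<ge> 0" and h: "h \<in> bcontfun" and f: "f \<in> bcontfun"
    and \<kappa>: "grid_time x d \<kappa>" "\<And>\<omega>. \<omega> \<in> \<Omega> \<Longrightarrow> \<kappa> \<omega> \<le> N"
  shows "V d h f N x \<le> (\<integral>\<omega>. gain d (if \<kappa> \<omega> < N then h else f) (\<kappa> \<omega>) \<omega> \<partial>P x)"
proof -
  define u where "u j = V d h f (N - j)" for j
  have u: "u j \<in> bcontfun" for j
    unfolding u_def by (intro V_bcontfun assms)
  have Suc_diff: "u j = bellman d h (u (Suc j))" if "j < N" for j
    using that by (simp add: u_def V_Suc[symmetric] Suc_diff_Suc)
  have "V d h f N x = (\<integral>\<omega>. gain d (u 0) 0 \<omega> \<partial>P x)"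
    using gain_0[OF u[of 0], of x d] by (simp add: u_def)
  also have "\<dots> \<le> (\<integral>\<omega>. gain d (u (\<kappa> \<omega>)) (\<kappa> \<omega>) \<omega> \<partial>P x)"
    by (rule gain_submartingale[where u = u and \<iota> = "\<lambda>_. 0" and N = N])
       (use \<kappa> u assms(1) in \<open>auto simp: Suc_diff bellman_def grid_time_const\<close>)
  also have "\<dots> \<le> (\<integral>\<omega>. gain d (if \<kappa> \<omega> < N then h else f) (\<kappa> \<omega>) \<omega> \<partial>P x)"
  proof (rule integral_mono_AE)
    show "integrable (P x) (\<lambda>\<omega>. gain d (u (\<kappa> \<omega>)) (\<kappa> \<omega>) \<omega>)"
      by (rule gain_stopped_integrable[OF assms(1) u grid_time_measurable[OF \<kappa>(1)] \<kappa>(2)])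
    show "integrable (P x) (\<lambda>\<omega>. gain d (if \<kappa> \<omega> < N then h else f) (\<kappa> \<omega>) \<omega>)"
      by (rule gain_stopped_integrable[where u = "\<lambda>j. if j < N then h else f", OF assms(1) _ grid_time_measurable[OF \<kappa>(1)] \<kappa>(2)])
         (use h f in auto)
    show "AE \<omega> in P x. gain d (u (\<kappa> \<omega>)) (\<kappa> \<omega>) \<omega> \<le> gain d (if \<kappa> \<omega> < N then h else f) (\<kappa> \<omega>) \<omega>"
    proof (rule AE_P_I)
      fix \<omega> assume "\<omega> \<in> \<Omega>"
      then have "\<kappa> \<omega> \<le> N" by (rule \<kappa>(2))
      moreover have "u N = f" by (simp add: u_def V_0)
      ultimately show "gain d (u (\<kappa> \<omega>)) (\<kappa> \<omega>) \<omega> \<le> gain d (if \<kappa> \<omega> < N then h else f) (\<kappa> \<omega>) \<omega>"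
        by (auto simp: gain_def Suc_diff bellman_def)
    qed
  qed
  finally show ?thesis .
qed

text \<open>The optimal index is the first at which the remaining value equals the obstacle. Before
  it the minimum in \<open>bellman\<close> is realised by continuing, so all increments in the
  optional sampling identity vanish.\<close>

lemma V_attained:
  assumes "d \<ge> 0" and h: "h \<in> bcontfun"
  obtains \<kappa> where "grid_time x d \<kappa>" "\<And>\<omega>. \<kappa> \<omega> \<le> N" "(\<integral>\<omega>. gain d h (\<kappa> \<omega>) \<omega> \<partial>P x) = V d h h N x"
proof -
  define u where "u j = V d h h (N - j)" for j
  have u: "u j \<in> bcontfun" for j
    unfolding u_def by (intro V_bcontfun assms)
  have u_N: "u N = h" by (simp add: u_def V_0)
  have Suc_diff: "u j = bellman d h (u (Suc j))" if "j < N" for j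
    using that by (simp add: u_def V_Suc[symmetric] Suc_diff_Suc)
  define S where "S \<omega> j \<longleftrightarrow> u j (X (real j * d) \<omega>) = h (X (real j * d) \<omega>)" for \<omega> j
  \<comment> \<open>At step \<open>N\<close> the remaining value is the obstacle itself; this
    guarantees that the least contact index exists and is at most \<open>N\<close>.\<close>
  have S_N: "S \<omega> N" for \<omega> by (simp add: S_def u_N)
  define \<kappa> where "\<kappa> \<omega> = (LEAST j. S \<omega> j)" for \<omega>
  have \<kappa>_S: "S \<omega> (\<kappa> \<omega>)" and \<kappa>_N: "\<kappa> \<omega> \<le> N" and \<kappa>_not: "\<And>j. j < \<kappa> \<omega> \<Longrightarrow> \<not> S \<omega> j" for \<omega>
    unfolding \<kappa>_def using LeastI[of "S \<omega>" N] Least_le[of "S \<omega>" N] not_less_Least S_N by blast+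
  have \<kappa>_grid: "grid_time x d \<kappa>"
    unfolding grid_time_def
  proof
    fix j
    have "{\<omega> \<in> \<Omega>. \<kappa> \<omega> \<le> j} = (\<Union>i\<le>j. {\<omega> \<in> space (F x (ennreal (real j * d))). u i (X (real i * d) \<omega>) = h (X (real i * d) \<omega>)})"
    proof -
      have "\<kappa> \<omega> \<le> j \<longleftrightarrow> (\<exists>i\<le>j. S \<omega> i)" for \<omega>
        using \<kappa>_S[of \<omega>] \<kappa>_not[of _ \<omega>] by (meson le_trans not_less)
      then show ?thesis by (auto simp: S_def space_F)
    qed
    also have "\<dots> \<in> sets (F x (ennreal (real j * d)))"
    proof (intro sets.finite_UN finite_atMost)
      fix i assume "i \<in> {..j}"
      then have "(\<lambda>\<omega>. v (X (real i * d) \<omega>)) \<in> borel_measurable (F x (ennreal (real j * d)))" if "v \<in> bcontfun" for v :: "'e \<Rightarrow> real"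
        using \<open>d \<ge> 0\<close> by (intro f_X_measurable_F that ennreal_leI mult_right_mono) auto
      from this[OF u[of i]] this[OF h]
      show "{\<omega> \<in> space (F x (ennreal (real j * d))). u i (X (real i * d) \<omega>) = h (X (real i * d) \<omega>)} \<in> sets (F x (ennreal (real j * d)))"
        by measurable
    qed
    finally show "{\<omega> \<in> \<Omega>. \<kappa> \<omega> \<le> j} \<in> sets (F x (ennreal (real j * d)))" .
  qed
  have "(\<integral>\<omega>. gain d (u (\<kappa> \<omega>)) (\<kappa> \<omega>) \<omega> \<partial>P x) - (\<integral>\<omega>. gain d (u 0) 0 \<omega> \<partial>P x)
    = (\<Sum>j<N. \<integral>\<omega>. indicator {\<omega> \<in> \<Omega>. 0 \<le> j \<and> j < \<kappa> \<omega>} \<omega> * (gain d (Q d (u (Suc j))) j \<omega> - gain d (u j) j \<omega>) \<partial>P x)"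
    by (rule gain_optional_sampling[where \<iota> = "\<lambda>_. 0" and u = u and N = N])
       (use assms u \<kappa>_N \<kappa>_grid grid_time_const in auto)
  also have "\<dots> = 0"
  proof (intro sum.neutral ballI)
    fix j assume "j \<in> {..<N}"
    then have "j < N" by simp
    have "u j (X (real j * d) \<omega>) = Q d (u (Suc j)) (X (real j * d) \<omega>)" if "j < \<kappa> \<omega>" for \<omega>
      using \<kappa>_not[OF that] unfolding S_def Suc_diff[OF \<open>j < N\<close>] bellman_def by (auto simp: min_def split: if_splits)
    then have "(\<lambda>\<omega>. indicator {\<omega> \<in> \<Omega>. 0 \<le> j \<and> j < \<kappa> \<omega>} \<omega> * (gain d (Q d (u (Suc j))) j \<omega> - gain d (u j) j \<omega>)) = (\<lambda>_. 0 :: real)"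
      by (auto simp: indicator_def gain_def)
    then show "(\<integral>\<omega>. indicator {\<omega> \<in> \<Omega>. 0 \<le> j \<and> j < \<kappa> \<omega>} \<omega> * (gain d (Q d (u (Suc j))) j \<omega> - gain d (u j) j \<omega>) \<partial>P x) = 0"
      by (simp only:) simp
  qed
  finally have "(\<integral>\<omega>. gain d (u (\<kappa> \<omega>)) (\<kappa> \<omega>) \<omega> \<partial>P x) = V d h h N x"
    using gain_0[OF u[of 0], of x d] by (simp add: u_def)
  moreover have "gain d (u (\<kappa> \<omega>)) (\<kappa> \<omega>) \<omega> = gain d h (\<kappa> \<omega>) \<omega>" for \<omega>
    using \<kappa>_S[of \<omega>] by (simp add: gain_def S_def)
  ultimately show thesis using that[OF \<kappa>_grid \<kappa>_N] by simp
qed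

end

section \<open>The value function\<close>

context stopping_problem
begin

text \<open>Level and horizon are separate indices: \<open>N\<close> controls the geometric gap,
  \<open>k\<close> the error of discretisation. The number of steps is \<open>N * 2 ^ k\<close>, so
  the horizon is the time \<open>N\<close> at every level.\<close>

definition U :: "nat \<Rightarrow> nat \<Rightarrow> ('e \<Rightarrow> real) \<Rightarrow> 'e \<Rightarrow> real" where
  "U k N h = V (1 / 2 ^ k) h h (N * 2 ^ k)"

text \<open>Restricting the infimum to the diagonal loses nothing, since \<open>U\<close> is
  antitone in both indices.\<close>

definition w :: "('e \<Rightarrow> real) \<Rightarrow> 'e \<Rightarrow> real" where
  "w h x = (INF N. U N N h x)"

lemma dyadic_step: "0 \<le> (1 / 2 ^ k :: real)" "0 < (1 / 2 ^ k :: real)" "real (N * 2 ^ k) * (1 / 2 ^ k) = real N"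
  by simp_all

lemma U_bcontfun: "h \<in> bcontfun \<Longrightarrow> U k N h \<in> bcontfun"
  unfolding U_def by (rule V_bcontfun[OF dyadic_step(1)])

lemma U_antimono_step:
  assumes h: "h \<in> bcontfun" and "k \<le> k'"
  shows "U k' N h x \<le> U k N h x"
  using assms(2)
proof (induction k' rule: dec_induct)
  case (step k')
  have "U (Suc k') N h x = V (1 / 2 ^ k' / 2) h h (2 * (N * 2 ^ k')) x"
    by (simp add: U_def mult.commute mult.left_commute)
  also have "\<dots> \<le> U k' N h x"
    unfolding U_def by (rule V_half_step[OF dyadic_step(1) h h])
  finally show ?case using step.IH by simp
qed simp

lemma U_antimono_horizon: "reward h H \<Longrightarrow> N \<le> N' \<Longrightarrow> U k N' h x \<le> U k N h x"
  unfolding U_def by (rule V_reward_decseq[OF dyadic_step(1)]) auto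

lemma U_antimono:
  assumes "reward h H" "k \<le> k'" "N \<le> N'"
  shows "U k' N' h x \<le> U k N h x"
  using U_antimono_step[OF rewardD(1)[OF assms(1)] assms(2)] U_antimono_horizon[OF assms(1,3)]
  by (rule order_trans[rotated])

lemma U_bounds:
  assumes "reward h H"
  shows "1 \<le> U k N h x" "U k N h x \<le> h x" "\<bar>U k N h x\<bar> \<le> H"
proof -
  show *: "1 \<le> U k N h x" "U k N h x \<le> h x"
    unfolding U_def using V_bounds[OF dyadic_step(1) assms] order_trans by blast+
  show "\<bar>U k N h x\<bar> \<le> H" using * rewardD(3)[OF assms, of x] by linarith
qed

lemma U_gap:
  assumes h: "reward h H" and "N \<le> N'"
  shows "U k N h x - gap_ratio H ^ N * H \<le> V (1 / 2 ^ k) h (\<lambda>_. 1) (N' * 2 ^ k) x"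
proof -
  have "real (2 ^ k) * (1 / 2 ^ k) = 1" by simp
  from V_gap[OF dyadic_step(1) h this, of N x]
  have "U k N h x - gap_ratio H ^ N * H \<le> V (1 / 2 ^ k) h (\<lambda>_. 1) (N * 2 ^ k) x"
    by (simp add: U_def)
  also have "\<dots> \<le> V (1 / 2 ^ k) h (\<lambda>_. 1) (N' * 2 ^ k) x"
    using \<open>N \<le> N'\<close> by (intro V_one_incseq[OF dyadic_step(1) h]) simp
  finally show ?thesis .
qed

lemma U_tendsto_w:
  assumes h: "reward h H"
  shows "(\<lambda>N. U N N h x) \<longlonglongrightarrow> w h x"
  unfolding w_def
proof (rule LIMSEQ_decseq_INF)
  show "bdd_below (range (\<lambda>N. U N N h x))"
    by (rule bdd_belowI[of _ 1]) (use U_bounds[OF h] in auto)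
  show "decseq (\<lambda>N. U N N h x)"
    by (rule decseq_SucI) (rule U_antimono[OF h], simp_all)
qed

lemma w_le_U:
  assumes h: "reward h H"
  shows "w h x \<le> U k N h x"
proof (rule LIMSEQ_le_const2[OF U_tendsto_w[OF h]], intro exI allI impI)
  fix n assume "max k N \<le> n"
  then show "U n n h x \<le> U k N h x" by (intro U_antimono[OF h]) auto
qed

lemma w_geI:
  assumes h: "reward h H" and "\<And>n. n \<ge> n0 \<Longrightarrow> l \<le> U n n h x"
  shows "l \<le> w h x"
  by (rule LIMSEQ_le_const[OF U_tendsto_w[OF h]]) (use assms in auto)

lemma w_bounds:
  assumes h: "reward h H"
  shows "1 \<le> w h x" "w h x \<le> h x" "\<bar>w h x\<bar> \<le> H"
proof -
  show *: "1 \<le> w h x" by (rule w_geI[OF h]) (rule U_bounds[OF h])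
  show "w h x \<le> h x" using w_le_U[OF h, of x 0 0] U_bounds(2)[OF h, of 0 0 x] by simp
  with * show "\<bar>w h x\<bar> \<le> H" using rewardD(3)[OF h, of x] by linarith
qed

lemma V_one_ge_w:
  assumes h: "reward h H"
  shows "w h x - gap_ratio H ^ N * H \<le> V (1 / 2 ^ k) h (\<lambda>_. 1) (N * 2 ^ k) x"
  using U_gap[OF h order_refl, of k N x] w_le_U[OF h, of x k N] by simp

section \<open>Truncated rewards and continuity of the value function\<close>

lemma V_mono_reward:
  assumes "d \<ge> 0" "h \<in> bcontfun" "h' \<in> bcontfun" "\<And>y. h' y \<le> h y"
  shows "V d h' h' n x \<le> V d h h n x"
proof (induction n arbitrary: x)
  case (Suc n)
  then show ?case
    unfolding V_Suc bellman_def by (intro min.mono Q_mono V_bcontfun assms)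
qed (simp add: V_0 assms)

text \<open>The grid time optimal for \<open>h'\<close> is used for \<open>h\<close> as well. The
  two costs differ only if the process is then in \<open>D\<close>, hence has hit \<open>D\<close>
  by time \<open>N\<close>, and the cost for \<open>h\<close> is at most
  \<open>exp (b * real N) * H\<close>.\<close>

lemma U_truncation:
  assumes h: "reward h H" and h': "reward h' H" "\<And>y. h' y \<le> h y"
    and eq: "\<And>y. y \<notin> D \<Longrightarrow> h' y = h y" and "open D"
  shows "U k N h x \<le> U k N h' x + exp (b * real N) * H *
           (\<integral>\<omega>. indicator {\<omega> \<in> \<Omega>. hitting D \<omega> \<le> ennreal (real N)} \<omega> \<partial>P x)"
proof -
  define d where "d = (1 / 2 ^ k :: real)"
  have d: "d \<ge> 0" "real (N * 2 ^ k) * d = real N" by (simp_all add: d_def)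
  have hb: "h \<in> bcontfun" "h' \<in> bcontfun" using h h'(1) by (auto dest: rewardD)
  obtain \<kappa> where \<kappa>: "grid_time x d \<kappa>" "\<And>\<omega>. \<kappa> \<omega> \<le> N * 2 ^ k"
    and opt: "(\<integral>\<omega>. gain d h' (\<kappa> \<omega>) \<omega> \<partial>P x) = V d h' h' (N * 2 ^ k) x"
    by (rule V_attained[OF d(1) hb(2), of x "N * 2 ^ k"]) (rule that)
  let ?A = "{\<omega> \<in> \<Omega>. hitting D \<omega> \<le> ennreal (real N)}"
  let ?C = "exp (b * real N) * H"
  have A: "?A \<in> sets (P x)"
    using stopping_timeD[OF hitting_stopping_time[OF \<open>open D\<close>, of x], of "ennreal (real N)"] sets_F_P[of x "ennreal (real N)"]
    by (auto simp: pred_def space_F)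
  have int: "integrable (P x) (\<lambda>\<omega>. gain d v (\<kappa> \<omega>) \<omega>)" if "v \<in> bcontfun" for v
    by (rule gain_stopped_integrable[OF d(1) that grid_time_measurable[OF \<kappa>(1)] \<kappa>(2)])
  interpret prob_space "P x" by (rule prob_space_P)
  have intA: "integrable (P x) (\<lambda>\<omega>. ?C * indicator ?A \<omega>)"
    using A by (intro integrable_mult_right integrable_real_indicator) (auto simp: less_top[symmetric])
  have "U k N h x \<le> (\<integral>\<omega>. gain d h (\<kappa> \<omega>) \<omega> \<partial>P x)"
    using V_le_stopped_gain[OF d(1) hb(1) hb(1) \<kappa>] by (simp add: U_def d_def)
  also have "\<dots> \<le> (\<integral>\<omega>. gain d h' (\<kappa> \<omega>) \<omega> + ?C * indicator ?A \<omega> \<partial>P x)"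
  proof (rule integral_mono_AE[OF int[OF hb(1)] Bochner_Integration.integrable_add[OF int[OF hb(2)] intA]], rule AE_P_I)
    fix \<omega> assume \<omega>: "\<omega> \<in> \<Omega>"
    let ?t = "real (\<kappa> \<omega>) * d"
    have "real (\<kappa> \<omega>) \<le> real (N * 2 ^ k)" unfolding of_nat_le_iff by (rule \<kappa>(2))
    from mult_right_mono[OF this d(1)] have t: "?t \<ge> 0" "?t \<le> real N"
      using d(1) unfolding d(2) by simp_all
    show "gain d h (\<kappa> \<omega>) \<omega> \<le> gain d h' (\<kappa> \<omega>) \<omega> + ?C * indicator ?A \<omega>"
    proof (cases "X ?t \<omega> \<in> D")
      case True
      then have "hitting D \<omega> \<le> ennreal ?t" by (rule hitting_le[OF t(1)])
      also have "\<dots> \<le> ennreal (real N)" using t by (intro ennreal_leI)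
      finally have "indicator ?A \<omega> = (1 :: real)" using \<omega> by simp
      moreover have "gain d h (\<kappa> \<omega>) \<omega> \<le> ?C"
        unfolding gain_def using I_le[OF \<omega> t(1)] t(2) b_nonneg rewardD(3,4)[OF h]
        by (intro mult_mono) (auto intro: order_trans mult_left_mono)
      moreover have "0 \<le> gain d h' (\<kappa> \<omega>) \<omega>" using rewardD(4)[OF h'(1)] by (simp add: gain_def)
      ultimately show ?thesis by simp
    next
      case False
      then have "gain d h (\<kappa> \<omega>) \<omega> = gain d h' (\<kappa> \<omega>) \<omega>" by (simp add: gain_def eq)
      moreover have "0 \<le> ?C * indicator ?A \<omega>" using rewardD(6)[OF h] by simp
      ultimately show ?thesis by simp
    qed
  qed
  also have "\<dots> = U k N h' x + ?C * (\<integral>\<omega>. indicator ?A \<omega> \<partial>P x)"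
    using Bochner_Integration.integral_add[OF int[OF hb(2)] intA] opt by (simp add: U_def d_def)
  finally show ?thesis .
qed

lemma w_continuous:
  assumes h: "reward h H"
  shows "continuous_on UNIV (w h)"
proof (rule continuous_if_sandwiched)
  fix x :: 'e and \<epsilon> :: real assume "\<epsilon> > 0"
  have "\<forall>\<^sub>F N in sequentially. U N N h x < w h x + \<epsilon>"
    using U_tendsto_w[OF h, of x] \<open>\<epsilon> > 0\<close> by (intro order_tendstoD(2)) auto
  then obtain N where "U N N h x < w h x + \<epsilon>"
    using eventually_happens'[OF sequentially_bot] by blast
  then show "\<exists>u. continuous_on UNIV u \<and> (\<forall>y. w h y \<le> u y) \<and> u x < w h x + \<epsilon>"
    using w_le_U[OF h] by (intro exI[of _ "U N N h"]) (auto intro: bcontfun_continuous U_bcontfun rewardD(1)[OF h])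
next
  fix x :: 'e and \<epsilon> :: real assume "\<epsilon> > 0"
  have H: "H \<ge> 1" by (rule rewardD(6)[OF h])
  \<comment> \<open>The horizon is fixed before the cutoff and the mesh, because the truncation
    error and the tolerance required of \<open>Q\<close> both involve
    \<open>exp (b * real N)\<close>.\<close>
  obtain N where N: "gap_ratio H ^ N * H < \<epsilon> / 4"
  proof -
    have "(\<lambda>N. gap_ratio H ^ N * H) \<longlonglongrightarrow> 0 * H"
      using gap_ratio_bounds[OF H] by (intro tendsto_mult tendsto_const LIMSEQ_power_zero) auto
    then have "\<forall>\<^sub>F N in sequentially. gap_ratio H ^ N * H < \<epsilon> / 4"
      using \<open>\<epsilon> > 0\<close> by (intro order_tendstoD(2)) auto
    with that show thesis using eventually_happens'[OF sequentially_bot] by blast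
  qed
  obtain \<eta> :: "nat \<Rightarrow> 'e \<Rightarrow> real" where \<eta>: "\<And>m. \<eta> m \<in> C0" "\<And>m x. 0 \<le> \<eta> m x" "\<And>m x. \<eta> m x \<le> 1"
    and \<eta>_mono: "\<And>m x. \<eta> m x \<le> \<eta> (Suc m) x"
    and \<eta>_one: "\<And>x. \<exists>U M. open U \<and> x \<in> U \<and> (\<forall>m\<ge>M. \<forall>y\<in>U. \<eta> m y = 1)"
    by (rule cutoffs) blast
  let ?C = "exp (b * real N) * H"
  have "?C > 0" using H by simp
  then have "\<epsilon> / 4 / ?C > 0" using \<open>\<epsilon> > 0\<close> by simp
  from compact_containment[where \<eta> = \<eta> and T = "real N" and x = x, OF C0_continuous[OF \<eta>(1)] \<eta>_mono \<eta>_one this]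
  obtain m where "(\<integral>\<omega>. indicator {\<omega> \<in> \<Omega>. hitting {y. \<eta> m y < 1} \<omega> \<le> ennreal (real N)} \<omega> \<partial>P x) < \<epsilon> / 4 / ?C" ..
  then have m: "?C * (\<integral>\<omega>. indicator {\<omega> \<in> \<Omega>. hitting {y. \<eta> m y < 1} \<omega> \<le> ennreal (real N)} \<omega> \<partial>P x) < \<epsilon> / 4"
    using \<open>?C > 0\<close> by (simp add: less_divide_eq mult.commute)
  \<comment> \<open>Interpolates between the constant 1 and \<open>h\<close>, so that
    \<open>h' - 1\<close> is in \<open>C0\<close> while \<open>h'\<close> remains a reward below
    \<open>h\<close>.\<close>
  define h' where "h' y = 1 + (h y - 1) * \<eta> m y" for y
  have "(\<lambda>y. h y - 1) \<in> bcontfun" using affine_bcontfun[OF rewardD(1)[OF h], of 1 "-1"] by simp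
  then have C0: "(\<lambda>y. h' y - 1) \<in> C0"
    unfolding h'_def using C0_mult_bounded[OF \<eta>(1)] by (simp add: bcontfun_def)
  have h'_le: "h' y \<le> h y" for y
    using mult_left_mono[OF \<eta>(3)[of m y], of "h y - 1"] rewardD(2)[OF h, of y] by (simp add: h'_def)
  have "h' \<in> bcontfun" using affine_bcontfun[OF C0_bcontfun[OF C0], of 1 1] by simp
  moreover have "1 \<le> h' y" for y using \<eta>(2) rewardD(2)[OF h] by (simp add: h'_def)
  ultimately have h': "reward h' H"
    unfolding reward_def using h'_le rewardD(3)[OF h] order_trans by blast
  have trunc: "U k N h x \<le> U k N h' x + \<epsilon> / 4" for k
  proof -
    have "U k N h x \<le> U k N h' x + ?C * (\<integral>\<omega>. indicator {\<omega> \<in> \<Omega>. hitting {y. \<eta> m y < 1} \<omega> \<le> ennreal (real N)} \<omega> \<partial>P x)"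
    proof (rule U_truncation[OF h h' h'_le])
      show "h' y = h y" if "y \<notin> {y. \<eta> m y < 1}" for y
      proof -
        have "\<eta> m y = 1" using that \<eta>(3)[of m y] by simp
        then show ?thesis by (simp add: h'_def)
      qed
      show "open {y. \<eta> m y < 1}"
        by (intro open_Collect_less C0_continuous \<eta> continuous_on_const)
    qed
    with m show ?thesis by simp
  qed
  have "\<epsilon> / 4 / exp (b * real N) > 0" using \<open>\<epsilon> > 0\<close> by simp
  from Q_le_at_small_times[OF rewardD(1)[OF h'] rewardD(4)[OF h'] rewardD(3)[OF h'] C0 this]
  obtain \<delta> where \<delta>: "\<delta> > 0" "\<And>t x. 0 \<le> t \<Longrightarrow> t \<le> \<delta> \<Longrightarrow> Q t h' x \<le> h' x + \<epsilon> / 4 / exp (b * real N)" by blast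
  obtain k where k: "(1 / 2 :: real) ^ k < \<delta>"
    using real_arch_pow_inv[OF \<delta>(1), of "1/2"] by auto
  have refine: "U k N h' y \<le> U k' N h' y + \<epsilon> / 4" if "k' \<ge> k" for k' y
  proof -
    have "V (1 / 2 ^ k) h' h' (N * 2 ^ k) y \<le> V (1 / 2 ^ k / real (2 ^ (k' - k))) h' h' (2 ^ (k' - k) * (N * 2 ^ k)) y
        + exp (b * (real (N * 2 ^ k) * (1 / 2 ^ k))) * (\<epsilon> / 4 / exp (b * real N))"
    proof (rule V_refinement_bound[OF dyadic_step(1) h'])
      fix t x assume "0 \<le> t" "t \<le> (1 / 2 ^ k :: real)"
      then show "Q t h' x \<le> h' x + \<epsilon> / 4 / exp (b * real N)"
        using k by (intro \<delta>(2)) (auto simp: power_one_over)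
    qed (use \<open>\<epsilon> > 0\<close> in auto)
    moreover have "(2 :: nat) ^ (k' - k) * (N * 2 ^ k) = N * 2 ^ k'"
      using that by (simp add: mult.left_commute flip: power_add)
    moreover have "1 / 2 ^ k / real (2 ^ (k' - k)) = (1 / 2 ^ k' :: real)"
      using that by (simp flip: power_add)
    ultimately show ?thesis
      unfolding U_def dyadic_step(3) by simp
  qed
  \<comment> \<open>Since \<open>h'\<close> is below \<open>h\<close>, this function lies below
    \<open>w h\<close> everywhere; the truncation error is paid at the point \<open>x\<close> alone.
    Truncation, mesh and horizon use a quarter of \<epsilon> each, so the final inequality is
    strict.\<close>
  define l where "l y = U k N h' y - \<epsilon> / 4 - gap_ratio H ^ N * H" for y
  have "l y \<le> w h y" for y
  proof (rule w_geI[OF h])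
    fix n assume n: "n \<ge> max k N"
    have "l y \<le> U n N h' y - gap_ratio H ^ N * H" using refine[of n y] n by (simp add: l_def)
    also have "\<dots> \<le> V (1 / 2 ^ n) h' (\<lambda>_. 1) (n * 2 ^ n) y" using n by (intro U_gap[OF h']) auto
    also have "\<dots> \<le> U n n h' y" unfolding U_def by (rule V_bounds(2)[OF dyadic_step(1) h'])
    also have "\<dots> \<le> U n n h y"
      unfolding U_def by (rule V_mono_reward[OF dyadic_step(1) rewardD(1)[OF h] rewardD(1)[OF h'] h'_le])
    finally show "l y \<le> U n n h y" .
  qed
  moreover have "w h x < l x + \<epsilon>"
    using w_le_U[OF h, of x k N] trunc[of k] N \<open>\<epsilon> > 0\<close> unfolding l_def by linarith
  moreover have "continuous_on UNIV l"
    unfolding l_def[abs_def] by (intro continuous_intros bcontfun_continuous U_bcontfun rewardD(1)[OF h'])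
  ultimately show "\<exists>l. continuous_on UNIV l \<and> (\<forall>y. l y \<le> w h y) \<and> w h x < l x + \<epsilon>"
    by blast
qed

lemma w_bcontfun: "reward h H \<Longrightarrow> w h \<in> bcontfun"
  by (intro bcontfunI w_continuous bounded_rangeI[of _ H] w_bounds)

lemma V_le_Q:
  assumes "d \<ge> 0" "h \<in> bcontfun" "f \<in> bcontfun"
  shows "V d h f (m + n) x \<le> Q (real m * d) (V d h f n) x"
proof (induction m arbitrary: x)
  case 0
  then show ?case
    using expectation_X_0[OF V_bcontfun[OF assms]] by (simp add: Q_def I_0)
next
  case (Suc m)
  have "V d h f (Suc m + n) x \<le> Q d (V d h f (m + n)) x"
    by (simp add: V_Suc bellman_def)
  also have "\<dots> \<le> Q d (Q (real m * d) (V d h f n)) x"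
    using assms Suc.IH by (intro Q_mono V_bcontfun Q_bcontfun) auto
  also have "\<dots> = Q (d + real m * d) (V d h f n) x"
    using assms by (intro Q_add[symmetric] V_bcontfun) auto
  finally show ?case by (simp add: algebra_simps)
qed

text \<open>On a fine grid, giving up the right to stop during an initial period of length
  \<open>1 / 2 ^ k\<close> can only raise the cost; the limit along the diagonal uses dominated
  convergence.\<close>

lemma w_le_Q:
  assumes h: "reward h H"
  shows "w h x \<le> Q (1 / 2 ^ k) (w h) x"
proof (rule LIMSEQ_le_const)
  have hb: "h \<in> bcontfun" by (rule rewardD(1)[OF h])
  show "(\<lambda>N. Q (1 / 2 ^ k) (U N N h) x) \<longlonglongrightarrow> Q (1 / 2 ^ k) (w h) x"
    unfolding Q_def
  proof (rule dominated_convergence_P)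
    show "(\<lambda>\<omega>. exp (I (1 / 2 ^ k) \<omega>) * U N N h (X (1 / 2 ^ k) \<omega>)) \<in> borel_measurable (P x)" for N
      by (rule exp_I_f_measurable[OF dyadic_step(1) U_bcontfun[OF hb]])
    show "\<bar>exp (I (1 / 2 ^ k) \<omega>) * U N N h (X (1 / 2 ^ k) \<omega>)\<bar> \<le> exp (b * (1 / 2 ^ k)) * H" if "\<omega> \<in> \<Omega>" for N \<omega>
      by (rule exp_I_f_bound[OF dyadic_step(1) U_bounds(3)[OF h] that])
  qed (intro tendsto_intros U_tendsto_w[OF h])
  show "\<exists>n0. \<forall>N\<ge>n0. w h x \<le> Q (1 / 2 ^ k) (U N N h) x"
  proof (intro exI[of _ k] allI impI)
    fix N assume "k \<le> N"
    \<comment> \<open>The longer horizon leaves room for the initial period: at level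
      \<open>N\<close> it takes \<open>2 ^ (N - k)\<close> steps, at most the \<open>2 ^ N\<close>
      steps of one unit of time.\<close>
    have "w h x \<le> U N (Suc N) h x" by (rule w_le_U[OF h])
    also have "\<dots> \<le> V (1 / 2 ^ N) h h (2 ^ (N - k) + N * 2 ^ N) x"
      unfolding U_def by (rule V_reward_decseq[OF dyadic_step(1) h]) (simp add: power_increasing)
    also have "\<dots> \<le> Q (real (2 ^ (N - k)) * (1 / 2 ^ N)) (U N N h) x"
      unfolding U_def by (rule V_le_Q[OF dyadic_step(1) hb hb])
    also have "real (2 ^ (N - k)) * (1 / 2 ^ N) = (1 / 2 ^ k :: real)"
    proof -
      obtain j where "N = k + j" using \<open>k \<le> N\<close> le_Suc_ex by blast
      then show ?thesis by (simp add: power_add)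
    qed
    finally show "w h x \<le> Q (1 / 2 ^ k) (U N N h) x" .
  qed
qed

text \<open>Despite the name, the weight is at least 1 and increases along each path, because
  \<open>g\<close> is nonnegative.\<close>

definition discounted :: "('e \<Rightarrow> real) \<Rightarrow> real \<Rightarrow> 'w \<Rightarrow> real" where
  "discounted f t \<omega> = exp (I t \<omega>) * f (X t \<omega>)"

lemma discounted_measurable:
  assumes [measurable]: "\<tau> \<in> borel_measurable (P x)" and "\<And>\<omega>. \<omega> \<in> \<Omega> \<Longrightarrow> \<tau> \<omega> \<ge> 0" and "f \<in> bcontfun"
  shows "(\<lambda>\<omega>. discounted f (\<tau> \<omega>) \<omega>) \<in> borel_measurable (P x)"
proof -
  have [measurable]: "(\<lambda>\<omega>. I (\<tau> \<omega>) \<omega>) \<in> borel_measurable (P x)"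
    by (rule I_random_time_measurable[OF assms(1,2)])
  have [measurable]: "(\<lambda>\<omega>. f (X (\<tau> \<omega>) \<omega>)) \<in> borel_measurable (P x)"
    by (rule measurable_compose[OF X_random_time_measurable[OF assms(1,2)] bcontfun_measurable[OF assms(3)]])
  show ?thesis unfolding discounted_def by measurable
qed

lemma abs_discounted_le:
  assumes "\<omega> \<in> \<Omega>" "0 \<le> t" "t \<le> T" "\<And>y. \<bar>f y\<bar> \<le> B"
  shows "\<bar>discounted f t \<omega>\<bar> \<le> exp (b * T) * B"
proof -
  have "I t \<omega> \<le> b * T" using I_le[OF assms(1,2)] mult_left_mono[OF assms(3) b_nonneg] by linarith
  then show ?thesis unfolding discounted_def abs_mult using assms(4) by (intro mult_mono) auto
qed

lemma discounted_tendsto: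
  assumes "\<omega> \<in> \<Omega>" "t \<ge> 0" "u \<longlonglongrightarrow> t" "\<And>n. u n \<ge> t" "f \<in> bcontfun"
  shows "(\<lambda>n. discounted f (u n) \<omega>) \<longlonglongrightarrow> discounted f t \<omega>"
  unfolding discounted_def
proof (intro tendsto_intros)
  have nonneg: "u n \<ge> 0" for n using assms(2,4) order_trans by blast
  show "(\<lambda>n. I (u n) \<omega>) \<longlonglongrightarrow> I t \<omega>" by (rule I_tendsto[OF assms(1-3) nonneg])
  show "(\<lambda>n. f (X (u n) \<omega>)) \<longlonglongrightarrow> f (X t \<omega>)"
    by (rule continuous_on_tendsto_compose[OF bcontfun_continuous[OF assms(5)] X_right_continuous[OF assms(1-4)]]) auto
qed

lemma gain_discounted: "gain d f j \<omega> = discounted f (real j * d) \<omega>"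
  by (simp add: gain_def discounted_def)

section \<open>From grid times to general bounded stopping times\<close>

lemma dyadic_tendsto_0: "(\<lambda>k. 1 / 2 ^ k :: real) \<longlonglongrightarrow> 0"
proof -
  have "(\<lambda>k. (1 / 2 :: real) ^ k) \<longlonglongrightarrow> 0" by (rule LIMSEQ_power_zero) auto
  then show ?thesis by (simp add: power_one_over)
qed

lemma dyadic_ceil_tendsto: "t \<ge> 0 \<Longrightarrow> (\<lambda>k. grid_ceil (1 / 2 ^ k) t) \<longlonglongrightarrow> t"
  by (rule grid_ceil_tendsto[OF dyadic_step(2) dyadic_tendsto_0])

text \<open>\<open>enn2real\<close> sends \<infinity> to 0, which is why the comparison with grid
  points below requires a finite time.\<close>

definition ceil_index :: "nat \<Rightarrow> ('w \<Rightarrow> ennreal) \<Rightarrow> 'w \<Rightarrow> nat" where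
  "ceil_index k \<tau> \<omega> = nat \<lceil>enn2real (\<tau> \<omega>) / (1 / 2 ^ k)\<rceil>"

lemma ceil_index_grid: "real (ceil_index k \<tau> \<omega>) * (1 / 2 ^ k) = grid_ceil (1 / 2 ^ k) (enn2real (\<tau> \<omega>))"
  by (simp add: ceil_index_def grid_ceil_def)

lemma ceil_index_le_iff:
  assumes "\<tau> \<omega> < \<infinity>"
  shows "ceil_index k \<tau> \<omega> \<le> j \<longleftrightarrow> \<tau> \<omega> \<le> ennreal (real j * (1 / 2 ^ k))"
proof -
  have "ceil_index k \<tau> \<omega> \<le> j \<longleftrightarrow> enn2real (\<tau> \<omega>) / (1 / 2 ^ k) \<le> real j"
    unfolding ceil_index_def by (simp add: nat_le_iff ceiling_le_iff)
  also have "\<dots> \<longleftrightarrow> enn2real (\<tau> \<omega>) \<le> real j * (1 / 2 ^ k)"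
    by (rule pos_divide_le_eq) simp
  also have "\<dots> \<longleftrightarrow> ennreal (enn2real (\<tau> \<omega>)) \<le> ennreal (real j * (1 / 2 ^ k))"
    by (rule ennreal_le_iff[symmetric]) simp
  also have "ennreal (enn2real (\<tau> \<omega>)) = \<tau> \<omega>" using assms by simp
  finally show ?thesis .
qed

lemma ceil_index_grid_time:
  assumes st: "stopping_time (F x) \<tau>" and fin: "\<And>\<omega>. \<omega> \<in> \<Omega> \<Longrightarrow> \<tau> \<omega> < \<infinity>"
  shows "grid_time x (1 / 2 ^ k) (ceil_index k \<tau>)"
  unfolding grid_time_def
proof
  fix j
  have "{\<omega> \<in> \<Omega>. ceil_index k \<tau> \<omega> \<le> j} = {\<omega> \<in> space (F x (ennreal (real j * (1 / 2 ^ k)))). \<tau> \<omega> \<le> ennreal (real j * (1 / 2 ^ k))}"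
    using ceil_index_le_iff[where \<tau> = \<tau>, OF fin] by (auto simp: space_F)
  also have "\<dots> \<in> sets (F x (ennreal (real j * (1 / 2 ^ k))))"
    using stopping_timeD[OF st] by (simp only: pred_def)
  finally show "{\<omega> \<in> \<Omega>. ceil_index k \<tau> \<omega> \<le> j} \<in> sets (F x (ennreal (real j * (1 / 2 ^ k))))" .
qed

lemma ceil_index_le:
  assumes "\<tau> \<omega> \<le> ennreal (real N)"
  shows "ceil_index k \<tau> \<omega> \<le> N * 2 ^ k"
proof -
  have "\<tau> \<omega> < \<infinity>" by (rule le_less_trans[OF assms]) simp
  then show ?thesis using assms ceil_index_le_iff[of \<tau> \<omega> k "N * 2 ^ k"] unfolding dyadic_step(3) by simp
qed

lemma ceil_index_mono:
  assumes "\<sigma> \<omega> \<le> \<tau> \<omega>" "\<tau> \<omega> < \<infinity>"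
  shows "ceil_index k \<sigma> \<omega> \<le> ceil_index k \<tau> \<omega>"
  unfolding ceil_index_def using enn2real_mono[OF assms(1)] assms(2)
  by (intro nat_mono ceiling_mono divide_right_mono) auto

context
  fixes x :: 'e and \<tau> :: "'w \<Rightarrow> ennreal" and N :: nat
  assumes st: "stopping_time (F x) \<tau>" and bdd: "\<And>\<omega>. \<omega> \<in> \<Omega> \<Longrightarrow> \<tau> \<omega> \<le> ennreal (real N)"
begin

lemma bounded_time_finite: "\<omega> \<in> \<Omega> \<Longrightarrow> \<tau> \<omega> < \<infinity>"
  by (rule le_less_trans[OF bdd]) simp_all

lemma bounded_time_le: "\<omega> \<in> \<Omega> \<Longrightarrow> enn2real (\<tau> \<omega>) \<le> real N"
  using enn2real_mono[OF bdd, of \<omega>] by simp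

lemma bounded_time_measurable: "(\<lambda>\<omega>. enn2real (\<tau> \<omega>)) \<in> borel_measurable (P x)"
  using stopping_time_measurable[OF st] by measurable

lemma dyadic_ceil_le:
  assumes "\<omega> \<in> \<Omega>"
  shows "real (ceil_index k \<tau> \<omega>) * (1 / 2 ^ k) \<le> real N"
proof -
  have "real (ceil_index k \<tau> \<omega>) \<le> real (N * 2 ^ k)"
    unfolding of_nat_le_iff by (rule ceil_index_le[where \<tau> = \<tau> and N = N, OF bdd[OF assms]])
  from mult_right_mono[OF this dyadic_step(1)[of k]] show ?thesis unfolding dyadic_step(3) .
qed

lemma discounted_integrable:
  assumes f: "f \<in> bcontfun"
  shows "integrable (P x) (\<lambda>\<omega>. discounted f (enn2real (\<tau> \<omega>)) \<omega>)"
proof -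
  obtain B where "\<And>y. \<bar>f y\<bar> \<le> B" using bcontfun_bound[OF f] by metis
  then show ?thesis
    by (intro integrable_P_bounded[where B = "exp (b * real N) * B"] discounted_measurable
        bounded_time_measurable abs_discounted_le f bounded_time_le) auto
qed

text \<open>Rounding up makes the integrands converge along each right-continuous path, and the
  horizon \<open>N\<close> bounds the weights.\<close>

lemma gain_ceil_tendsto:
  assumes f: "f \<in> bcontfun"
  shows "(\<lambda>k. \<integral>\<omega>. gain (1 / 2 ^ k) f (ceil_index k \<tau> \<omega>) \<omega> \<partial>P x)
           \<longlonglongrightarrow> (\<integral>\<omega>. discounted f (enn2real (\<tau> \<omega>)) \<omega> \<partial>P x)"
proof -
  obtain B where B: "\<And>y. \<bar>f y\<bar> \<le> B" using bcontfun_bound[OF f] by metis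
  show ?thesis
  proof (rule dominated_convergence_P[where B = "exp (b * real N) * B"])
    fix k
    show "(\<lambda>\<omega>. gain (1 / 2 ^ k) f (ceil_index k \<tau> \<omega>) \<omega>) \<in> borel_measurable (P x)"
      by (rule measurable_compose_countable[OF gain_measurable[OF dyadic_step(1) f]
            grid_time_measurable[OF ceil_index_grid_time[OF st bounded_time_finite]]])
    show "\<bar>gain (1 / 2 ^ k) f (ceil_index k \<tau> \<omega>) \<omega>\<bar> \<le> exp (b * real N) * B" if "\<omega> \<in> \<Omega>" for \<omega>
      unfolding gain_discounted by (rule abs_discounted_le[OF that _ dyadic_ceil_le[OF that] B]) simp
  next
    fix \<omega> assume "\<omega> \<in> \<Omega>"
    then show "(\<lambda>k. gain (1 / 2 ^ k) f (ceil_index k \<tau> \<omega>) \<omega>) \<longlonglongrightarrow> discounted f (enn2real (\<tau> \<omega>)) \<omega>"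
      unfolding gain_discounted ceil_index_grid
      by (intro discounted_tendsto dyadic_ceil_tendsto grid_ceil_ge dyadic_step f) auto
  qed
qed

text \<open>The expectations for \<sigma> enter only through a limit \<open>l\<close>. This covers
  the start at time 0, where they all equal \<open>w h x\<close>, together with a general earlier
  stopping time.\<close>

lemma w_submartingale:
  assumes h: "reward h H" and \<sigma>: "stopping_time (F x) \<sigma>" "\<And>\<omega>. \<omega> \<in> \<Omega> \<Longrightarrow> \<sigma> \<omega> \<le> \<tau> \<omega>"
    and \<sigma>_lim: "(\<lambda>k. \<integral>\<omega>. gain (1 / 2 ^ k) (w h) (ceil_index k \<sigma> \<omega>) \<omega> \<partial>P x) \<longlonglongrightarrow> l"
  shows "l \<le> (\<integral>\<omega>. discounted (w h) (enn2real (\<tau> \<omega>)) \<omega> \<partial>P x)"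
proof (rule LIMSEQ_le[OF \<sigma>_lim gain_ceil_tendsto[OF w_bcontfun[OF h]]], intro exI allI impI)
  fix k
  have fin: "\<sigma> \<omega> < \<infinity>" if "\<omega> \<in> \<Omega>" for \<omega> using \<sigma>(2)[OF that] bounded_time_finite[OF that] by (rule le_less_trans)
  show "(\<integral>\<omega>. gain (1 / 2 ^ k) (w h) (ceil_index k \<sigma> \<omega>) \<omega> \<partial>P x)
      \<le> (\<integral>\<omega>. gain (1 / 2 ^ k) (w h) (ceil_index k \<tau> \<omega>) \<omega> \<partial>P x)"
  proof (rule gain_submartingale[where u = "\<lambda>_. w h" and N = "N * 2 ^ k"])
    show "grid_time x (1 / 2 ^ k) (ceil_index k \<sigma>)" "grid_time x (1 / 2 ^ k) (ceil_index k \<tau>)"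
      by (intro ceil_index_grid_time \<sigma> st fin bounded_time_finite; assumption)+
    fix \<omega> assume \<omega>: "\<omega> \<in> \<Omega>"
    show "ceil_index k \<sigma> \<omega> \<le> ceil_index k \<tau> \<omega>"
      by (rule ceil_index_mono[where \<sigma> = \<sigma> and \<tau> = \<tau>, OF \<sigma>(2)[OF \<omega>] bounded_time_finite[OF \<omega>]])
    show "ceil_index k \<tau> \<omega> \<le> N * 2 ^ k" by (rule ceil_index_le[where \<tau> = \<tau> and N = N, OF bdd[OF \<omega>]])
  qed (auto intro: w_bcontfun[OF h] w_le_Q[OF h])
qed

lemma w_le_discounted:
  assumes h: "reward h H"
  shows "w h x \<le> (\<integral>\<omega>. discounted (w h) (enn2real (\<tau> \<omega>)) \<omega> \<partial>P x)"
    and "w h x \<le> (\<integral>\<omega>. discounted h (enn2real (\<tau> \<omega>)) \<omega> \<partial>P x)"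
proof -
  have "(\<integral>\<omega>. gain (1 / 2 ^ k) (w h) (ceil_index k (\<lambda>_. 0) \<omega>) \<omega> \<partial>P x) = w h x" for k
    using gain_0[OF w_bcontfun[OF h], of x "1 / 2 ^ k"] by (simp add: ceil_index_def)
  then show *: "w h x \<le> (\<integral>\<omega>. discounted (w h) (enn2real (\<tau> \<omega>)) \<omega> \<partial>P x)"
    by (intro w_submartingale[OF h, of "\<lambda>_. 0"] stopping_time_const) auto
  also have "\<dots> \<le> (\<integral>\<omega>. discounted h (enn2real (\<tau> \<omega>)) \<omega> \<partial>P x)"
    by (intro integral_mono discounted_integrable w_bcontfun[OF h] rewardD(1)[OF h])
       (auto simp: discounted_def w_bounds[OF h])
  finally show "w h x \<le> (\<integral>\<omega>. discounted h (enn2real (\<tau> \<omega>)) \<omega> \<partial>P x)" .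
qed

text \<open>The payoff jumps at the horizon, yet rounding respects the jump: a time below
  \<open>N\<close> is eventually rounded to a time below \<open>N\<close>, while the time
  \<open>N\<close> is never rounded below itself. So the grid bound from \<open>V_one_ge_w\<close>
  passes to the limit.\<close>

lemma w_le_discounted_lower:
  assumes h: "reward h H"
  shows "w h x - gap_ratio H ^ N * H
    \<le> (\<integral>\<omega>. discounted (if enn2real (\<tau> \<omega>) < real N then h else (\<lambda>_. 1)) (enn2real (\<tau> \<omega>)) \<omega> \<partial>P x)"
proof (rule LIMSEQ_le_const)
  let ?v = "\<lambda>k \<omega>. if ceil_index k \<tau> \<omega> < N * 2 ^ k then h else (\<lambda>_. 1)"
  have hb: "h \<in> bcontfun" by (rule rewardD(1)[OF h])
  have v_bound: "\<bar>?v k \<omega> y\<bar> \<le> H" for k \<omega> y using rewardD(5,6)[OF h] by auto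
  show "\<exists>n0. \<forall>k\<ge>n0. w h x - gap_ratio H ^ N * H \<le> (\<integral>\<omega>. gain (1 / 2 ^ k) (?v k \<omega>) (ceil_index k \<tau> \<omega>) \<omega> \<partial>P x)"
  proof (intro exI allI impI)
    fix k
    note V_one_ge_w[OF h, of x N k]
    also have "V (1 / 2 ^ k) h (\<lambda>_. 1) (N * 2 ^ k) x \<le> (\<integral>\<omega>. gain (1 / 2 ^ k) (?v k \<omega>) (ceil_index k \<tau> \<omega>) \<omega> \<partial>P x)"
      using ceil_index_le[where \<tau> = \<tau> and N = N, OF bdd]
      by (intro V_le_stopped_gain dyadic_step hb const_bcontfun_real ceil_index_grid_time st bounded_time_finite)
    finally show "w h x - gap_ratio H ^ N * H \<le> (\<integral>\<omega>. gain (1 / 2 ^ k) (?v k \<omega>) (ceil_index k \<tau> \<omega>) \<omega> \<partial>P x)" .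
  qed
  show "(\<lambda>k. \<integral>\<omega>. gain (1 / 2 ^ k) (?v k \<omega>) (ceil_index k \<tau> \<omega>) \<omega> \<partial>P x)
      \<longlonglongrightarrow> (\<integral>\<omega>. discounted (if enn2real (\<tau> \<omega>) < real N then h else (\<lambda>_. 1)) (enn2real (\<tau> \<omega>)) \<omega> \<partial>P x)"
  proof (rule dominated_convergence_P[where B = "exp (b * real N) * H"])
    fix k
    show "(\<lambda>\<omega>. gain (1 / 2 ^ k) (?v k \<omega>) (ceil_index k \<tau> \<omega>) \<omega>) \<in> borel_measurable (P x)"
      by (rule measurable_compose_countable[OF _ grid_time_measurable[OF ceil_index_grid_time[OF st bounded_time_finite]]])
         (auto intro: gain_measurable hb const_bcontfun_real)
    show "\<bar>gain (1 / 2 ^ k) (?v k \<omega>) (ceil_index k \<tau> \<omega>) \<omega>\<bar> \<le> exp (b * real N) * H" if "\<omega> \<in> \<Omega>" for \<omega>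
      unfolding gain_discounted by (rule abs_discounted_le[OF that _ dyadic_ceil_le[OF that] v_bound]) simp
  next
    fix \<omega> assume \<omega>: "\<omega> \<in> \<Omega>"
    define t where "t = enn2real (\<tau> \<omega>)"
    have lim: "(\<lambda>k. gain (1 / 2 ^ k) f (ceil_index k \<tau> \<omega>) \<omega>) \<longlonglongrightarrow> discounted f t \<omega>" if "f \<in> bcontfun" for f
      unfolding gain_discounted ceil_index_grid t_def
      by (intro discounted_tendsto dyadic_ceil_tendsto grid_ceil_ge dyadic_step that \<omega>) auto
    have less_iff: "ceil_index k \<tau> \<omega> < N * 2 ^ k \<longleftrightarrow> grid_ceil (1 / 2 ^ k) t < real N" for k
    proof -
      have "ceil_index k \<tau> \<omega> < N * 2 ^ k \<longleftrightarrow> real (ceil_index k \<tau> \<omega>) * (1 / 2 ^ k) < real (N * 2 ^ k) * (1 / 2 ^ k)"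
        by (subst mult_less_cancel_right_pos) (simp_all only: dyadic_step(2) of_nat_less_iff)
      then show ?thesis unfolding ceil_index_grid dyadic_step(3) t_def .
    qed
    show "(\<lambda>k. gain (1 / 2 ^ k) (?v k \<omega>) (ceil_index k \<tau> \<omega>) \<omega>)
        \<longlonglongrightarrow> discounted (if enn2real (\<tau> \<omega>) < real N then h else (\<lambda>_. 1)) (enn2real (\<tau> \<omega>)) \<omega>"
    proof (cases "t < real N")
      case True
      have "\<forall>\<^sub>F k in sequentially. grid_ceil (1 / 2 ^ k) t < real N"
        using dyadic_ceil_tendsto[of t] True by (intro order_tendstoD(2)) (auto simp: t_def)
      then have "\<forall>\<^sub>F k in sequentially. gain (1 / 2 ^ k) (?v k \<omega>) (ceil_index k \<tau> \<omega>) \<omega> = gain (1 / 2 ^ k) h (ceil_index k \<tau> \<omega>) \<omega>"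
        by eventually_elim (simp add: less_iff)
      then show ?thesis
        using lim[OF hb] True unfolding t_def by (simp add: tendsto_cong)
    next
      case False
      have "\<not> grid_ceil (1 / 2 ^ k) t < real N" for k
        using False grid_ceil_ge[OF dyadic_step(2), of t k] by linarith
      then have "gain (1 / 2 ^ k) (?v k \<omega>) (ceil_index k \<tau> \<omega>) \<omega> = gain (1 / 2 ^ k) (\<lambda>_. 1) (ceil_index k \<tau> \<omega>) \<omega>" for k
        by (simp add: less_iff)
      then show ?thesis using lim[OF const_bcontfun_real, of 1] False by (simp add: t_def)
    qed
  qed
qed

end

lemma w_optional_sampling:
  assumes h: "reward h H" and \<tau>: "stopping_time (F x) \<tau>" "\<And>\<omega>. \<omega> \<in> \<Omega> \<Longrightarrow> \<tau> \<omega> \<le> ennreal (real N)"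
    and \<sigma>: "stopping_time (F x) \<sigma>" "\<And>\<omega>. \<omega> \<in> \<Omega> \<Longrightarrow> \<sigma> \<omega> \<le> \<tau> \<omega>"
  shows "(\<integral>\<omega>. discounted (w h) (enn2real (\<sigma> \<omega>)) \<omega> \<partial>P x) \<le> (\<integral>\<omega>. discounted (w h) (enn2real (\<tau> \<omega>)) \<omega> \<partial>P x)"
proof (rule w_submartingale[OF \<tau> h \<sigma>])
  show "(\<lambda>k. \<integral>\<omega>. gain (1 / 2 ^ k) (w h) (ceil_index k \<sigma> \<omega>) \<omega> \<partial>P x)
      \<longlonglongrightarrow> (\<integral>\<omega>. discounted (w h) (enn2real (\<sigma> \<omega>)) \<omega> \<partial>P x)"
    using \<sigma>(2) \<tau>(2) order_trans by (intro gain_ceil_tendsto[OF \<sigma>(1) _ w_bcontfun[OF h]]) blast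
qed

end

section \<open>The contact time\<close>

lemma ennreal_integral_le_nn_integral:
  fixes f :: "'a \<Rightarrow> real"
  assumes "\<And>x. x \<in> space M \<Longrightarrow> 0 \<le> f x"
  shows "ennreal (\<integral>x. f x \<partial>M) \<le> (\<integral>\<^sup>+x. ennreal (f x) \<partial>M)"
proof (cases "integrable M f")
  case True
  then show ?thesis using assms by (subst nn_integral_eq_integral) auto
qed (simp add: not_integrable_integral_eq)

lemma stopped_expectation_bounded:
  assumes "\<And>\<omega>. \<omega> \<in> space M \<Longrightarrow> \<tau> \<omega> \<le> ennreal T"
  shows "stopped_expectation M Z \<tau> = (\<integral>\<^sup>+\<omega>. ennreal (Z (enn2real (\<tau> \<omega>)) \<omega>) \<partial>M)"
proof -
  obtain n0 where n0: "T \<le> real n0" using real_arch_simple by blast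
  have "(\<integral>\<^sup>+\<omega>. ennreal (Z (enn2real (min (\<tau> \<omega>) (of_nat n))) \<omega>) \<partial>M) = (\<integral>\<^sup>+\<omega>. ennreal (Z (enn2real (\<tau> \<omega>)) \<omega>) \<partial>M)"
    if "n \<ge> n0" for n
  proof (rule nn_integral_cong)
    fix \<omega> assume "\<omega> \<in> space M"
    then have "\<tau> \<omega> \<le> ennreal T" by (rule assms)
    also have "\<dots> \<le> of_nat n"
      using n0 that by (subst ennreal_of_nat_eq_real_of_nat) (intro ennreal_leI, linarith)
    finally show "ennreal (Z (enn2real (min (\<tau> \<omega>) (of_nat n))) \<omega>) = ennreal (Z (enn2real (\<tau> \<omega>)) \<omega>)"
      by (simp add: min_absorb1)
  qed
  then have "(\<lambda>n. \<integral>\<^sup>+\<omega>. ennreal (Z (enn2real (min (\<tau> \<omega>) (of_nat n))) \<omega>) \<partial>M)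
      \<longlonglongrightarrow> (\<integral>\<^sup>+\<omega>. ennreal (Z (enn2real (\<tau> \<omega>)) \<omega>) \<partial>M)"
    by (intro tendsto_eventually) (auto simp: eventually_sequentially)
  then show ?thesis
    unfolding stopped_expectation_def by (rule lim_imp_Liminf[OF sequentially_bot])
qed

context feller_process
begin

text \<open>The contact set is closed, and its hitting time will be identified only almost surely,
  with a supremum of hitting times of open sets. Completeness and the null sets contained in the
  filtration make this enough.\<close>

lemma stopping_time_AE_cong:
  assumes st: "stopping_time (F x) \<sigma>" and eq: "AE \<omega> in P x. \<tau> \<omega> = \<sigma> \<omega>"
  shows "stopping_time (F x) \<tau>"
proof (rule stopping_timeI)
  fix t
  interpret complete_measure "P x" by (rule complete_measure_P)
  obtain N where N': "{\<omega> \<in> space (P x). \<not> \<tau> \<omega> = \<sigma> \<omega>} \<subseteq> N" "emeasure (P x) N = 0" "N \<in> sets (P x)"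
    by (rule AE_E[OF eq])
  then have N: "N \<in> null_sets (P x)" "{\<omega> \<in> space (P x). \<not> \<tau> \<omega> = \<sigma> \<omega>} \<subseteq> N"
    by (simp_all add: null_setsI)
  have "{\<omega> \<in> \<Omega>. \<tau> \<omega> \<le> t} \<inter> N \<in> sets (P x)"
    by (rule complete[OF _ N(1)]) simp
  then have sub: "{\<omega> \<in> \<Omega>. \<tau> \<omega> \<le> t} \<inter> N \<in> null_sets (P x)"
    by (rule null_sets_subset[OF N(1)]) simp
  have "{\<omega> \<in> \<Omega>. \<tau> \<omega> \<le> t} = ({\<omega> \<in> space (F x t). \<sigma> \<omega> \<le> t} - N) \<union> ({\<omega> \<in> \<Omega>. \<tau> \<omega> \<le> t} \<inter> N)"
    using N(2) by (auto simp: space_F space_P)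
  also have "\<dots> \<in> sets (F x t)"
    using stopping_timeD[OF st, of t] N(1) sub null_sets_F[of x t]
    by (intro sets.Un sets.Diff) (auto simp: pred_def)
  finally show "Measurable.pred (F x t) (\<lambda>\<omega>. \<tau> \<omega> \<le> t)"
    by (simp add: pred_def space_F)
qed

lemma stopping_time_SUP:
  assumes "\<And>i :: nat. stopping_time (F x) (\<sigma> i)"
  shows "stopping_time (F x) (\<lambda>\<omega>. SUP i. \<sigma> i \<omega>)"
  unfolding stopping_time_def SUP_le_iff
  using stopping_timeD[OF assms] by (auto intro!: pred_intros_countable)

end

context stopping_problem
begin

lemma grid_time_stopping_time:
  assumes \<kappa>: "grid_time x d \<kappa>" and "d > 0"
  shows "stopping_time (F x) (\<lambda>\<omega>. ennreal (real (\<kappa> \<omega>) * d))"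
proof (rule stopping_timeI)
  fix t
  have "{\<omega> \<in> \<Omega>. ennreal (real (\<kappa> \<omega>) * d) \<le> t} \<in> sets (F x t)"
  proof (cases t)
    case (real r)
    define j where "j = nat \<lfloor>r / d\<rfloor>"
    have "real (\<kappa> \<omega>) * d \<le> r \<longleftrightarrow> \<kappa> \<omega> \<le> j" for \<omega>
    proof -
      have "real (\<kappa> \<omega>) * d \<le> r \<longleftrightarrow> real (\<kappa> \<omega>) \<le> r / d"
        by (rule pos_le_divide_eq[OF \<open>d > 0\<close>, symmetric])
      also have "\<dots> \<longleftrightarrow> int (\<kappa> \<omega>) \<le> \<lfloor>r / d\<rfloor>" by (simp add: le_floor_iff)
      also have "\<dots> \<longleftrightarrow> \<kappa> \<omega> \<le> j" using real \<open>d > 0\<close> by (simp add: j_def le_nat_iff)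
      finally show ?thesis .
    qed
    then have "{\<omega> \<in> \<Omega>. ennreal (real (\<kappa> \<omega>) * d) \<le> t} = {\<omega> \<in> \<Omega>. \<kappa> \<omega> \<le> j}"
      using real by (simp add: ennreal_le_iff)
    also have "\<dots> \<in> sets (F x (ennreal (real j * d)))" using \<kappa> by (simp add: grid_time_def)
    also have "\<dots> \<subseteq> sets (F x t)"
    proof (rule sets_F_mono)
      have "real j \<le> r / d" using real \<open>d > 0\<close> by (simp add: j_def)
      then have "real j * d \<le> r" using pos_le_divide_eq[OF \<open>d > 0\<close>] by blast
      then show "ennreal (real j * d) \<le> t" using real by (simp add: ennreal_leI)
    qed
    finally show ?thesis .
  next
    case top
    then show ?thesis using sets.top[of "F x t"] by (simp add: space_F)
  qed
  then show "Measurable.pred (F x t) (\<lambda>\<omega>. ennreal (real (\<kappa> \<omega>) * d) \<le> t)"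
    by (simp add: pred_def space_F)
qed

section \<open>Near-optimal times and the entrance into the contact set\<close>

lemma approximately_optimal_times:
  assumes h: "reward h H"
  obtains \<tau> where "\<And>n. stopping_time (F x) (\<tau> n)" "\<And>n \<omega>. \<tau> n \<omega> \<le> ennreal (real n)"
    "\<And>n. (\<integral>\<omega>. discounted h (enn2real (\<tau> n \<omega>)) \<omega> \<partial>P x) = U n n h x"
proof -
  have "\<forall>n. \<exists>\<kappa>. grid_time x (1 / 2 ^ n) \<kappa> \<and> (\<forall>\<omega>. \<kappa> \<omega> \<le> n * 2 ^ n) \<and> (\<integral>\<omega>. gain (1 / 2 ^ n) h (\<kappa> \<omega>) \<omega> \<partial>P x) = U n n h x"
  proof
    fix n
    obtain \<kappa> where "grid_time x (1 / 2 ^ n) \<kappa>" "\<And>\<omega>. \<kappa> \<omega> \<le> n * 2 ^ n"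
      "(\<integral>\<omega>. gain (1 / 2 ^ n) h (\<kappa> \<omega>) \<omega> \<partial>P x) = V (1 / 2 ^ n) h h (n * 2 ^ n) x"
      by (rule V_attained[OF dyadic_step(1)[of n] rewardD(1)[OF h], of x "n * 2 ^ n"]) (rule that)
    then show "\<exists>\<kappa>. grid_time x (1 / 2 ^ n) \<kappa> \<and> (\<forall>\<omega>. \<kappa> \<omega> \<le> n * 2 ^ n) \<and> (\<integral>\<omega>. gain (1 / 2 ^ n) h (\<kappa> \<omega>) \<omega> \<partial>P x) = U n n h x"
      unfolding U_def by blast
  qed
  from choice[OF this] obtain \<kappa> where \<kappa>: "\<And>n. grid_time x (1 / 2 ^ n) (\<kappa> n)" "\<And>n \<omega>. \<kappa> n \<omega> \<le> n * 2 ^ n"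
    "\<And>n. (\<integral>\<omega>. gain (1 / 2 ^ n) h (\<kappa> n \<omega>) \<omega> \<partial>P x) = U n n h x"
    by blast
  show thesis
  proof (rule that[of "\<lambda>n \<omega>. ennreal (real (\<kappa> n \<omega>) * (1 / 2 ^ n))"])
    show "stopping_time (F x) (\<lambda>\<omega>. ennreal (real (\<kappa> n \<omega>) * (1 / 2 ^ n)))" for n
      by (rule grid_time_stopping_time[OF \<kappa>(1) dyadic_step(2)])
    show "ennreal (real (\<kappa> n \<omega>) * (1 / 2 ^ n)) \<le> ennreal (real n)" for n \<omega>
    proof (rule ennreal_leI)
      have "real (\<kappa> n \<omega>) \<le> real (n * 2 ^ n)" unfolding of_nat_le_iff by (rule \<kappa>(2))
      from mult_right_mono[OF this dyadic_step(1)[of n]]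
      show "real (\<kappa> n \<omega>) * (1 / 2 ^ n) \<le> real n" unfolding dyadic_step(3) .
    qed
    show "(\<integral>\<omega>. discounted h (enn2real (ennreal (real (\<kappa> n \<omega>) * (1 / 2 ^ n)))) \<omega> \<partial>P x) = U n n h x" for n
      using \<kappa>(3)[of n] by (simp add: gain_discounted)
  qed
qed

lemma discounted_nonneg: "reward h H \<Longrightarrow> 0 \<le> discounted h t \<omega>"
  by (simp add: discounted_def rewardD)

lemma discounted_w_nonneg: "reward h H \<Longrightarrow> 0 \<le> discounted (w h) t \<omega>"
  using w_bounds(1)[of h H "X t \<omega>"] by (simp add: discounted_def)

text \<open>The bound concerns \<open>w h\<close> and not \<open>h\<close>, because optional
  sampling speaks of the former; the two functions meet only when \<epsilon> tends to 0.\<close>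

lemma near_contact_time_bound:
  assumes h: "reward h H" and "\<epsilon> > 0"
  defines "\<sigma> \<equiv> hitting {y. h y - w h y < \<epsilon>}"
  shows "stopping_time (F x) \<sigma>" and "AE \<omega> in P x. \<sigma> \<omega> < \<infinity>"
    and "(\<integral>\<^sup>+\<omega>. ennreal (discounted (w h) (enn2real (\<sigma> \<omega>)) \<omega>) \<partial>P x) \<le> ennreal (w h x)"
proof -
  have hb: "h \<in> bcontfun" and wb: "w h \<in> bcontfun"
    using rewardD(1)[OF h] w_bcontfun[OF h] by auto
  have vb: "(\<lambda>y. h y - w h y) \<in> bcontfun" by (rule minus_cont[OF hb wb])
  show st: "stopping_time (F x) \<sigma>"
    unfolding \<sigma>_def by (intro hitting_stopping_time open_Collect_less bcontfun_continuous[OF vb] continuous_on_const)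
  obtain \<tau> where \<tau>: "\<And>n. stopping_time (F x) (\<tau> n)" "\<And>n \<omega>. \<tau> n \<omega> \<le> ennreal (real n)"
    and opt: "\<And>n. (\<integral>\<omega>. discounted h (enn2real (\<tau> n \<omega>)) \<omega> \<partial>P x) = U n n h x"
    by (rule approximately_optimal_times[OF h]) (rule that)
  define v where "v n \<omega> = h (X (enn2real (\<tau> n \<omega>)) \<omega>) - w h (X (enn2real (\<tau> n \<omega>)) \<omega>)" for n \<omega>
  obtain B where B: "\<And>y. \<bar>h y - w h y\<bar> \<le> B" using bcontfun_bound[OF vb] by metis
  have v_int: "integrable (P x) (v n)" for n
  proof (rule integrable_P_bounded)
    show "v n \<in> borel_measurable (P x)"
      unfolding v_def
      by (rule measurable_compose[OF X_random_time_measurable[OF bounded_time_measurable[OF \<tau>]] bcontfun_measurable[OF vb]]) simp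
    show "\<bar>v n \<omega>\<bar> \<le> B" for \<omega> unfolding v_def by (rule B)
  qed
  have v_nonneg: "0 \<le> v n \<omega>" for n \<omega> by (simp add: v_def w_bounds[OF h])
  \<comment> \<open>The weight is at least 1 and may be inserted. Then the cost of
    \<open>\<tau> n\<close> is \<open>U n n h x\<close>, while the weighted \<open>w h\<close> has
    expectation at least \<open>w h x\<close> by the submartingale property; the difference is the
    suboptimality of \<open>\<tau> n\<close>.\<close>
  have v_le: "(\<integral>\<omega>. norm (v n \<omega>) \<partial>P x) \<le> U n n h x - w h x" for n
  proof -
    note int = discounted_integrable[OF \<tau>(1) \<tau>(2)]
    have "(\<integral>\<omega>. norm (v n \<omega>) \<partial>P x)
        \<le> (\<integral>\<omega>. discounted h (enn2real (\<tau> n \<omega>)) \<omega> - discounted (w h) (enn2real (\<tau> n \<omega>)) \<omega> \<partial>P x)"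
    proof (rule integral_mono_AE[OF integrable_norm[OF v_int] Bochner_Integration.integrable_diff[OF int[OF hb] int[OF wb]]], rule AE_P_I)
      fix \<omega> assume \<omega>: "\<omega> \<in> \<Omega>"
      have "norm (v n \<omega>) = 1 * v n \<omega>" using v_nonneg[of n \<omega>] by simp
      also have "\<dots> \<le> exp (I (enn2real (\<tau> n \<omega>)) \<omega>) * v n \<omega>"
        using I_nonneg[OF \<omega>, of "enn2real (\<tau> n \<omega>)"] v_nonneg[of n \<omega>] by (intro mult_right_mono) auto
      finally show "norm (v n \<omega>) \<le> discounted h (enn2real (\<tau> n \<omega>)) \<omega> - discounted (w h) (enn2real (\<tau> n \<omega>)) \<omega>"
        by (simp add: discounted_def v_def right_diff_distrib)
    qed
    also have "\<dots> = U n n h x - (\<integral>\<omega>. discounted (w h) (enn2real (\<tau> n \<omega>)) \<omega> \<partial>P x)"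
      using Bochner_Integration.integral_diff[OF int[OF hb] int[OF wb]] opt[of n] by simp
    also have "\<dots> \<le> U n n h x - w h x"
      using w_le_discounted(1)[OF \<tau>(1) \<tau>(2) h] by simp
    finally show ?thesis .
  qed
  have U_gap_lim: "(\<lambda>n. U n n h x - w h x) \<longlonglongrightarrow> 0"
    using LIM_zero[OF U_tendsto_w[OF h]] .
  have "(\<lambda>n. \<integral>\<omega>. norm (v n \<omega>) \<partial>P x) \<longlonglongrightarrow> 0"
    by (rule tendsto_sandwich[OF _ _ tendsto_const U_gap_lim]) (use v_le in auto)
  \<comment> \<open>Convergence in mean yields almost sure convergence only along a subsequence,
    which is all that the eventual comparison with \<sigma> requires.\<close>
  from tendsto_L1_AE_subseq[OF v_int this]
  obtain r :: "nat \<Rightarrow> nat" where r: "strict_mono r" and v_lim: "AE \<omega> in P x. (\<lambda>n. v (r n) \<omega>) \<longlonglongrightarrow> 0"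
    by auto
  have later: "AE \<omega> in P x. \<forall>\<^sub>F n in sequentially. \<sigma> \<omega> \<le> \<tau> (r n) \<omega>"
    using v_lim
  proof eventually_elim
    fix \<omega> assume "(\<lambda>n. v (r n) \<omega>) \<longlonglongrightarrow> 0"
    then have "\<forall>\<^sub>F n in sequentially. v (r n) \<omega> < \<epsilon>" using \<open>\<epsilon> > 0\<close> by (rule order_tendstoD(2))
    then show "\<forall>\<^sub>F n in sequentially. \<sigma> \<omega> \<le> \<tau> (r n) \<omega>"
    proof eventually_elim
      fix n assume "v (r n) \<omega> < \<epsilon>"
      then have "\<sigma> \<omega> \<le> ennreal (enn2real (\<tau> (r n) \<omega>))"
        unfolding \<sigma>_def by (intro hitting_le) (auto simp: v_def)
      also have "ennreal (enn2real (\<tau> (r n) \<omega>)) = \<tau> (r n) \<omega>"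
        using le_less_trans[OF \<tau>(2)[of "r n" \<omega>], of \<top>] by simp
      finally show "\<sigma> \<omega> \<le> \<tau> (r n) \<omega>" .
    qed
  qed
  then show "AE \<omega> in P x. \<sigma> \<omega> < \<infinity>"
  proof eventually_elim
    fix \<omega> assume "\<forall>\<^sub>F n in sequentially. \<sigma> \<omega> \<le> \<tau> (r n) \<omega>"
    then obtain n where "\<sigma> \<omega> \<le> \<tau> (r n) \<omega>" using eventually_happens'[OF sequentially_bot] by blast
    also have "\<dots> \<le> ennreal (real (r n))" by (rule \<tau>(2))
    also have "\<dots> < \<infinity>" by simp
    finally show "\<sigma> \<omega> < \<infinity>" .
  qed
  \<comment> \<open>The minimum with \<open>\<tau> (r n)\<close> is a bounded time, to which
    optional sampling applies. It equals \<sigma> for all large \<open>n\<close>, so Fatou's lemma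
    recovers the expectation at \<sigma> itself.\<close>
  define u where "u n \<omega> = ennreal (discounted (w h) (enn2real (min (\<sigma> \<omega>) (\<tau> (r n) \<omega>))) \<omega>)" for n \<omega>
  have min_st: "stopping_time (F x) (\<lambda>\<omega>. min (\<sigma> \<omega>) (\<tau> (r n) \<omega>))" for n
    by (rule stopping_time_min[OF st \<tau>(1)])
  have min_le: "min (\<sigma> \<omega>) (\<tau> (r n) \<omega>) \<le> ennreal (real (r n))" for n \<omega>
    by (rule order_trans[OF min.cobounded2 \<tau>(2)])
  have u_int: "integrable (P x) (\<lambda>\<omega>. discounted (w h) (enn2real (min (\<sigma> \<omega>) (\<tau> (r n) \<omega>))) \<omega>)" for n
    by (rule discounted_integrable[OF min_st min_le wb])
  have u_le: "(\<integral>\<^sup>+\<omega>. u n \<omega> \<partial>P x) \<le> ennreal (U (r n) (r n) h x)" for n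
  proof -
    have "(\<integral>\<^sup>+\<omega>. u n \<omega> \<partial>P x) = ennreal (\<integral>\<omega>. discounted (w h) (enn2real (min (\<sigma> \<omega>) (\<tau> (r n) \<omega>))) \<omega> \<partial>P x)"
      unfolding u_def by (rule nn_integral_eq_integral[OF u_int]) (simp add: discounted_w_nonneg[OF h])
    also have "(\<integral>\<omega>. discounted (w h) (enn2real (min (\<sigma> \<omega>) (\<tau> (r n) \<omega>))) \<omega> \<partial>P x)
        \<le> (\<integral>\<omega>. discounted (w h) (enn2real (\<tau> (r n) \<omega>)) \<omega> \<partial>P x)"
      by (rule w_optional_sampling[OF h \<tau>(1) \<tau>(2) min_st]) simp
    also have "\<dots> \<le> (\<integral>\<omega>. discounted h (enn2real (\<tau> (r n) \<omega>)) \<omega> \<partial>P x)"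
      by (intro integral_mono discounted_integrable[OF \<tau>(1) \<tau>(2)] wb hb) (auto simp: discounted_def w_bounds[OF h])
    finally show ?thesis by (simp add: opt ennreal_leI)
  qed
  have "(\<integral>\<^sup>+\<omega>. ennreal (discounted (w h) (enn2real (\<sigma> \<omega>)) \<omega>) \<partial>P x) = (\<integral>\<^sup>+\<omega>. liminf (\<lambda>n. u n \<omega>) \<partial>P x)"
  proof (rule nn_integral_cong_AE)
    show "AE \<omega> in P x. ennreal (discounted (w h) (enn2real (\<sigma> \<omega>)) \<omega>) = liminf (\<lambda>n. u n \<omega>)"
      using later
    proof eventually_elim
      fix \<omega> assume "\<forall>\<^sub>F n in sequentially. \<sigma> \<omega> \<le> \<tau> (r n) \<omega>"
      then have "\<forall>\<^sub>F n in sequentially. u n \<omega> = ennreal (discounted (w h) (enn2real (\<sigma> \<omega>)) \<omega>)"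
        by eventually_elim (simp add: u_def min_absorb1)
      then have "(\<lambda>n. u n \<omega>) \<longlonglongrightarrow> ennreal (discounted (w h) (enn2real (\<sigma> \<omega>)) \<omega>)"
        by (rule tendsto_eventually)
      then show "ennreal (discounted (w h) (enn2real (\<sigma> \<omega>)) \<omega>) = liminf (\<lambda>n. u n \<omega>)"
        by (rule lim_imp_Liminf[OF sequentially_bot, symmetric])
    qed
  qed
  also have "\<dots> \<le> liminf (\<lambda>n. \<integral>\<^sup>+\<omega>. u n \<omega> \<partial>P x)"
  proof (rule nn_integral_liminf)
    show "u n \<in> borel_measurable (P x)" for n
      unfolding u_def using borel_measurable_integrable[OF u_int] by measurable
  qed
  also have "\<dots> \<le> liminf (\<lambda>n. ennreal (U (r n) (r n) h x))"
    by (intro Liminf_mono always_eventually allI u_le)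
  also have "\<dots> = ennreal (w h x)"
  proof (rule lim_imp_Liminf[OF sequentially_bot tendsto_ennrealI])
    show "(\<lambda>n. U (r n) (r n) h x) \<longlonglongrightarrow> w h x"
      using LIMSEQ_subseq_LIMSEQ[OF U_tendsto_w[OF h] r] by (simp add: o_def)
  qed
  finally show "(\<integral>\<^sup>+\<omega>. ennreal (discounted (w h) (enn2real (\<sigma> \<omega>)) \<omega>) \<partial>P x) \<le> ennreal (w h x)" .
qed

lemma contact_time_optimal:
  assumes h: "reward h H"
  defines "\<tau> \<equiv> hitting {y. w h y = h y}"
  shows "stopping_time (F x) \<tau>" and "AE \<omega> in P x. \<tau> \<omega> < \<infinity>"
    and "(\<integral>\<^sup>+\<omega>. ennreal (discounted h (enn2real (\<tau> \<omega>)) \<omega>) \<partial>P x) \<le> ennreal (w h x)"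
proof -
  have hb: "h \<in> bcontfun" and wb: "w h \<in> bcontfun"
    using rewardD(1)[OF h] w_bcontfun[OF h] by auto
  have vb: "(\<lambda>y. h y - w h y) \<in> bcontfun" by (rule minus_cont[OF hb wb])
  define e where "e i = 1 / real (Suc i)" for i
  have e: "e i > 0" "e (Suc i) \<le> e i" for i
    by (simp_all add: e_def frac_le)
  have e_lim: "e \<longlonglongrightarrow> 0"
    unfolding e_def by (rule LIMSEQ_Suc[OF lim_const_over_n])
  define \<sigma> where "\<sigma> i = hitting {y. h y - w h y < e i}" for i
  have near: "stopping_time (F x) (\<sigma> i)" "AE \<omega> in P x. \<sigma> i \<omega> < \<infinity>"
    "(\<integral>\<^sup>+\<omega>. ennreal (discounted (w h) (enn2real (\<sigma> i \<omega>)) \<omega>) \<partial>P x) \<le> ennreal (w h x)" for i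
    unfolding \<sigma>_def by (rule near_contact_time_bound[OF h e(1)])+
  define S where "S \<omega> = (SUP i. \<sigma> i \<omega>)" for \<omega>
  have inc: "incseq (\<lambda>i. \<sigma> i \<omega>)" for \<omega>
    unfolding \<sigma>_def by (intro incseq_SucI hitting_antimono) (use e(2) less_le_trans in blast)
  have S_st: "stopping_time (F x) S"
    unfolding S_def[abs_def] by (rule stopping_time_SUP[OF near(1)])
  have \<sigma>_meas: "\<sigma> i \<in> borel_measurable (P x)" for i
    by (rule stopping_time_measurable[OF near(1)])
  \<comment> \<open>As \<open>g\<close> is at least \<open>c\<close>, \<open>c\<close> times the
    entrance time is at most \<open>I\<close>, hence below the weighted value there. The
    expectations of \<open>c\<close> times \<open>\<sigma> i\<close> are thus bounded by
    \<open>w h x\<close>, and by monotone convergence the supremum is integrable.\<close>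
  have S_fin: "AE \<omega> in P x. S \<omega> < \<infinity>"
  proof -
    have "(\<integral>\<^sup>+\<omega>. ennreal c * \<sigma> i \<omega> \<partial>P x) \<le> ennreal (w h x)" for i
    proof -
      have "(\<integral>\<^sup>+\<omega>. ennreal c * \<sigma> i \<omega> \<partial>P x) \<le> (\<integral>\<^sup>+\<omega>. ennreal (discounted (w h) (enn2real (\<sigma> i \<omega>)) \<omega>) \<partial>P x)"
      proof (rule nn_integral_mono_AE)
        show "AE \<omega> in P x. ennreal c * \<sigma> i \<omega> \<le> ennreal (discounted (w h) (enn2real (\<sigma> i \<omega>)) \<omega>)"
          using near(2)[of i] AE_space
        proof eventually_elim
          fix \<omega> assume fin: "\<sigma> i \<omega> < \<infinity>" and "\<omega> \<in> space (P x)"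
          then have \<omega>: "\<omega> \<in> \<Omega>" by (simp add: space_P)
          let ?t = "enn2real (\<sigma> i \<omega>)"
          have "c * ?t \<le> I ?t \<omega>" using I_diff_ge[OF \<omega>, of 0 ?t c] g_ge by (simp add: I_0)
          also have "\<dots> \<le> exp (I ?t \<omega>)" using exp_ge_add_one_self[of "I ?t \<omega>"] by linarith
          also have "\<dots> \<le> discounted (w h) ?t \<omega>"
            using w_bounds(1)[OF h, of "X ?t \<omega>"] by (simp add: discounted_def)
          finally have "ennreal (c * ?t) \<le> ennreal (discounted (w h) ?t \<omega>)" by (rule ennreal_leI)
          moreover have "ennreal c * \<sigma> i \<omega> = ennreal (c * ?t)"
            using fin c_pos by (simp add: ennreal_mult)
          ultimately show "ennreal c * \<sigma> i \<omega> \<le> ennreal (discounted (w h) ?t \<omega>)" by simp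
        qed
      qed
      from this near(3) show ?thesis by (rule order_trans)
    qed
    moreover have "(\<integral>\<^sup>+\<omega>. (SUP i. ennreal c * \<sigma> i \<omega>) \<partial>P x) = (SUP i. \<integral>\<^sup>+\<omega>. ennreal c * \<sigma> i \<omega> \<partial>P x)"
    proof (rule nn_integral_monotone_convergence_SUP)
      show "incseq (\<lambda>i \<omega>. ennreal c * \<sigma> i \<omega>)"
        using incseqD[OF inc] by (auto simp: incseq_def le_fun_def intro: mult_left_mono)
      show "(\<lambda>\<omega>. ennreal c * \<sigma> i \<omega>) \<in> borel_measurable (P x)" for i
        using \<sigma>_meas[of i] by measurable
    qed
    ultimately have "(\<integral>\<^sup>+\<omega>. (SUP i. ennreal c * \<sigma> i \<omega>) \<partial>P x) \<le> ennreal (w h x)"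
      by (auto intro: SUP_least)
    then have "(\<integral>\<^sup>+\<omega>. (SUP i. ennreal c * \<sigma> i \<omega>) \<partial>P x) \<noteq> \<infinity>"
      by (auto simp: top_unique)
    moreover have "(\<lambda>\<omega>. SUP i. ennreal c * \<sigma> i \<omega>) \<in> borel_measurable (P x)"
      using \<sigma>_meas by measurable
    ultimately have "AE \<omega> in P x. (SUP i. ennreal c * \<sigma> i \<omega>) \<noteq> \<infinity>"
      by (intro nn_integral_PInf_AE)
    then show ?thesis
    proof eventually_elim
      fix \<omega> assume "(SUP i. ennreal c * \<sigma> i \<omega>) \<noteq> \<infinity>"
      then have "ennreal c * S \<omega> \<noteq> \<top>"
        unfolding S_def by (simp add: SUP_mult_left_ennreal)
      then have "S \<omega> \<noteq> \<top>" using c_pos by (auto simp: ennreal_mult_eq_top_iff)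
      then show "S \<omega> < \<infinity>" by (simp add: less_top)
    qed
  qed
  have limits: "AE \<omega> in P x. S \<omega> < \<infinity> \<and> \<omega> \<in> \<Omega> \<and> (\<lambda>i. X (enn2real (\<sigma> i \<omega>)) \<omega>) \<longlonglongrightarrow> X (enn2real (S \<omega>)) \<omega>"
    using quasi_left_continuous[of x \<sigma>, OF near(1) inc] S_fin AE_space
    by eventually_elim (simp add: S_def space_P)
  \<comment> \<open>At each \<open>\<sigma> i\<close> the difference of \<open>h\<close> and
    \<open>w h\<close> is at most \<open>e i\<close>, in the weak form that survives on the closure.
    Continuity along the quasi-left limit brings it down to 0.\<close>
  have contact: "w h (X (enn2real (S \<omega>)) \<omega>) = h (X (enn2real (S \<omega>)) \<omega>)"
    if \<omega>: "S \<omega> < \<infinity>" "\<omega> \<in> \<Omega>" and lim: "(\<lambda>i. X (enn2real (\<sigma> i \<omega>)) \<omega>) \<longlonglongrightarrow> X (enn2real (S \<omega>)) \<omega>" for \<omega>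
  proof -
    let ?v = "\<lambda>y. h y - w h y"
    have v_cont: "continuous_on UNIV ?v" by (rule bcontfun_continuous[OF vb])
    have "?v (X (enn2real (\<sigma> i \<omega>)) \<omega>) \<le> e i" for i
    proof -
      have "\<sigma> i \<omega> \<le> S \<omega>" unfolding S_def by (rule SUP_upper) simp
      then have fin: "\<sigma> i \<omega> < \<infinity>" using \<omega>(1) by (rule le_less_trans)
      obtain u where u: "\<And>k. X (u k) \<omega> \<in> {y. ?v y < e i}" "(\<lambda>k. X (u k) \<omega>) \<longlonglongrightarrow> X (enn2real (\<sigma> i \<omega>)) \<omega>"
        by (rule hitting_approached[OF \<omega>(2) fin[unfolded \<sigma>_def], folded \<sigma>_def]) (rule that)
      have "(\<lambda>k. ?v (X (u k) \<omega>)) \<longlonglongrightarrow> ?v (X (enn2real (\<sigma> i \<omega>)) \<omega>)"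
        by (rule continuous_on_tendsto_compose[OF v_cont u(2)]) auto
      then show ?thesis
        by (rule LIMSEQ_le_const2) (use u(1) in \<open>auto intro!: less_imp_le\<close>)
    qed
    moreover have "(\<lambda>i. ?v (X (enn2real (\<sigma> i \<omega>)) \<omega>)) \<longlonglongrightarrow> ?v (X (enn2real (S \<omega>)) \<omega>)"
      by (rule continuous_on_tendsto_compose[OF v_cont lim]) auto
    ultimately have "?v (X (enn2real (S \<omega>)) \<omega>) \<le> 0"
      by (intro LIMSEQ_le[OF _ e_lim]) auto
    with w_bounds(2)[OF h] show ?thesis by (intro antisym) auto
  qed
  \<comment> \<open>Contact at time \<open>S\<close> gives one inequality. For the other, contact
    points lie in every near-contact set, so each \<open>\<sigma> i\<close> comes no later than
    \<tau>.\<close>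
  have \<tau>_S: "AE \<omega> in P x. \<tau> \<omega> = S \<omega>"
    using limits
  proof eventually_elim
    fix \<omega> assume \<omega>: "S \<omega> < \<infinity> \<and> \<omega> \<in> \<Omega> \<and> (\<lambda>i. X (enn2real (\<sigma> i \<omega>)) \<omega>) \<longlonglongrightarrow> X (enn2real (S \<omega>)) \<omega>"
    have "\<tau> \<omega> \<le> ennreal (enn2real (S \<omega>))"
      unfolding \<tau>_def by (rule hitting_le) (use contact \<omega> in auto)
    also have "\<dots> = S \<omega>" using \<omega> by simp
    finally have "\<tau> \<omega> \<le> S \<omega>" .
    moreover have "\<sigma> i \<omega> \<le> \<tau> \<omega>" for i
      unfolding \<sigma>_def \<tau>_def by (rule hitting_antimono) (use e(1) in auto)
    then have "S \<omega> \<le> \<tau> \<omega>" unfolding S_def by (rule SUP_least)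
    ultimately show "\<tau> \<omega> = S \<omega>" by (rule antisym)
  qed
  show "stopping_time (F x) \<tau>" by (rule stopping_time_AE_cong[OF S_st \<tau>_S])
  show "AE \<omega> in P x. \<tau> \<omega> < \<infinity>" using \<tau>_S S_fin by eventually_elim simp
  have "(\<integral>\<^sup>+\<omega>. ennreal (discounted h (enn2real (\<tau> \<omega>)) \<omega>) \<partial>P x)
      = (\<integral>\<^sup>+\<omega>. liminf (\<lambda>i. ennreal (discounted (w h) (enn2real (\<sigma> i \<omega>)) \<omega>)) \<partial>P x)"
  \<comment> \<open>Along almost every path the weighted values at \<open>\<sigma> i\<close>
    converge, by continuity of \<open>I\<close> in time and of \<open>w h\<close> along the
    quasi-left limit; at the limit \<open>w h\<close> may be exchanged for \<open>h\<close> by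
    contact.\<close>
  proof (rule nn_integral_cong_AE)
    show "AE \<omega> in P x. ennreal (discounted h (enn2real (\<tau> \<omega>)) \<omega>)
        = liminf (\<lambda>i. ennreal (discounted (w h) (enn2real (\<sigma> i \<omega>)) \<omega>))"
      using limits \<tau>_S
    proof eventually_elim
      fix \<omega> assume lim: "S \<omega> < \<infinity> \<and> \<omega> \<in> \<Omega> \<and> (\<lambda>i. X (enn2real (\<sigma> i \<omega>)) \<omega>) \<longlonglongrightarrow> X (enn2real (S \<omega>)) \<omega>"
        and eq: "\<tau> \<omega> = S \<omega>"
      have "(\<lambda>i. \<sigma> i \<omega>) \<longlonglongrightarrow> S \<omega>" unfolding S_def by (rule LIMSEQ_SUP[OF inc])
      then have "(\<lambda>i. enn2real (\<sigma> i \<omega>)) \<longlonglongrightarrow> enn2real (S \<omega>)"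
        using lim by (intro tendsto_enn2real) auto
      then have "(\<lambda>i. I (enn2real (\<sigma> i \<omega>)) \<omega>) \<longlonglongrightarrow> I (enn2real (S \<omega>)) \<omega>"
        using lim by (intro I_tendsto) auto
      moreover have "(\<lambda>i. w h (X (enn2real (\<sigma> i \<omega>)) \<omega>)) \<longlonglongrightarrow> w h (X (enn2real (S \<omega>)) \<omega>)"
        using lim by (intro continuous_on_tendsto_compose[OF bcontfun_continuous[OF wb]]) auto
      ultimately have "(\<lambda>i. ennreal (discounted (w h) (enn2real (\<sigma> i \<omega>)) \<omega>))
          \<longlonglongrightarrow> ennreal (discounted (w h) (enn2real (S \<omega>)) \<omega>)"
        unfolding discounted_def by (intro tendsto_ennrealI tendsto_mult tendsto_exp)
      moreover have "discounted (w h) (enn2real (S \<omega>)) \<omega> = discounted h (enn2real (\<tau> \<omega>)) \<omega>"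
        using contact[of \<omega>] lim by (simp add: discounted_def eq)
      ultimately show "ennreal (discounted h (enn2real (\<tau> \<omega>)) \<omega>)
          = liminf (\<lambda>i. ennreal (discounted (w h) (enn2real (\<sigma> i \<omega>)) \<omega>))"
        using lim_imp_Liminf[OF sequentially_bot] by metis
    qed
  qed
  also have "\<dots> \<le> liminf (\<lambda>i. \<integral>\<^sup>+\<omega>. ennreal (discounted (w h) (enn2real (\<sigma> i \<omega>)) \<omega>) \<partial>P x)"
  proof (rule nn_integral_liminf)
    fix i
    have "(\<lambda>\<omega>. discounted (w h) (enn2real (\<sigma> i \<omega>)) \<omega>) \<in> borel_measurable (P x)"
      by (rule discounted_measurable[OF _ _ wb]) (use \<sigma>_meas[of i] in simp_all)
    then show "(\<lambda>\<omega>. ennreal (discounted (w h) (enn2real (\<sigma> i \<omega>)) \<omega>)) \<in> borel_measurable (P x)"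
      by measurable
  qed
  also have "\<dots> \<le> ennreal (w h x)"
    by (rule order_trans[OF Liminf_le_Limsup[OF sequentially_bot] Limsup_bounded])
       (intro always_eventually allI near(3))
  finally show "(\<integral>\<^sup>+\<omega>. ennreal (discounted h (enn2real (\<tau> \<omega>)) \<omega>) \<partial>P x) \<le> ennreal (w h x)" .
qed

text \<open>Connects the ordinary expectation at the contact time with the convention for unbounded
  times, namely the limit inferior over truncated times; here the truncated expectations actually
  converge.\<close>

lemma stopped_expectation_contact_time:
  assumes h: "reward h H"
  shows "stopped_expectation (P x) (discounted h) (hitting {y. w h y = h y}) \<le> ennreal (w h x)"
proof -
  define \<tau> where "\<tau> = hitting {y. w h y = h y}"
  note opt = contact_time_optimal[OF h, of x, folded \<tau>_def]
  have hb: "h \<in> bcontfun" by (rule rewardD(1)[OF h])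
  have [measurable]: "\<tau> \<in> borel_measurable (P x)" by (rule stopping_time_measurable[OF opt(1)])
  have meas: "(\<lambda>\<omega>. ennreal (discounted h (enn2real (\<rho> \<omega>)) \<omega>)) \<in> borel_measurable (P x)"
    if [measurable]: "\<rho> \<in> borel_measurable (P x)" for \<rho>
  proof -
    have [measurable]: "(\<lambda>\<omega>. discounted h (enn2real (\<rho> \<omega>)) \<omega>) \<in> borel_measurable (P x)"
      by (rule discounted_measurable[OF _ _ hb]) simp_all
    show ?thesis by measurable
  qed
  have "(\<lambda>n. \<integral>\<^sup>+\<omega>. ennreal (discounted h (enn2real (min (\<tau> \<omega>) (of_nat n))) \<omega>) \<partial>P x)
      \<longlonglongrightarrow> (\<integral>\<^sup>+\<omega>. ennreal (discounted h (enn2real (\<tau> \<omega>)) \<omega>) \<partial>P x)"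
  \<comment> \<open>Stopping earlier carries a smaller weight and a reward of at most
    \<open>H\<close>, whereas the reward at \<tau> is at least 1. So \<open>H\<close> times the cost
    at \<tau> dominates, and its expectation is finite by optimality.\<close>
  proof (rule nn_integral_dominated_convergence[where w = "\<lambda>\<omega>. ennreal H * ennreal (discounted h (enn2real (\<tau> \<omega>)) \<omega>)"])
    show "(\<lambda>\<omega>. ennreal (discounted h (enn2real (min (\<tau> \<omega>) (of_nat n))) \<omega>)) \<in> borel_measurable (P x)" for n
      by (rule meas) measurable
    show m: "(\<lambda>\<omega>. ennreal (discounted h (enn2real (\<tau> \<omega>)) \<omega>)) \<in> borel_measurable (P x)"
      by (rule meas) measurable
    then show "(\<lambda>\<omega>. ennreal H * ennreal (discounted h (enn2real (\<tau> \<omega>)) \<omega>)) \<in> borel_measurable (P x)"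
      by measurable
    have "(\<integral>\<^sup>+\<omega>. ennreal H * ennreal (discounted h (enn2real (\<tau> \<omega>)) \<omega>) \<partial>P x)
        = ennreal H * (\<integral>\<^sup>+\<omega>. ennreal (discounted h (enn2real (\<tau> \<omega>)) \<omega>) \<partial>P x)"
      by (rule nn_integral_cmult[OF m])
    also have "\<dots> \<le> ennreal H * ennreal (w h x)" by (intro mult_left_mono opt) simp
    also have "\<dots> < \<infinity>" by (simp add: ennreal_mult_less_top)
    finally show "(\<integral>\<^sup>+\<omega>. ennreal H * ennreal (discounted h (enn2real (\<tau> \<omega>)) \<omega>) \<partial>P x) < \<infinity>" .
    show "AE \<omega> in P x. ennreal (discounted h (enn2real (min (\<tau> \<omega>) (of_nat n))) \<omega>)
        \<le> ennreal H * ennreal (discounted h (enn2real (\<tau> \<omega>)) \<omega>)" for n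
      using opt(2) AE_space
    proof eventually_elim
      fix \<omega> assume fin: "\<tau> \<omega> < \<infinity>" and "\<omega> \<in> space (P x)"
      then have \<omega>: "\<omega> \<in> \<Omega>" by (simp add: space_P)
      let ?s = "enn2real (min (\<tau> \<omega>) (of_nat n))" and ?t = "enn2real (\<tau> \<omega>)"
      have "?s \<le> ?t" using fin by (intro enn2real_mono) auto
      then have "I ?s \<omega> \<le> I ?t \<omega>" by (intro I_mono[OF \<omega>]) auto
      then have "discounted h ?s \<omega> \<le> exp (I ?t \<omega>) * H"
        unfolding discounted_def using rewardD(3,4)[OF h] by (intro mult_mono) auto
      also have "\<dots> \<le> (exp (I ?t \<omega>) * H) * h (X ?t \<omega>)"
        using mult_left_mono[OF rewardD(2)[OF h, of "X ?t \<omega>"], of "exp (I ?t \<omega>) * H"] rewardD(6)[OF h] by simp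
      also have "\<dots> = H * discounted h ?t \<omega>" by (simp add: discounted_def)
      finally show "ennreal (discounted h ?s \<omega>) \<le> ennreal H * ennreal (discounted h ?t \<omega>)"
        using rewardD(6)[OF h] by (simp add: ennreal_leI flip: ennreal_mult')
    qed
    show "AE \<omega> in P x. (\<lambda>n. ennreal (discounted h (enn2real (min (\<tau> \<omega>) (of_nat n))) \<omega>))
        \<longlonglongrightarrow> ennreal (discounted h (enn2real (\<tau> \<omega>)) \<omega>)"
      using opt(2)
    proof eventually_elim
      fix \<omega> assume fin: "\<tau> \<omega> < \<infinity>"
      obtain n0 where n0: "enn2real (\<tau> \<omega>) \<le> real n0" using real_arch_simple by blast
      have "min (\<tau> \<omega>) (of_nat n) = \<tau> \<omega>" if "n \<ge> n0" for n
      proof (rule min_absorb1)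
        have "\<tau> \<omega> = ennreal (enn2real (\<tau> \<omega>))" using fin by simp
        also have "\<dots> \<le> ennreal (real n)" using n0 that by (intro ennreal_leI) linarith
        finally show "\<tau> \<omega> \<le> of_nat n" by (simp add: ennreal_of_nat_eq_real_of_nat)
      qed
      then show "(\<lambda>n. ennreal (discounted h (enn2real (min (\<tau> \<omega>) (of_nat n))) \<omega>))
        \<longlonglongrightarrow> ennreal (discounted h (enn2real (\<tau> \<omega>)) \<omega>)"
        unfolding tendsto_def eventually_sequentially by (intro allI impI exI[of _ n0]) simp
    qed
  qed
  from lim_imp_Liminf[OF sequentially_bot this] opt(3)
  show ?thesis by (simp add: stopped_expectation_def \<tau>_def)
qed

end

section \<open>The optimal stopping problem\<close>

locale exponential_stopping_problem = stopping_problem \<Omega> P F X g b c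
  for \<Omega> :: "'w set"
    and P :: "'e::{metric_space, second_countable_topology} \<Rightarrow> 'w measure"
    and F :: "'e \<Rightarrow> ennreal \<Rightarrow> 'w measure"
    and X :: "real \<Rightarrow> 'w \<Rightarrow> 'e"
    and g :: "'e \<Rightarrow> real" and b c :: real +
  fixes G :: "'e \<Rightarrow> real" and C :: real
  assumes G_continuous: "continuous_on UNIV G" and G_nonneg: "\<And>x. 0 \<le> G x" and G_le: "\<And>x. G x \<le> C"
begin

abbreviation h :: "'e \<Rightarrow> real" where "h x \<equiv> exp (G x)"

lemma reward_h: "reward h (exp C)"
proof -
  have "h \<in> bcontfun"
    by (intro bcontfunI bounded_rangeI[of _ "exp C"] continuous_intros G_continuous) (simp add: G_le)
  then show ?thesis by (simp add: reward_def G_nonneg G_le)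
qed

lemma payoff_eq: "payoff X g G t \<omega> = discounted h t \<omega>"
  by (simp add: payoff_def discounted_def I_def exp_add)

lemma lower_payoff_eq: "lower_payoff X g G T t \<omega> = discounted (if t < T then h else (\<lambda>_. 1)) t \<omega>"
  by (simp add: lower_payoff_def discounted_def I_def exp_add)

lemma stopped_payoff_bounded:
  assumes "\<tau> \<in> bounded_stopping_times (P x) (F x) T"
  shows "stopped_expectation (P x) (payoff X g G) \<tau> = (\<integral>\<^sup>+\<omega>. ennreal (discounted h (enn2real (\<tau> \<omega>)) \<omega>) \<partial>P x)"
    and "stopped_expectation (P x) (lower_payoff X g G T) \<tau>
      = (\<integral>\<^sup>+\<omega>. ennreal (discounted (if enn2real (\<tau> \<omega>) < T then h else (\<lambda>_. 1)) (enn2real (\<tau> \<omega>)) \<omega>) \<partial>P x)"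
  using assms stopped_expectation_bounded[of "P x" \<tau> T]
  by (auto simp: bounded_stopping_times_def payoff_eq lower_payoff_eq)

lemma w_le_stopped_payoff:
  assumes "stopping_time (F x) \<tau>" "\<And>\<omega>. \<omega> \<in> \<Omega> \<Longrightarrow> \<tau> \<omega> \<le> ennreal (real N)"
  shows "ennreal (w h x) \<le> (\<integral>\<^sup>+\<omega>. ennreal (discounted h (enn2real (\<tau> \<omega>)) \<omega>) \<partial>P x)"
proof -
  have "ennreal (w h x) \<le> ennreal (\<integral>\<omega>. discounted h (enn2real (\<tau> \<omega>)) \<omega> \<partial>P x)"
    by (rule ennreal_leI) (rule w_le_discounted(2)[OF assms reward_h])
  also have "\<dots> \<le> (\<integral>\<^sup>+\<omega>. ennreal (discounted h (enn2real (\<tau> \<omega>)) \<omega>) \<partial>P x)"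
    by (rule ennreal_integral_le_nn_integral) (rule discounted_nonneg[OF reward_h])
  finally show ?thesis .
qed

lemma bounded_stopping_timesD:
  assumes "\<tau> \<in> bounded_stopping_times (P x) (F x) T"
  shows "stopping_time (F x) \<tau>" "\<And>\<omega>. \<omega> \<in> \<Omega> \<Longrightarrow> \<tau> \<omega> \<le> ennreal T"
  using assms by (auto simp: bounded_stopping_times_def finite_stopping_times_def space_P)

text \<open>One and the same time is admissible for every horizon from \<open>N\<close> on; it
  therefore serves the infinite-horizon problem and all later upper values.\<close>

lemma near_optimal_time:
  obtains \<tau> where "\<And>T. real N \<le> T \<Longrightarrow> \<tau> \<in> bounded_stopping_times (P x) (F x) T"
    "stopped_expectation (P x) (payoff X g G) \<tau> = ennreal (U N N h x)"
proof -
  obtain \<tau> where \<tau>: "\<And>n. stopping_time (F x) (\<tau> n)" "\<And>n \<omega>. \<tau> n \<omega> \<le> ennreal (real n)"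
    and opt: "\<And>n. (\<integral>\<omega>. discounted h (enn2real (\<tau> n \<omega>)) \<omega> \<partial>P x) = U n n h x"
    by (rule approximately_optimal_times[OF reward_h]) (rule that)
  have mem: "\<tau> N \<in> bounded_stopping_times (P x) (F x) T" if "real N \<le> T" for T
  proof -
    have "\<tau> N \<omega> \<le> ennreal T" for \<omega>
      using \<tau>(2) ennreal_leI[OF that] by (rule order_trans)
    moreover from this have "\<tau> N \<omega> < \<infinity>" for \<omega> by (rule le_less_trans) simp
    ultimately show ?thesis
      using \<tau>(1) by (simp add: bounded_stopping_times_def finite_stopping_times_def)
  qed
  have "stopped_expectation (P x) (payoff X g G) (\<tau> N) = (\<integral>\<^sup>+\<omega>. ennreal (discounted h (enn2real (\<tau> N \<omega>)) \<omega>) \<partial>P x)"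
    by (rule stopped_payoff_bounded(1)[OF mem[OF order_refl]])
  also have "\<dots> = ennreal (\<integral>\<omega>. discounted h (enn2real (\<tau> N \<omega>)) \<omega> \<partial>P x)"
    by (rule nn_integral_eq_integral[OF discounted_integrable[OF \<tau> rewardD(1)[OF reward_h]]])
       (simp add: discounted_nonneg[OF reward_h])
  finally show thesis by (intro that[of "\<tau> N"] mem) (simp_all add: opt)
qed

text \<open>For the lower bound the truncating convention is convenient: each truncated time is
  bounded, so \<open>w\<close> lies below every member of the sequence and hence below its limit
  inferior. For the upper bound, grid times are admissible.\<close>

lemma opt_value_eq: "opt_value P F X g G x = ennreal (w h x)"
proof (rule antisym)
  have "opt_value P F X g G x \<le> ennreal (U N N h x)" for N
  proof -
    obtain \<tau> where \<tau>: "\<tau> \<in> bounded_stopping_times (P x) (F x) (real N)"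
      "stopped_expectation (P x) (payoff X g G) \<tau> = ennreal (U N N h x)"
      using near_optimal_time[of N x] by blast
    then show ?thesis
      unfolding opt_value_def by (intro INF_lower2[of \<tau>]) (auto simp: bounded_stopping_times_def)
  qed
  then show "opt_value P F X g G x \<le> ennreal (w h x)"
    by (intro LIMSEQ_le_const[OF tendsto_ennrealI[OF U_tendsto_w[OF reward_h]]]) auto
next
  show "ennreal (w h x) \<le> opt_value P F X g G x"
    unfolding opt_value_def
  proof (rule INF_greatest)
    fix \<tau> assume "\<tau> \<in> finite_stopping_times (P x) (F x)"
    then have st: "stopping_time (F x) \<tau>" by (simp add: finite_stopping_times_def)
    show "ennreal (w h x) \<le> stopped_expectation (P x) (payoff X g G) \<tau>"
      unfolding stopped_expectation_def payoff_eq
    proof (rule Liminf_bounded, intro always_eventually allI)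
      fix n
      show "ennreal (w h x) \<le> (\<integral>\<^sup>+\<omega>. ennreal (discounted h (enn2real (min (\<tau> \<omega>) (of_nat n))) \<omega>) \<partial>P x)"
        by (rule w_le_stopped_payoff[where N = n, OF stopping_time_min[OF st stopping_time_const]])
           (simp add: ennreal_of_nat_eq_real_of_nat)
    qed
  qed
qed

lemma w_le_upper_value: "ennreal (w h x) \<le> upper_value_upto P F X g G T x"
  unfolding upper_value_upto_def
proof (rule INF_greatest)
  fix \<tau> assume \<tau>: "\<tau> \<in> bounded_stopping_times (P x) (F x) T"
  obtain n where n: "T \<le> real n" using real_arch_simple by blast
  show "ennreal (w h x) \<le> stopped_expectation (P x) (payoff X g G) \<tau>"
    unfolding stopped_payoff_bounded(1)[OF \<tau>]
    using bounded_stopping_timesD[OF \<tau>] ennreal_leI[OF n] order_trans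
    by (intro w_le_stopped_payoff[where N = n]) blast+
qed

lemma upper_value_le:
  assumes "real N \<le> T"
  shows "upper_value_upto P F X g G T x \<le> ennreal (U N N h x)"
proof -
  obtain \<tau> where "\<tau> \<in> bounded_stopping_times (P x) (F x) T"
    "stopped_expectation (P x) (payoff X g G) \<tau> = ennreal (U N N h x)"
    using near_optimal_time[of N x] assms by blast
  then show ?thesis unfolding upper_value_upto_def by (intro INF_lower2[of \<tau>]) auto
qed

lemma lower_le_upper_value: "lower_value_upto P F X g G T x \<le> upper_value_upto P F X g G T x"
  unfolding lower_value_upto_def upper_value_upto_def
proof (rule INF_mono, rule bexI)
  fix \<tau> assume \<tau>: "\<tau> \<in> bounded_stopping_times (P x) (F x) T"
  show "stopped_expectation (P x) (lower_payoff X g G T) \<tau> \<le> stopped_expectation (P x) (payoff X g G) \<tau>"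
    unfolding stopped_payoff_bounded[OF \<tau>]
    by (intro nn_integral_mono ennreal_leI) (simp add: discounted_def G_nonneg)
qed

text \<open>Any time admissible for the real horizon \<open>T\<close> is cut at the integer
  \<open>N\<close>, for which the grid bound is available. The cut does not increase the lower
  payoff, so the bound carries over.\<close>

lemma lower_value_ge:
  assumes "real N \<le> T"
  shows "ennreal (w h x - gap_ratio (exp C) ^ N * exp C) \<le> lower_value_upto P F X g G T x"
  unfolding lower_value_upto_def
proof (rule INF_greatest)
  fix \<tau> assume \<tau>: "\<tau> \<in> bounded_stopping_times (P x) (F x) T"
  note \<tau>D = bounded_stopping_timesD[OF \<tau>]
  define \<rho> where "\<rho> \<omega> = min (\<tau> \<omega>) (ennreal (real N))" for \<omega>
  let ?l = "\<lambda>T t \<omega>. discounted (if t < T then h else (\<lambda>_. 1)) t \<omega>"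
  have \<rho>: "stopping_time (F x) \<rho>" "\<And>\<omega>. \<rho> \<omega> \<le> ennreal (real N)"
    unfolding \<rho>_def by (auto intro: stopping_time_min stopping_time_const \<tau>D(1))
  have "ennreal (w h x - gap_ratio (exp C) ^ N * exp C) \<le> ennreal (\<integral>\<omega>. ?l (real N) (enn2real (\<rho> \<omega>)) \<omega> \<partial>P x)"
    by (intro ennreal_leI w_le_discounted_lower \<rho> reward_h)
  also have "\<dots> \<le> (\<integral>\<^sup>+\<omega>. ennreal (?l (real N) (enn2real (\<rho> \<omega>)) \<omega>) \<partial>P x)"
    by (rule ennreal_integral_le_nn_integral) (simp add: discounted_def)
  also have "\<dots> \<le> (\<integral>\<^sup>+\<omega>. ennreal (?l T (enn2real (\<tau> \<omega>)) \<omega>) \<partial>P x)"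
  proof (intro nn_integral_mono ennreal_leI)
    fix \<omega> assume "\<omega> \<in> space (P x)"
    then have \<omega>: "\<omega> \<in> \<Omega>" by (simp add: space_P)
    have fin: "\<tau> \<omega> < \<infinity>" using \<tau>D(2)[OF \<omega>] by (rule le_less_trans) simp
    have eq: "ennreal (enn2real (\<tau> \<omega>)) = \<tau> \<omega>" using fin by simp
    show "?l (real N) (enn2real (\<rho> \<omega>)) \<omega> \<le> ?l T (enn2real (\<tau> \<omega>)) \<omega>"
    proof (cases "enn2real (\<tau> \<omega>) < real N")
      case True
      then have "ennreal (enn2real (\<tau> \<omega>)) \<le> ennreal (real N)" by (intro ennreal_leI) simp
      then have "\<rho> \<omega> = \<tau> \<omega>" unfolding eq \<rho>_def by (rule min_absorb1)
      with True assms show ?thesis by simp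
    next
      \<comment> \<open>Cut at \<open>N\<close>, the payoff consists of the running weight alone. Up
        to \<tau> this weight can only grow, and a stopping cost there multiplies it by at least
        1.\<close>
      case False
      then have "ennreal (real N) \<le> ennreal (enn2real (\<tau> \<omega>))" by (intro ennreal_leI) simp
      then have "\<rho> \<omega> = ennreal (real N)" unfolding eq \<rho>_def by (rule min_absorb2)
      moreover have le: "I (real N) \<omega> \<le> I (enn2real (\<tau> \<omega>)) \<omega>"
        using False I_mono[OF \<omega>] by simp
      moreover have "exp (I (real N) \<omega>) \<le> exp (I (enn2real (\<tau> \<omega>)) \<omega>) * h (X (enn2real (\<tau> \<omega>)) \<omega>)"
        using le G_nonneg by (simp add: add_increasing2 flip: exp_add)
      ultimately show ?thesis by (auto simp: discounted_def)
    qed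
  qed
  finally show "ennreal (w h x - gap_ratio (exp C) ^ N * exp C) \<le> stopped_expectation (P x) (lower_payoff X g G T) \<tau>"
    unfolding stopped_payoff_bounded(2)[OF \<tau>] .
qed

lemma upper_value_tendsto: "((\<lambda>T. upper_value_upto P F X g G T x) \<longlongrightarrow> ennreal (w h x)) at_top"
proof (rule order_tendstoI)
  show "\<forall>\<^sub>F T in at_top. a < upper_value_upto P F X g G T x" if "a < ennreal (w h x)" for a
    using less_le_trans[OF that w_le_upper_value] by simp
  fix a assume "ennreal (w h x) < a"
  then have "\<forall>\<^sub>F N in sequentially. ennreal (U N N h x) < a"
    by (intro order_tendstoD(2)[OF tendsto_ennrealI[OF U_tendsto_w[OF reward_h]]])
  then obtain N where N: "ennreal (U N N h x) < a" using eventually_happens'[OF sequentially_bot] by blast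
  show "\<forall>\<^sub>F T in at_top. upper_value_upto P F X g G T x < a"
    using eventually_ge_at_top[of "real N"]
    by eventually_elim (rule le_less_trans[OF upper_value_le N])
qed

lemma lower_value_tendsto: "((\<lambda>T. lower_value_upto P F X g G T x) \<longlongrightarrow> ennreal (w h x)) at_top"
proof (rule order_tendstoI)
  fix a assume a: "a < ennreal (w h x)"
  have "(\<lambda>N. w h x - gap_ratio (exp C) ^ N * exp C) \<longlonglongrightarrow> w h x - 0 * exp C"
    using gap_ratio_bounds[OF rewardD(6)[OF reward_h]]
    by (intro tendsto_intros LIMSEQ_power_zero) auto
  then have "(\<lambda>N. ennreal (w h x - gap_ratio (exp C) ^ N * exp C)) \<longlonglongrightarrow> ennreal (w h x)"
    by (intro tendsto_ennrealI) simp
  then have "\<forall>\<^sub>F N in sequentially. a < ennreal (w h x - gap_ratio (exp C) ^ N * exp C)"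
    using a by (rule order_tendstoD(1))
  then obtain N where N: "a < ennreal (w h x - gap_ratio (exp C) ^ N * exp C)"
    using eventually_happens'[OF sequentially_bot] by blast
  show "\<forall>\<^sub>F T in at_top. a < lower_value_upto P F X g G T x"
    using eventually_ge_at_top[of "real N"]
    by eventually_elim (rule less_le_trans[OF N lower_value_ge])
next
  fix a assume "ennreal (w h x) < a"
  with upper_value_tendsto have "\<forall>\<^sub>F T in at_top. upper_value_upto P F X g G T x < a"
    by (rule order_tendstoD(2))
  then show "\<forall>\<^sub>F T in at_top. lower_value_upto P F X g G T x < a"
    by eventually_elim (rule le_less_trans[OF lower_le_upper_value])
qed

lemma optimal_time_eq: "optimal_time P F X g G = hitting {y. w h y = h y}"
proof
  fix \<omega>
  have "ennreal (w h y) = ennreal (h y) \<longleftrightarrow> w h y = h y" for y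
    using w_bounds(1)[OF reward_h, of y] by (intro ennreal_inj) auto
  then show "optimal_time P F X g G \<omega> = hitting {y. w h y = h y} \<omega>"
    unfolding optimal_time_def hitting_def opt_value_eq by simp
qed

lemma optimal_time_attains:
  shows "optimal_time P F X g G \<in> finite_stopping_times (P x) (F x)"
    and "stopped_expectation (P x) (payoff X g G) (optimal_time P F X g G) = opt_value P F X g G x"
proof -
  show mem: "optimal_time P F X g G \<in> finite_stopping_times (P x) (F x)"
    unfolding optimal_time_eq finite_stopping_times_def
    using contact_time_optimal(1,2)[OF reward_h] by simp
  have "payoff X g G = discounted h" by (intro ext payoff_eq)
  then have "stopped_expectation (P x) (payoff X g G) (optimal_time P F X g G) \<le> ennreal (w h x)"
    unfolding optimal_time_eq using stopped_expectation_contact_time[OF reward_h] by simp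
  moreover have "opt_value P F X g G x \<le> stopped_expectation (P x) (payoff X g G) (optimal_time P F X g G)"
    unfolding opt_value_def by (rule INF_lower[OF mem])
  ultimately show "stopped_expectation (P x) (payoff X g G) (optimal_time P F X g G) = opt_value P F X g G x"
    unfolding opt_value_eq by (rule antisym)
qed

end

theorem theorem4p7:
  fixes \<Omega> :: "'w set"
    and P :: "'e::{metric_space, second_countable_topology} \<Rightarrow> 'w measure"
    and F :: "'e \<Rightarrow> ennreal \<Rightarrow> 'w measure"
    and X :: "real \<Rightarrow> 'w \<Rightarrow> 'e"
    and g G :: "'e \<Rightarrow> real"
    and c :: real
  assumes "standard_markov_process \<Omega> P F X"
    and "C0_feller P X"
    and "continuous_on UNIV g" "bounded (range g)" "\<And>x. g x \<ge> 0"
    and "continuous_on UNIV G" "bounded (range G)" "\<And>x. G x \<ge> 0"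
    and "c > 0" "\<And>x. g x \<ge> c"
  shows "(\<forall>x. opt_value P F X g G x < \<infinity>) \<and>
         continuous_on UNIV (\<lambda>x. enn2real (opt_value P F X g G x)) \<and>
         bounded (range (\<lambda>x. enn2real (opt_value P F X g G x))) \<and>
         (\<forall>x. ((\<lambda>T. lower_value_upto P F X g G T x) \<longlongrightarrow> lower_value P F X g G x) at_top \<and>
              ((\<lambda>T. upper_value_upto P F X g G T x) \<longlongrightarrow> upper_value P F X g G x) at_top \<and>
              lower_value P F X g G x = opt_value P F X g G x \<and>
              opt_value P F X g G x = upper_value P F X g G x) \<and>
         (\<forall>x. optimal_time P F X g G \<in> finite_stopping_times (P x) (F x) \<and>
              stopped_expectation (P x) (payoff X g G) (optimal_time P F X g G)
                = opt_value P F X g G x)"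
proof -
  obtain b where b: "\<And>x. \<bar>g x\<bar> \<le> b" using bounded_rangeE[OF assms(4)] by metis
  obtain C where C: "\<And>x. \<bar>G x\<bar> \<le> C" using bounded_rangeE[OF assms(7)] by metis
  interpret standard_markov_process \<Omega> P F X by (rule assms(1))
  interpret exponential_stopping_problem \<Omega> P F X g b c G C
    by unfold_locales (use assms b C abs_le_D1 in auto)
  have w_eq: "enn2real (ennreal (w h x)) = w h x" for x
    using w_bounds(1)[OF reward_h, of x] by simp
  have lower: "lower_value P F X g G x = ennreal (w h x)" for x
    unfolding lower_value_def by (rule tendsto_Lim[OF _ lower_value_tendsto]) simp
  have upper: "upper_value P F X g G x = ennreal (w h x)" for x
    unfolding upper_value_def by (rule tendsto_Lim[OF _ upper_value_tendsto]) simp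
  have "bounded (range (w h))" by (rule bcontfun_bounded[OF w_bcontfun[OF reward_h]])
  then show ?thesis
    unfolding opt_value_eq lower upper w_eq
    using w_continuous[OF reward_h] lower_value_tendsto upper_value_tendsto
      optimal_time_attains[unfolded opt_value_eq]
    by auto
qed

end
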